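(* Let $(X,S)$ and $(Y,T)$ be association schemes, and suppose that $(Y,T)$ is a quasi-thin scheme or a one-class scheme. Fix $x_0\in X$ and $y_0\in Y$, consider the wreath product $(X\times Y, S\wr T)$, and let $\mathcal{T}(S\wr T)=\mathcal{T}(X\times Y, S\wr T,(x_0,y_0))$ be its Terwilliger algebra with respect to $(x_0,y_0)$. With the matrices $e_{1_{\mathcal{T}(S\wr T)}}$, $\tilde e_\chi$, $\bar e_\varphi$, $\hat e_\psi^{(t)}$, $e_\eta$, $e_{\eta_i}$ defined in the context, the following hold. (1) If $(Y,T)$ is a thin scheme or a one-class scheme, then $$\{e_{1_{\mathcal{T}(S\wr T)}}\}\cup\{\tilde e_\chi\mid \chi\in \mathrm{Irr}(\mathcal{T}(U^{(1_Y)}))^\times\}\cup\bigcup_{t\in T\setminus\{1_Y\}}\{\bar e_\varphi\mid \varphi\in\mathrm{Irr}(\mathcal{A}(U^{(t)}))^\times\}$$ is the set of all central primitive idempotents of $\mathcal{T}(S\wr T)$. (2) If $(Y,T)$ is quasi-thin with $\emptyset\ne T^\bot\subseteq T_2$ or $|T^\bot|\ge 2$, then $$\{e_{1_{\mathcal{T}(S\wr T)}}\}\cup\{\tilde e_\chi\mid \chi\in \mathrm{Irr}(\mathcal{T}(U^{(1_Y)}))^\times\}\cup\bigcup_{t\in T_1\setminus\{1_Y\}}\{\bar e_\varphi\mid \varphi\in\mathrm{Irr}(\mathcal{A}(U^{(t)}))^\times\}\cup\bigcup_{t\in T_2}\{\hat e_\psi^{(t)}\mid \psi\in\mathrm{Irr}(\mathcal{A}(S))^\times\}\cup\{e_\eta\}$$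 is the set of all central primitive idempotents of $\mathcal{T}(S\wr T)$. (3) If $(Y,T)$ is quasi-thin with $|T^\bot|=1$ and $T^\bot\subseteq T_1$, then $$\{e_{1_{\mathcal{T}(S\wr T)}}\}\cup\{\tilde e_\chi\mid \chi\in \mathrm{Irr}(\mathcal{T}(U^{(1_Y)}))^\times\}\cup\bigcup_{t\in T_1\setminus\{1_Y\}}\{\bar e_\varphi\mid \varphi\in\mathrm{Irr}(\mathcal{A}(U^{(t)}))^\times\}\cup\bigcup_{t\in T_2}\{\hat e_\psi^{(t)}\mid \psi\in\mathrm{Irr}(\mathcal{A}(S))^\times\}\cup\{e_{\eta_i}\mid i\in I\setminus\{i_0\}\}$$ is the set of all central primitive idempotents of $\mathcal{T}(S\wr T)$.
   Context: Schemes. A coherent configuration on a finite set $X$ is a pair $(X,S)$ with $S$ a partition of $X\times X$ (into nonempty sets) such that: $1_X=\{(x,x)\mid x\in X\}$ is a union of elements of $S$; $s^*=\{(y,x)\mid(x,y)\in s\}\in S$ for $s\in S$; and for $s,t,u\in S$ the number $p_{st}^u=|\{z\mid (x,z)\in s,(z,y)\in t\}|$ is the same for all $(x,y)\in u$. It is a scheme (association scheme; not assumed commutative or symmetric) if $1_X\in S$. For $s\in S$, $xs=\{y\mid(x,y)\in s\}$, $n_s=p_{ss^*}^{1_X}$ is the valency, and $\sigma_s\in\mathrm{Mat}_X(\mathbb{C})$ is the $0/1$ adjacency matrix. A scheme is thin if all valencies are $1$, one-class if $|S|=2$. The complex product is $st=\{u\in S\mid p_{st}^u\neq 0\}$. Algebras.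 $I_X$, $J_X$ are the identity and all-one matrices; for $U,V\subseteq X$, $\varepsilon_U$ is the diagonal $0/1$ matrix with support $U$, and $J_{U,V}=\varepsilon_UJ_X\varepsilon_V$. For a scheme $(X,S)$, $\mathcal{A}(S)=\bigoplus_{s\in S}\mathbb{C}\sigma_s$ is the adjacency algebra, and the Terwilliger algebra $\mathcal{T}(X,S,x_0)$ is the subalgebra of $\mathrm{Mat}_X(\mathbb{C})$ generated by $\{\sigma_s\}_{s\in S}\cup\{\varepsilon_{x_0s}\}_{s\in S}$. Both are semisimple; $\mathrm{Irr}$ denotes the set of irreducible characters and $e_\chi$ the central primitive idempotent corresponding to $\chi$. The trivial character $1_{\mathcal{A}(S)}$ has idempotent $|X|^{-1}J_X$; the trivial character $1_{\mathcal{T}(S)}$ of $\mathcal{T}(X,S,x_0)$ has idempotent $e_{1_{\mathcal{T}(S)}}=\sum_{s\in S}n_s^{-1}\varepsilon_{x_0s}J_X\varepsilon_{x_0s}$. $\mathrm{Irr}(\cdot)^\times$ denotes $\mathrm{Irr}(\cdot)$ with the trivial character removed. (In particular $e_{1_{\mathcal{T}(S\wr T)}}$ is the trivial idempotent for the scheme $S\wr T$ and base point $(x_0,y_0)$.) Wreath product. For $s\in S$, $\tilde s=\{((x,y),(x',y))\mid (x,x')\in s,\ y\in Y\}$; for $t\in T$, $\bar t=\{((x,y),(x',y'))\mid x,x'\in X,\ (y,y')\in t\}$. $S\wr T=\{\tilde s\mid s\in S\}\cup\{\bar t\mid t\in T\setminus\{1_Y\}\}$. Thus $\sigma_{\tilde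 s}=\sigma_s\otimes I_Y$, $\sigma_{\bar t}=J_X\otimes\sigma_t$. Quasi-thin schemes. $(Y,T)$ is quasi-thin if $T=T_1\cup T_2$, where $T_i$ is the set of elements of $T$ of valency $i$. For $t\in T_2$ there is a unique $t^\bot\in T$ with $tt^*=\{1_Y,t^\bot\}$; set $T^\bot=\{t^\bot\mid t\in T_2\}$ (nonempty iff $(Y,T)$ is not thin). Idempotents. For $t\in T$ let $F^{(t)}=X\times y_0t$ and let $U^{(t)}$ be the set of nonempty relations $u\cap(F^{(t)}\times F^{(t)})$, $u\in S\wr T$; in the situations considered $(F^{(t)},U^{(t)})$ is a scheme. It is isomorphic to $(X,S)$ via the first coordinate if $n_t=1$; $\mathcal{T}(U^{(1_Y)})$ is its Terwilliger algebra with respect to $(x_0,y_0)$, identified with $\mathcal{T}(X,S,x_0)$. - For $\chi\in\mathrm{Irr}(\mathcal{T}(U^{(1_Y)}))^\times$: $\tilde e_\chi=e_\chi\otimes\varepsilon_{\{y_0\}}$. - For $t\in T\setminus\{1_Y\}$ and $\varphi\in\mathrm{Irr}(\mathcal{A}(U^{(t)}))^\times$: $\bar e_\varphi$ is the matrix in $\mathrm{Mat}_{X\times Y}(\mathbb{C})$ obtained by extending $e_\varphi\in\mathrm{Mat}_{F^{(t)}}(\mathbb{C})$ by zero. For $t\in T_1$ this is $e_\varphi\otimes\varepsilon_{y_0t}$ under the identification $U^{(t)}\cong S$. - For $t\in T_2$ and $\psi\in\mathrm{Irr}(\mathcal{A}(S))^\times$: $\hat e_\psi^{(t)}=e_\psi\otimes\varepsilon_{y_0t}$.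 - For $t\in T_2$ write $y_0t=\{y_{t(1)},y_{t(2)}\}$ and $\overline{\varepsilon_{y_0t}}=J_{\{y_{t(1)}\},\{y_{t(2)}\}}+J_{\{y_{t(2)}\},\{y_{t(1)}\}}$. In case (2), $e_\eta=\sum_{t\in T_2}\frac{1}{2|X|}J_X\otimes(\varepsilon_{y_0t}-\overline{\varepsilon_{y_0t}})$. - In case (3), let $H=\{1_Y\}\cup T^\bot$ (this is the thin residue of $T$), for $y\in Y$ let $yH=\bigcup_{h\in H}yh$, and $Y/H=\{yH\mid y\in Y\}$. Let $T_{(H)}$ be the set of nonempty relations $t\cap(\Delta\times\Gamma)$, $t\in T$, $\Delta,\Gamma\in Y/H$; $(Y,T_{(H)})$ is a coherent configuration. For $\Delta,\Gamma\in Y/H$ put $\Delta\sim\Gamma$ iff $\Delta\times\Gamma\notin T_{(H)}$; this is an equivalence relation on $Y/H$. Let $I$ be its set of classes, $Y_i$ the union of the members of the class $i\in I$, and $i_0\in I$ the class with $y_0\in Y_{i_0}$. For $i\in I\setminus\{i_0\}$ let $U_i=\{t\in T_2\mid y_0t\subseteq Y_i\}$ and $e_{\eta_i}=\sum_{t\in U_i}\frac{1}{2|X|}J_X\otimes(\varepsilon_{y_0t}-\overline{\varepsilon_{y_0t}})$. *)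

theory Defs
  imports
    "HOL-Library.Disjoint_Sets"
    "HOL-Library.Function_Algebras"
    "Jordan_Normal_Form.VS_Connect"
begin

section \<open>Coherent configurations and association schemes\<close>

definition coherent_configuration :: "'a set \<Rightarrow> ('a \<times> 'a) set set \<Rightarrow> bool" where
  "coherent_configuration X S \<longleftrightarrow>
     finite X \<and> partition_on (X \<times> X) S \<and>
     (\<exists>D\<subseteq>S. \<Union>D = Id_on X) \<and>
     (\<forall>s\<in>S. s\<inverse> \<in> S) \<and>
     (\<forall>s\<in>S. \<forall>t\<in>S. \<forall>u\<in>S. \<forall>(x, y)\<in>u. \<forall>(x', y')\<in>u.
        card {z. (x, z) \<in> s \<and> (z, y) \<in> t} = card {z. (x', z) \<in> s \<and> (z, y') \<in> t})"

definition scheme :: "'a set \<Rightarrow> ('a \<times> 'a) set set \<Rightarrow> bool" where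
  "scheme X S \<longleftrightarrow> coherent_configuration X S \<and> Id_on X \<in> S"

definition intersection_number ::
    "('a \<times> 'a) set \<Rightarrow> ('a \<times> 'a) set \<Rightarrow> ('a \<times> 'a) set \<Rightarrow> nat" where
  "intersection_number s t u =
     (THE n. \<forall>(x, y)\<in>u. card {z. (x, z) \<in> s \<and> (z, y) \<in> t} = n)"

definition complex_product ::
    "('a \<times> 'a) set set \<Rightarrow> ('a \<times> 'a) set \<Rightarrow> ('a \<times> 'a) set \<Rightarrow> ('a \<times> 'a) set set" where
  "complex_product S s t = {u \<in> S. intersection_number s t u \<noteq> 0}"

definition valency :: "'a set \<Rightarrow> ('a \<times> 'a) set \<Rightarrow> nat" where
  "valency X s = intersection_number s (s\<inverse>) (Id_on X)"

definition valency_part :: "'a set \<Rightarrow> ('a \<times> 'a) set set \<Rightarrow> nat \<Rightarrow> ('a \<times> 'a) set set" where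
  "valency_part X S i = {s \<in> S. valency X s = i}"

definition thin :: "'a set \<Rightarrow> ('a \<times> 'a) set set \<Rightarrow> bool" where
  "thin X S \<longleftrightarrow> (\<forall>s\<in>S. valency X s = 1)"

definition one_class_scheme :: "('a \<times> 'a) set set \<Rightarrow> bool" where
  "one_class_scheme S \<longleftrightarrow> card S = 2"

definition quasi_thin :: "'a set \<Rightarrow> ('a \<times> 'a) set set \<Rightarrow> bool" where
  "quasi_thin X S \<longleftrightarrow> S = valency_part X S 1 \<union> valency_part X S 2"

text \<open>The element \<open>t\<^sup>\<bottom>\<close> for \<open>t\<close> of valency 2, and the set of all of them.\<close>

definition orth :: "'a set \<Rightarrow> ('a \<times> 'a) set set \<Rightarrow> ('a \<times> 'a) set \<Rightarrow> ('a \<times> 'a) set" where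
  "orth X S t = (THE u. u \<in> S \<and> complex_product S t (t\<inverse>) = {Id_on X, u})"

definition orth_set :: "'a set \<Rightarrow> ('a \<times> 'a) set set \<Rightarrow> ('a \<times> 'a) set set" where
  "orth_set X S = orth X S ` valency_part X S 2"

text \<open>Nonempty restrictions to \<open>F\<close> of the relations in \<open>S\<close>.\<close>

definition restrict_relations :: "'a set \<Rightarrow> ('a \<times> 'a) set set \<Rightarrow> ('a \<times> 'a) set set" where
  "restrict_relations F S = {u \<inter> F \<times> F | u. u \<in> S} - {{}}"

definition wreath_tilde :: "'b set \<Rightarrow> ('a \<times> 'a) set \<Rightarrow> (('a \<times> 'b) \<times> ('a \<times> 'b)) set" where
  "wreath_tilde Y s = {((x, y), (x', y)) | x x' y. (x, x') \<in> s \<and> y \<in> Y}"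

definition wreath_bar :: "'a set \<Rightarrow> ('b \<times> 'b) set \<Rightarrow> (('a \<times> 'b) \<times> ('a \<times> 'b)) set" where
  "wreath_bar X t = {((x, y), (x', y')) | x x' y y'. x \<in> X \<and> x' \<in> X \<and> (y, y') \<in> t}"

definition wreath ::
    "'a set \<Rightarrow> ('a \<times> 'a) set set \<Rightarrow> 'b set \<Rightarrow> ('b \<times> 'b) set set
      \<Rightarrow> (('a \<times> 'b) \<times> ('a \<times> 'b)) set set" where
  "wreath X S Y T = wreath_tilde Y ` S \<union> wreath_bar X ` (T - {Id_on Y})"


section \<open>Matrices indexed by finite sets\<close>

text \<open>
  An element of \<open>Mat\<^sub>X(\<complex>)\<close> is a function on pairs that vanishes outside \<open>X \<times> X\<close>.  Hence, for
  \<open>F \<subseteq> X\<close>, a matrix over \<open>F\<close> and its extension by zero to \<open>X\<close> are the same function.  Sums,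
  differences and zero of matrices are the pointwise ones of \<open>Function_Algebras\<close>; the pointwise
  \<open>*\<close> and \<open>1\<close> given there are not the matrix operations and are never used on matrices.
\<close>

type_synonym 'a cmat = "'a \<Rightarrow> 'a \<Rightarrow> complex"

definition Mat :: "'a set \<Rightarrow> 'a cmat set" where
  "Mat X = {M. \<forall>x y. M x y \<noteq> 0 \<longrightarrow> x \<in> X \<and> y \<in> X}"

definition cm_mult :: "'a set \<Rightarrow> 'a cmat \<Rightarrow> 'a cmat \<Rightarrow> 'a cmat" where
  "cm_mult X M N = (\<lambda>x y. \<Sum>z\<in>X. M x z * N z y)"

definition cm_scale :: "complex \<Rightarrow> 'a cmat \<Rightarrow> 'a cmat" where
  "cm_scale c M = (\<lambda>x y. c * M x y)"

definition sigma :: "('a \<times> 'a) set \<Rightarrow> 'a cmat" where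
  "sigma s = (\<lambda>x y. of_bool ((x, y) \<in> s))"

text \<open>\<open>eps U\<close> is \<open>\<epsilon>\<^sub>U\<close> (so \<open>eps X\<close> is the identity of \<open>Mat X\<close>), and \<open>Jm U V\<close> is \<open>J\<^sub>U\<^sub>,\<^sub>V\<close>.\<close>

definition eps :: "'a set \<Rightarrow> 'a cmat" where
  "eps U = (\<lambda>x y. of_bool (x = y \<and> x \<in> U))"

definition Jm :: "'a set \<Rightarrow> 'a set \<Rightarrow> 'a cmat" where
  "Jm U V = (\<lambda>x y. of_bool (x \<in> U \<and> y \<in> V))"

definition kron :: "'a cmat \<Rightarrow> 'b cmat \<Rightarrow> ('a \<times> 'b) cmat" where
  "kron M N = (\<lambda>(x, y) (x', y'). M x x' * N y y')"

definition subalgebra :: "'a set \<Rightarrow> 'a cmat set \<Rightarrow> bool" where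
  "subalgebra X A \<longleftrightarrow>
     A \<subseteq> Mat X \<and> eps X \<in> A \<and>
     (\<forall>M\<in>A. \<forall>N\<in>A. M + N \<in> A \<and> cm_mult X M N \<in> A) \<and>
     (\<forall>c. \<forall>M\<in>A. cm_scale c M \<in> A)"

definition generated_subalgebra :: "'a set \<Rightarrow> 'a cmat set \<Rightarrow> 'a cmat set" where
  "generated_subalgebra X G = \<Inter>{A. subalgebra X A \<and> G \<subseteq> A}"

definition adjacency_algebra :: "('a \<times> 'a) set set \<Rightarrow> 'a cmat set" where
  "adjacency_algebra S = {\<Sum>s\<in>S. cm_scale (c s) (sigma s) | c. True}"

definition terwilliger_algebra :: "'a set \<Rightarrow> ('a \<times> 'a) set set \<Rightarrow> 'a \<Rightarrow> 'a cmat set" where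
  "terwilliger_algebra X S x\<^sub>0 =
     generated_subalgebra X (sigma ` S \<union> (\<lambda>s. eps (s `` {x\<^sub>0})) ` S)"


section \<open>Irreducible characters and central primitive idempotents\<close>

text \<open>In this section \<open>A\<close> is a subalgebra of \<open>Mat X\<close> with identity \<open>eps X\<close>.\<close>

definition center :: "'a set \<Rightarrow> 'a cmat set \<Rightarrow> 'a cmat set" where
  "center X A = {M \<in> A. \<forall>N\<in>A. cm_mult X M N = cm_mult X N M}"

definition central_idempotents :: "'a set \<Rightarrow> 'a cmat set \<Rightarrow> 'a cmat set" where
  "central_idempotents X A = {e \<in> center X A. cm_mult X e e = e}"

definition central_primitive_idempotents :: "'a set \<Rightarrow> 'a cmat set \<Rightarrow> 'a cmat set" where
  "central_primitive_idempotents X A =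
     {e \<in> central_idempotents X A. e \<noteq> 0 \<and>
       (\<forall>f \<in> central_idempotents X A. \<forall>g \<in> central_idempotents X A.
          cm_mult X f g = 0 \<and> e = f + g \<longrightarrow> f = 0 \<or> g = 0)}"

definition representation ::
    "'a set \<Rightarrow> 'a cmat set \<Rightarrow> nat \<Rightarrow> ('a cmat \<Rightarrow> complex mat) \<Rightarrow> bool" where
  "representation X A n \<rho> \<longleftrightarrow>
     (\<forall>M\<in>A. \<rho> M \<in> carrier_mat n n) \<and>
     \<rho> (eps X) = 1\<^sub>m n \<and>
     (\<forall>M\<in>A. \<forall>N\<in>A. \<rho> (M + N) = \<rho> M + \<rho> N \<and> \<rho> (cm_mult X M N) = \<rho> M * \<rho> N) \<and>
     (\<forall>c. \<forall>M\<in>A. \<rho> (cm_scale c M) = c \<cdot>\<^sub>m \<rho> M)"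

definition irreducible_representation ::
    "'a set \<Rightarrow> 'a cmat set \<Rightarrow> nat \<Rightarrow> ('a cmat \<Rightarrow> complex mat) \<Rightarrow> bool" where
  "irreducible_representation X A n \<rho> \<longleftrightarrow>
     representation X A n \<rho> \<and> n > 0 \<and>
     (\<forall>W. VectorSpace.subspace class_ring W (module_vec TYPE(complex) n) \<and>
          (\<forall>M\<in>A. \<forall>w\<in>W. \<rho> M *\<^sub>v w \<in> W)
        \<longrightarrow> W = {0\<^sub>v n} \<or> W = carrier_vec n)"

text \<open>Characters are functions on \<open>A\<close>; the value 0 outside \<open>A\<close> is a convention that makes
  characters agreeing on \<open>A\<close> equal.\<close>

definition character :: "'a cmat set \<Rightarrow> nat \<Rightarrow> ('a cmat \<Rightarrow> complex mat) \<Rightarrow> 'a cmat \<Rightarrow> complex" where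
  "character A n \<rho> = (\<lambda>M. if M \<in> A then \<Sum>i<n. \<rho> M $$ (i, i) else 0)"

definition Irr :: "'a set \<Rightarrow> 'a cmat set \<Rightarrow> ('a cmat \<Rightarrow> complex) set" where
  "Irr X A = {character A n \<rho> | n \<rho>. irreducible_representation X A n \<rho>}"

text \<open>\<open>e\<^sub>\<chi>\<close>: the central primitive idempotent that does not vanish under \<open>\<chi>\<close>.\<close>

definition idempotent_of :: "'a set \<Rightarrow> 'a cmat set \<Rightarrow> ('a cmat \<Rightarrow> complex) \<Rightarrow> 'a cmat" where
  "idempotent_of X A \<chi> = (THE e. e \<in> central_primitive_idempotents X A \<and> \<chi> e \<noteq> 0)"

text \<open>The trivial characters of adjacency and Terwilliger algebras are the irreducible characters
  belonging to the idempotents \<open>trivial_idempotent_A\<close> and \<open>trivial_idempotent_T\<close> below.\<close>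

definition character_of_idempotent ::
    "'a set \<Rightarrow> 'a cmat set \<Rightarrow> 'a cmat \<Rightarrow> ('a cmat \<Rightarrow> complex)" where
  "character_of_idempotent X A e = (THE \<chi>. \<chi> \<in> Irr X A \<and> idempotent_of X A \<chi> = e)"

definition trivial_idempotent_A :: "'a set \<Rightarrow> 'a cmat" where
  "trivial_idempotent_A X = cm_scale (1 / of_nat (card X)) (Jm X X)"

definition trivial_idempotent_T :: "'a set \<Rightarrow> ('a \<times> 'a) set set \<Rightarrow> 'a \<Rightarrow> 'a cmat" where
  "trivial_idempotent_T X S x\<^sub>0 =
     (\<Sum>s\<in>S. cm_scale (1 / of_nat (valency X s)) (Jm (s `` {x\<^sub>0}) (s `` {x\<^sub>0})))"

definition Irr_nontrivial_A :: "'a set \<Rightarrow> ('a \<times> 'a) set set \<Rightarrow> ('a cmat \<Rightarrow> complex) set" where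
  "Irr_nontrivial_A X S =
     (let A = adjacency_algebra S
      in Irr X A - {character_of_idempotent X A (trivial_idempotent_A X)})"

definition Irr_nontrivial_T ::
    "'a set \<Rightarrow> ('a \<times> 'a) set set \<Rightarrow> 'a \<Rightarrow> ('a cmat \<Rightarrow> complex) set" where
  "Irr_nontrivial_T X S x\<^sub>0 =
     (let A = terwilliger_algebra X S x\<^sub>0
      in Irr X A - {character_of_idempotent X A (trivial_idempotent_T X S x\<^sub>0)})"


section \<open>The idempotents of the Terwilliger algebra of a wreath product\<close>

text \<open>The sets \<open>F\<^sup>(\<^sup>t\<^sup>) = X \<times> y\<^sub>0t\<close> and \<open>U\<^sup>(\<^sup>t\<^sup>)\<close>.\<close>

definition Ft :: "'a set \<Rightarrow> 'b \<Rightarrow> ('b \<times> 'b) set \<Rightarrow> ('a \<times> 'b) set" where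
  "Ft X y\<^sub>0 t = X \<times> (t `` {y\<^sub>0})"

definition Ut ::
    "'a set \<Rightarrow> ('a \<times> 'a) set set \<Rightarrow> 'b set \<Rightarrow> ('b \<times> 'b) set set \<Rightarrow> 'b \<Rightarrow> ('b \<times> 'b) set
      \<Rightarrow> (('a \<times> 'b) \<times> ('a \<times> 'b)) set set" where
  "Ut X S Y T y\<^sub>0 t = restrict_relations (Ft X y\<^sub>0 t) (wreath X S Y T)"

text \<open>The identification of \<open>Mat (X \<times> {y\<^sub>0})\<close> with \<open>Mat X\<close>.\<close>

definition first_coordinate :: "'b \<Rightarrow> ('a \<times> 'b) cmat \<Rightarrow> 'a cmat" where
  "first_coordinate y\<^sub>0 M = (\<lambda>x x'. M (x, y\<^sub>0) (x', y\<^sub>0))"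

definition e_tilde ::
    "'a set \<Rightarrow> ('a \<times> 'a) set set \<Rightarrow> 'b set \<Rightarrow> ('b \<times> 'b) set set \<Rightarrow> 'a \<Rightarrow> 'b
      \<Rightarrow> (('a \<times> 'b) cmat \<Rightarrow> complex) \<Rightarrow> ('a \<times> 'b) cmat" where
  "e_tilde X S Y T x\<^sub>0 y\<^sub>0 \<chi> =
     (let F = Ft X y\<^sub>0 (Id_on Y); U = Ut X S Y T y\<^sub>0 (Id_on Y)
      in kron (first_coordinate y\<^sub>0 (idempotent_of F (terwilliger_algebra F U (x\<^sub>0, y\<^sub>0)) \<chi>))
              (eps {y\<^sub>0}))"

text \<open>No explicit extension by zero is needed in the next definition, because elements of
  \<open>Mat F\<close> already vanish outside \<open>F \<times> F\<close>.\<close>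

definition e_bar ::
    "'a set \<Rightarrow> ('a \<times> 'a) set set \<Rightarrow> 'b set \<Rightarrow> ('b \<times> 'b) set set \<Rightarrow> 'b \<Rightarrow> ('b \<times> 'b) set
      \<Rightarrow> (('a \<times> 'b) cmat \<Rightarrow> complex) \<Rightarrow> ('a \<times> 'b) cmat" where
  "e_bar X S Y T y\<^sub>0 t \<phi> =
     idempotent_of (Ft X y\<^sub>0 t) (adjacency_algebra (Ut X S Y T y\<^sub>0 t)) \<phi>"

definition e_hat ::
    "'a set \<Rightarrow> ('a \<times> 'a) set set \<Rightarrow> 'b \<Rightarrow> ('b \<times> 'b) set
      \<Rightarrow> ('a cmat \<Rightarrow> complex) \<Rightarrow> ('a \<times> 'b) cmat" where
  "e_hat X S y\<^sub>0 t \<psi> =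
     kron (idempotent_of X (adjacency_algebra S) \<psi>) (eps (t `` {y\<^sub>0}))"

text \<open>For \<open>V = {a, b}\<close> with \<open>a \<noteq> b\<close>, the following is \<open>J\<close> on \<open>{a} \<times> {b}\<close> plus \<open>J\<close> on \<open>{b} \<times> {a}\<close>.\<close>

definition eps_overline :: "'b set \<Rightarrow> 'b cmat" where
  "eps_overline V = (\<Sum>(a, b) \<in> {(a, b). a \<in> V \<and> b \<in> V \<and> a \<noteq> b}. Jm {a} {b})"

lemma eps_overline_doubleton:
  assumes "a \<noteq> b"
  shows "eps_overline {a, b} = Jm {a} {b} + Jm {b} {a}"
proof -
  have "{(x, y). x \<in> {a, b} \<and> y \<in> {a, b} \<and> x \<noteq> y} = {(a, b), (b, a)}"
    using assms by auto
  then show ?thesis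
    using assms by (simp add: eps_overline_def)
qed

text \<open>The matrices \<open>e\<^sub>\<eta>\<close> (with \<open>U = T\<^sub>2\<close>) and \<open>e\<^sub>\<eta>\<^sub>i\<close> (with \<open>U = U\<^sub>i\<close>).\<close>

definition e_eta :: "'a set \<Rightarrow> 'b \<Rightarrow> ('b \<times> 'b) set set \<Rightarrow> ('a \<times> 'b) cmat" where
  "e_eta X y\<^sub>0 U =
     (\<Sum>t\<in>U. cm_scale (1 / (2 * of_nat (card X)))
        (kron (Jm X X) (eps (t `` {y\<^sub>0}) - eps_overline (t `` {y\<^sub>0}))))"

definition H_set :: "'b set \<Rightarrow> ('b \<times> 'b) set set \<Rightarrow> ('b \<times> 'b) set set" where
  "H_set Y T = {Id_on Y} \<union> orth_set Y T"

definition H_cosets :: "'b set \<Rightarrow> ('b \<times> 'b) set set \<Rightarrow> 'b set set" where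
  "H_cosets Y T = (\<lambda>y. \<Union>h\<in>H_set Y T. h `` {y}) ` Y"

definition T_H :: "'b set \<Rightarrow> ('b \<times> 'b) set set \<Rightarrow> ('b \<times> 'b) set set" where
  "T_H Y T =
     {t \<inter> \<Delta> \<times> \<Gamma> | t \<Delta> \<Gamma>. t \<in> T \<and> \<Delta> \<in> H_cosets Y T \<and> \<Gamma> \<in> H_cosets Y T} - {{}}"

definition I_classes :: "'b set \<Rightarrow> ('b \<times> 'b) set set \<Rightarrow> 'b set set set" where
  "I_classes Y T =
     H_cosets Y T // {(\<Delta>, \<Gamma>). \<Delta> \<in> H_cosets Y T \<and> \<Gamma> \<in> H_cosets Y T \<and> \<Delta> \<times> \<Gamma> \<notin> T_H Y T}"

text \<open>The set \<open>I \<setminus> {i\<^sub>0}\<close>: a class \<open>i\<close> has \<open>Y\<^sub>i = \<Union>i\<close>, and \<open>i\<^sub>0\<close> is the class with \<open>y\<^sub>0 \<in> \<Union>i\<^sub>0\<close>.\<close>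

definition I_classes_off :: "'b set \<Rightarrow> ('b \<times> 'b) set set \<Rightarrow> 'b \<Rightarrow> 'b set set set" where
  "I_classes_off Y T y\<^sub>0 = I_classes Y T - {THE i. i \<in> I_classes Y T \<and> y\<^sub>0 \<in> \<Union>i}"

definition U_class :: "'b set \<Rightarrow> ('b \<times> 'b) set set \<Rightarrow> 'b \<Rightarrow> 'b set set \<Rightarrow> ('b \<times> 'b) set set" where
  "U_class Y T y\<^sub>0 i = {t \<in> valency_part Y T 2. t `` {y\<^sub>0} \<subseteq> \<Union>i}"

end

theory Submission
  imports Defs
begin

text \<open>
  Decompose \<open>Y\<close> into the fibres \<open>y\<^sub>0t\<close>.  The Terwilliger algebra of \<open>S \<wreath> T\<close> is generated by the matrices
  \<open>\<sigma>\<^sub>s \<otimes> I\<close>, which preserve the blocks over the fibres, by the matrices \<open>J\<^sub>X \<otimes> \<sigma>\<^sub>t\<close>, and by the block projections.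
  Everything that mixes fibres thus factors through \<open>J\<^sub>X\<close>, and multiplying by \<open>I - J\<^sub>X / |X|\<close> on a fibre (by
  \<open>I - J\<^sub>F / |F|\<close> on \<open>F = X \<times> y\<^sub>0t\<close> in the one-class case), or by the complement of the trivial idempotent on the
  base fibre, leaves a corner that is a corner of a smaller algebra:
  the Terwilliger algebra of \<open>S\<close> over \<open>y\<^sub>0\<close> (\<open>base_corner\<close>), the adjacency algebra of \<open>S\<close> over a fibre
  (\<open>hat_corner\<close>), and the adjacency algebra of \<open>U\<^sup>(\<^sup>t\<^sup>)\<close> if the fibre is a point or \<open>T\<close> has one class
  (\<open>bar_corner\<close>).  In each of them exactly the trivial idempotent is missing.  What remains is the part \<open>J\<^sub>X / |X|\<close>
  tensored with the Terwilliger algebra of \<open>T\<close>: it consists of the trivial idempotent and, for a quasi-thin \<open>T\<close>, of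
  the alternating vectors on the fibres with two points.

  Two fibres with two points are linked if the block of some \<open>\<sigma>\<^sub>u\<close> between them is a perfect matching.  A matching
  carries alternating vectors to alternating vectors and all other blocks kill them.  Hence the projections onto
  the alternating vectors of one connected component of the linking relation add up to a primitive central
  idempotent (\<open>eta_primitive\<close>).  Unlinked relations have the same \<open>t\<^sup>\<bottom>\<close>, and it has valency 1
  (\<open>unlinked_orth\<close>).  This makes the linking relation connected in the second case (\<open>linked_connected\<close>).  In the
  third case, linking means that the points of the fibres are related by a relation of valency 1, and the
  components are the sets \<open>U\<^sub>i\<close> (\<open>U_class_components\<close>).

  Three general facts turn this into a list of all primitive central idempotents.  If no nonzero matrix is
  annihilated by a given set of central idempotents, every primitive central idempotent lies below one of them
  (\<open>cpis_cover\<close>), and a corner determines the primitive central idempotents below it (\<open>cpis_below_corner\<close>).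
  A central idempotent generated as an ideal by a matrix of rank one is primitive (\<open>cpi_of_scalar_corner\<close>).

  Irreducible characters enter only through the primitive central idempotents they belong to.  An irreducible
  representation sends exactly one primitive central idempotent to the identity (\<open>irreducible_unique_cpi\<close>), and
  each one occurs, on a minimal invariant subspace of its image (\<open>irreducible_representation_exists\<close>).  Removing
  the trivial character removes exactly the trivial idempotent because it is the only irreducible character
  belonging to it, which follows from a rank-one generator of that ideal and a trace computation (\<open>scalar_corner_character_unique\<close>).
\<close>

section \<open>Matrix arithmetic\<close>

lemma sum_fun_apply2: "(\<Sum>i\<in>I. M i) x y = (\<Sum>i\<in>I. M i x y)"
  for M :: "'i \<Rightarrow> 'x \<Rightarrow> 'y \<Rightarrow> 'z::comm_monoid_add"
  by (induction I rule: infinite_finite_induct) auto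

lemma Mat_I: "(\<And>x y. M x y \<noteq> 0 \<Longrightarrow> x \<in> X \<and> y \<in> X) \<Longrightarrow> M \<in> Mat X"
  by (auto simp: Mat_def)

lemma Mat_outside: "M \<in> Mat X \<Longrightarrow> x \<notin> X \<or> y \<notin> X \<Longrightarrow> M x y = 0"
  by (auto simp: Mat_def)

lemma Mat_mult: "M \<in> Mat X \<Longrightarrow> N \<in> Mat X \<Longrightarrow> cm_mult X M N \<in> Mat X"
proof (rule Mat_I)
  fix x y assume M: "M \<in> Mat X" and N: "N \<in> Mat X" and "cm_mult X M N x y \<noteq> 0"
  then obtain z where "M x z * N z y \<noteq> 0"
    unfolding cm_mult_def by (meson sum.not_neutral_contains_not_neutral)
  then show "x \<in> X \<and> y \<in> X" using M N Mat_outside by fastforce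
qed

lemma Mat_add: "M \<in> Mat X \<Longrightarrow> N \<in> Mat X \<Longrightarrow> M + N \<in> Mat X"
  by (rule Mat_I) (metis Mat_outside add_0 plus_fun_apply)

lemma Mat_scale: "M \<in> Mat X \<Longrightarrow> cm_scale c M \<in> Mat X"
  by (auto simp: Mat_def cm_scale_def)

lemma eps_in_Mat: "U \<subseteq> X \<Longrightarrow> eps U \<in> Mat X"
  by (auto simp: Mat_def eps_def)

lemma Jm_in_Mat: "U \<subseteq> X \<Longrightarrow> V \<subseteq> X \<Longrightarrow> Jm U V \<in> Mat X"
  by (auto simp: Mat_def Jm_def)

lemma cm_mult_assoc:
  "cm_mult X (cm_mult X L M) N = cm_mult X L (cm_mult X M N)"
  unfolding cm_mult_def fun_eq_iff
  by (auto simp: sum_distrib_left sum_distrib_right mult.assoc intro: sum.swap)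

lemma cm_mult_add_left: "cm_mult X (L + M) N = cm_mult X L N + cm_mult X M N"
  and cm_mult_add_right: "cm_mult X N (L + M) = cm_mult X N L + cm_mult X N M"
  and cm_mult_diff_left: "cm_mult X (L - M) N = cm_mult X L N - cm_mult X M N"
  and cm_mult_diff_right: "cm_mult X N (L - M) = cm_mult X N L - cm_mult X N M"
  by (auto simp: cm_mult_def fun_eq_iff algebra_simps sum.distrib sum_subtractf)

lemma cm_mult_zero_left [simp]: "cm_mult X 0 N = 0"
  and cm_mult_zero_right [simp]: "cm_mult X N 0 = 0"
  by (auto simp: cm_mult_def fun_eq_iff)

lemma cm_mult_scale_left: "cm_mult X (cm_scale c M) N = cm_scale c (cm_mult X M N)"
  and cm_mult_scale_right: "cm_mult X M (cm_scale c N) = cm_scale c (cm_mult X M N)"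
  by (auto simp: cm_mult_def cm_scale_def fun_eq_iff sum_distrib_left algebra_simps)

lemma cm_mult_sum_left: "cm_mult X (\<Sum>i\<in>I. M i) N = (\<Sum>i\<in>I. cm_mult X (M i) N)"
  by (simp add: fun_eq_iff cm_mult_def sum_fun_apply2 sum_distrib_right sum.swap[of _ I X])

lemma cm_mult_sum_right: "cm_mult X N (\<Sum>i\<in>I. M i) = (\<Sum>i\<in>I. cm_mult X N (M i))"
  by (simp add: fun_eq_iff cm_mult_def sum_fun_apply2 sum_distrib_left sum.swap[of _ I X])

lemma cm_scale_simps [simp]:
  "cm_scale 0 M = 0" "cm_scale 1 M = M" "cm_scale c 0 = 0"
  "cm_scale c (cm_scale d M) = cm_scale (c * d) M"
  by (auto simp: cm_scale_def fun_eq_iff)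

lemma cm_scale_eq_0: "cm_scale c M = 0 \<Longrightarrow> c = 0 \<or> M = 0"
  by (auto simp: cm_scale_def fun_eq_iff)

lemma cm_mult_eps_left:
  assumes "finite X"
  shows "cm_mult X (eps U) M = (\<lambda>x y. of_bool (x \<in> U \<inter> X) * M x y)"
proof (intro ext)
  fix x y
  have "cm_mult X (eps U) M x y = (\<Sum>z\<in>X. if z = x then of_bool (x \<in> U) * M x y else 0)"
    unfolding cm_mult_def eps_def by (auto intro!: sum.cong)
  then show "cm_mult X (eps U) M x y = of_bool (x \<in> U \<inter> X) * M x y"
    using assms by (simp add: sum.delta)
qed

lemma cm_mult_eps_right:
  assumes "finite X"
  shows "cm_mult X M (eps U) = (\<lambda>x y. M x y * of_bool (y \<in> U \<inter> X))"
proof (intro ext)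
  fix x y
  have "cm_mult X M (eps U) x y = (\<Sum>z\<in>X. if z = y then M x y * of_bool (y \<in> U) else 0)"
    unfolding cm_mult_def eps_def by (auto intro!: sum.cong)
  then show "cm_mult X M (eps U) x y = M x y * of_bool (y \<in> U \<inter> X)"
    using assms by (simp add: sum.delta)
qed

lemma cm_mult_one_left: "finite X \<Longrightarrow> M \<in> Mat X \<Longrightarrow> cm_mult X (eps X) M = M"
  by (auto simp: cm_mult_eps_left fun_eq_iff Mat_outside)

lemma cm_mult_one_right: "finite X \<Longrightarrow> M \<in> Mat X \<Longrightarrow> cm_mult X M (eps X) = M"
  by (auto simp: cm_mult_eps_right fun_eq_iff Mat_outside)

text \<open>The outer terms of the sum vanish, so a product in which one factor is supported on a diagonal
  block may be computed in the block or in the whole matrix algebra.\<close>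

lemma cm_mult_superset:
  assumes "finite X" "F \<subseteq> X" "M \<in> Mat F \<or> N \<in> Mat F"
  shows "cm_mult X M N = cm_mult F M N"
  unfolding cm_mult_def fun_eq_iff using assms
  by (auto intro!: sum.mono_neutral_right simp: Mat_outside)

lemma cm_mult_kron:
  "cm_mult (X \<times> Y) (kron A B) (kron C D) = kron (cm_mult X A C) (cm_mult Y B D)"
  by (auto simp: cm_mult_def kron_def fun_eq_iff sum_product sum.cartesian_product
      intro!: sum.cong)

lemma kron_add_left: "kron (A + B) C = kron A C + kron B C"
  and kron_add_right: "kron C (A + B) = kron C A + kron C B"
  and kron_diff_left: "kron (A - B) C = kron A C - kron B C"
  and kron_diff_right: "kron C (A - B) = kron C A - kron C B"
  by (auto simp: kron_def fun_eq_iff algebra_simps)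

lemma kron_zero_left [simp]: "kron 0 C = 0"
  and kron_zero_right [simp]: "kron C 0 = 0"
  by (auto simp: kron_def fun_eq_iff)

lemma kron_scale_left: "kron (cm_scale c A) B = cm_scale c (kron A B)"
  and kron_scale_right: "kron A (cm_scale c B) = cm_scale c (kron A B)"
  by (auto simp: kron_def cm_scale_def fun_eq_iff)

lemma kron_sum_left: "kron (\<Sum>i\<in>I. A i) B = (\<Sum>i\<in>I. kron (A i) B)"
  by (simp add: fun_eq_iff kron_def sum_fun_apply2 sum_distrib_right split_beta)

lemma kron_sum_right: "kron B (\<Sum>i\<in>I. A i) = (\<Sum>i\<in>I. kron B (A i))"
  by (simp add: fun_eq_iff kron_def sum_fun_apply2 sum_distrib_left split_beta)

lemma kron_eps: "kron (eps U) (eps V) = eps (U \<times> V)"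
  by (auto simp: kron_def eps_def fun_eq_iff)

lemma kron_Jm: "kron (Jm U V) (Jm U' V') = Jm (U \<times> U') (V \<times> V')"
  by (auto simp: kron_def Jm_def fun_eq_iff)

lemma cm_mult_Jm: "finite X \<Longrightarrow> cm_mult X (Jm U V) (Jm V' W) = cm_scale (of_nat (card (V \<inter> V' \<inter> X))) (Jm U W)"
  by (auto simp: cm_mult_def Jm_def cm_scale_def fun_eq_iff of_bool_conj[symmetric] Int_def
      simp flip: of_bool_conj intro!: arg_cong[where f=card])

section \<open>Subalgebras and their central idempotents\<close>

lemma subalgebra_Mat: "subalgebra X A \<Longrightarrow> M \<in> A \<Longrightarrow> M \<in> Mat X"
  and subalgebra_one: "subalgebra X A \<Longrightarrow> eps X \<in> A"
  and subalgebra_add: "subalgebra X A \<Longrightarrow> M \<in> A \<Longrightarrow> N \<in> A \<Longrightarrow> M + N \<in> A"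
  and subalgebra_mult: "subalgebra X A \<Longrightarrow> M \<in> A \<Longrightarrow> N \<in> A \<Longrightarrow> cm_mult X M N \<in> A"
  and subalgebra_scale: "subalgebra X A \<Longrightarrow> M \<in> A \<Longrightarrow> cm_scale c M \<in> A"
  by (auto simp: subalgebra_def)

lemma subalgebra_zero: "subalgebra X A \<Longrightarrow> 0 \<in> A"
  by (metis cm_scale_simps(1) subalgebra_one subalgebra_scale)

lemma subalgebra_diff:
  assumes "subalgebra X A" "M \<in> A" "N \<in> A"
  shows "M - N \<in> A"
proof -
  have "M - N = M + cm_scale (-1) N" by (auto simp: cm_scale_def fun_eq_iff)
  then show ?thesis using assms by (metis subalgebra_add subalgebra_scale)
qed

lemma subalgebra_sum:
  "subalgebra X A \<Longrightarrow> (\<And>i. i \<in> I \<Longrightarrow> M i \<in> A) \<Longrightarrow> (\<Sum>i\<in>I. M i) \<in> A"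
proof (induction I rule: infinite_finite_induct)
  case (infinite I)
  then show ?case using subalgebra_zero by (metis sum.infinite)
next
  case empty
  then show ?case using subalgebra_zero by (metis sum.empty)
next
  case (insert i I)
  then have "M i + sum M I \<in> A" by (intro subalgebra_add) blast+
  then show ?case using insert.hyps by (metis sum.insert)
qed

lemma subalgebra_full: "subalgebra X (Mat X)"
  by (auto simp: subalgebra_def eps_in_Mat Mat_add Mat_mult Mat_scale)

lemma generated_subalgebra_subalgebra:
  assumes "G \<subseteq> Mat X"
  shows "subalgebra X (generated_subalgebra X G)"
proof -
  have "generated_subalgebra X G \<subseteq> Mat X"
    using subalgebra_full assms by (auto simp: generated_subalgebra_def)
  moreover have "eps X \<in> generated_subalgebra X G"
    unfolding generated_subalgebra_def by (blast intro: subalgebra_one)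
  moreover have "M + N \<in> generated_subalgebra X G" "cm_mult X M N \<in> generated_subalgebra X G"
      "cm_scale c M \<in> generated_subalgebra X G"
    if "M \<in> generated_subalgebra X G" "N \<in> generated_subalgebra X G" for M N c
    using that unfolding generated_subalgebra_def
    by (blast intro: subalgebra_add subalgebra_mult subalgebra_scale)+
  ultimately show ?thesis by (simp add: subalgebra_def)
qed

lemma generated_subalgebra_generators: "G \<subseteq> generated_subalgebra X G"
  by (auto simp: generated_subalgebra_def)

lemma generated_subalgebra_least:
  "subalgebra X A \<Longrightarrow> G \<subseteq> A \<Longrightarrow> generated_subalgebra X G \<subseteq> A"
  by (auto simp: generated_subalgebra_def)

lemma central_idempotentsI:
  assumes "e \<in> A" "\<And>N. N \<in> A \<Longrightarrow> cm_mult X e N = cm_mult X N e" "cm_mult X e e = e"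
  shows "e \<in> central_idempotents X A"
  unfolding central_idempotents_def center_def using assms by blast

lemma central_idempotentsD:
  assumes "e \<in> central_idempotents X A"
  shows "e \<in> A" "N \<in> A \<Longrightarrow> cm_mult X e N = cm_mult X N e" "cm_mult X e e = e"
  using assms unfolding central_idempotents_def center_def by blast+

lemma central_idempotents_one:
  assumes "finite X" "subalgebra X A"
  shows "eps X \<in> central_idempotents X A"
proof (rule central_idempotentsI)
  show one: "eps X \<in> A" using assms subalgebra_one by blast
  show "cm_mult X (eps X) N = cm_mult X N (eps X)" if "N \<in> A" for N
    using that assms by (metis cm_mult_one_left cm_mult_one_right subalgebra_Mat)
  show "cm_mult X (eps X) (eps X) = eps X"
    using one assms by (metis cm_mult_one_left subalgebra_Mat)
qed

lemma central_idempotents_mult: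
  assumes A: "subalgebra X A"
    and e: "e \<in> central_idempotents X A" and f: "f \<in> central_idempotents X A"
  shows "cm_mult X e f \<in> central_idempotents X A"
proof (rule central_idempotentsI)
  note eD = central_idempotentsD[OF e] and fD = central_idempotentsD[OF f]
  show "cm_mult X e f \<in> A" using eD fD A subalgebra_mult by metis
  show "cm_mult X (cm_mult X e f) N = cm_mult X N (cm_mult X e f)" if "N \<in> A" for N
    using that eD(2) fD(2) by (metis cm_mult_assoc)
  show "cm_mult X (cm_mult X e f) (cm_mult X e f) = cm_mult X e f"
    using eD fD by (metis cm_mult_assoc)
qed

lemma central_idempotents_diff:
  assumes A: "subalgebra X A" and e: "e \<in> central_idempotents X A"
    and f: "f \<in> central_idempotents X A" and ef: "cm_mult X e f = f"
  shows "e - f \<in> central_idempotents X A"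
proof (rule central_idempotentsI)
  note eD = central_idempotentsD[OF e] and fD = central_idempotentsD[OF f]
  have fe: "cm_mult X f e = f" using ef eD(2)[OF fD(1)] by simp
  show "e - f \<in> A" using eD fD A subalgebra_diff by metis
  show "cm_mult X (e - f) N = cm_mult X N (e - f)" if "N \<in> A" for N
    using that by (simp add: cm_mult_diff_left cm_mult_diff_right eD(2) fD(2))
  show "cm_mult X (e - f) (e - f) = e - f"
    by (simp add: cm_mult_diff_left cm_mult_diff_right eD(3) fD(3) ef fe)
qed

lemma central_idempotents_complement:
  assumes X: "finite X" and A: "subalgebra X A" and e: "e \<in> central_idempotents X A"
  shows "eps X - e \<in> central_idempotents X A"
proof (rule central_idempotents_diff[OF A central_idempotents_one[OF X A] e])
  show "cm_mult X (eps X) e = e"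
    using X A e by (meson central_idempotentsD(1) cm_mult_one_left subalgebra_Mat)
qed

lemma cpiD:
  "e \<in> central_primitive_idempotents X A \<Longrightarrow> e \<in> central_idempotents X A"
  "e \<in> central_primitive_idempotents X A \<Longrightarrow> e \<noteq> 0"
  by (simp_all add: central_primitive_idempotents_def)

text \<open>Splitting \<open>e\<close> as \<open>e f + (e - e f)\<close> shows that a primitive central idempotent lies entirely inside or
  entirely outside every other central idempotent.\<close>

lemma cpi_mult_central_idempotent:
  assumes A: "subalgebra X A" and e: "e \<in> central_primitive_idempotents X A"
    and f: "f \<in> central_idempotents X A"
  shows "cm_mult X e f = 0 \<or> cm_mult X e f = e"
proof -
  note eD = central_idempotentsD[OF cpiD(1)[OF e]] and fD = central_idempotentsD[OF f]
  define g where "g = cm_mult X e f"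
  have g: "g \<in> central_idempotents X A"
    unfolding g_def by (rule central_idempotents_mult[OF A cpiD(1)[OF e] f])
  have eg: "cm_mult X e g = g"
    unfolding g_def using eD(3) by (metis cm_mult_assoc)
  then have ge: "cm_mult X g e = g"
    using eD(2) central_idempotentsD(1)[OF g] by metis
  have h: "e - g \<in> central_idempotents X A"
    by (rule central_idempotents_diff[OF A cpiD(1)[OF e] g eg])
  have gh: "cm_mult X g (e - g) = 0"
    using ge central_idempotentsD(3)[OF g] by (simp add: cm_mult_diff_right)
  have "\<forall>g \<in> central_idempotents X A. \<forall>h \<in> central_idempotents X A.
      cm_mult X g h = 0 \<and> e = g + h \<longrightarrow> g = 0 \<or> h = 0"
    using e by (simp add: central_primitive_idempotents_def)
  moreover have "e = g + (e - g)" by simp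
  ultimately have "g = 0 \<or> e - g = 0" using g h gh by blast
  then show ?thesis unfolding g_def by (metis eq_iff_diff_eq_0)
qed

lemma cpi_orthogonal:
  assumes A: "subalgebra X A" and e: "e \<in> central_primitive_idempotents X A"
    and f: "f \<in> central_primitive_idempotents X A" and "e \<noteq> f"
  shows "cm_mult X e f = 0"
  using cpi_mult_central_idempotent[OF A e cpiD(1)[OF f]]
    cpi_mult_central_idempotent[OF A f cpiD(1)[OF e]] \<open>e \<noteq> f\<close>
    central_idempotentsD(2)[OF cpiD(1)[OF e] central_idempotentsD(1)[OF cpiD(1)[OF f]]]
  by auto

definition cpis_below :: "'a set \<Rightarrow> 'a cmat set \<Rightarrow> 'a cmat \<Rightarrow> 'a cmat set" where
  "cpis_below X A z = {e \<in> central_primitive_idempotents X A. cm_mult X e z = e}"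

text \<open>A primitive central idempotent lies inside or outside each \<open>z \<in> Z\<close>, and it cannot lie outside all of
  them.  The search thus splits into the corners cut out by \<open>Z\<close>.\<close>

lemma cpis_cover:
  assumes X: "finite X" and A: "subalgebra X A"
    and Z: "\<And>z. z \<in> Z \<Longrightarrow> z \<in> central_idempotents X A"
    and faithful: "\<And>e. e \<in> Mat X \<Longrightarrow> (\<And>z. z \<in> Z \<Longrightarrow> cm_mult X e z = 0) \<Longrightarrow> e = 0"
  shows "central_primitive_idempotents X A = (\<Union>z\<in>Z. cpis_below X A z)"
proof -
  have "\<exists>z\<in>Z. cm_mult X e z = e" if e: "e \<in> central_primitive_idempotents X A" for e
  proof (rule ccontr)
    assume "\<not> ?thesis"
    then have "cm_mult X e z = 0" if "z \<in> Z" for z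
      using cpi_mult_central_idempotent[OF A e Z[OF that]] that by blast
    moreover have "e \<in> Mat X"
      using A e by (meson central_idempotentsD(1) cpiD(1) subalgebra_Mat)
    ultimately have "e = 0" using faithful by blast
    then show False using cpiD(2)[OF e] by blast
  qed
  then show ?thesis unfolding cpis_below_def by blast
qed

lemma cpis_below_cpi:
  assumes A: "subalgebra X A" and z: "z \<in> central_primitive_idempotents X A"
  shows "cpis_below X A z = {z}"
proof -
  have "e = z" if "e \<in> cpis_below X A z" for e
  proof (rule ccontr)
    have e: "e \<in> central_primitive_idempotents X A" "cm_mult X e z = e"
      using that unfolding cpis_below_def by blast+
    assume "e \<noteq> z"
    then show False using cpi_orthogonal[OF A e(1) z] e(2) cpiD(2)[OF e(1)] by simp
  qed
  moreover have "z \<in> cpis_below X A z"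
    using z central_idempotentsD(3)[OF cpiD(1)[OF z]] unfolding cpis_below_def by blast
  ultimately show ?thesis by blast
qed

lemma cpis_below_complement:
  assumes X: "finite X" and A: "subalgebra X A" and z: "z \<in> central_primitive_idempotents X A"
  shows "cpis_below X A (eps X - z) = central_primitive_idempotents X A - {z}"
proof -
  have "cm_mult X e (eps X - z) = e \<longleftrightarrow> e \<noteq> z" if e: "e \<in> central_primitive_idempotents X A" for e
  proof -
    have "cm_mult X e (eps X) = e"
      using e A X by (meson central_idempotentsD(1) cm_mult_one_right cpiD(1) subalgebra_Mat)
    then have "cm_mult X e (eps X - z) = e \<longleftrightarrow> cm_mult X e z = 0"
      by (simp add: cm_mult_diff_right)
    moreover have "cm_mult X e z = 0 \<longleftrightarrow> e \<noteq> z"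
      using cpi_orthogonal[OF A e z] central_idempotentsD(3)[OF cpiD(1)[OF z]] cpiD(2)[OF z] by metis
    ultimately show ?thesis by blast
  qed
  then show ?thesis unfolding cpis_below_def by blast
qed

lemma cpiI:
  assumes "e \<in> central_idempotents X A" "e \<noteq> 0"
    and below: "\<And>f. f \<in> central_idempotents X A \<Longrightarrow> cm_mult X e f = f \<Longrightarrow> f = 0 \<or> f = e"
  shows "e \<in> central_primitive_idempotents X A"
proof -
  have "f = 0 \<or> g = 0" if f: "f \<in> central_idempotents X A" and g: "g \<in> central_idempotents X A"
    and fg: "cm_mult X f g = 0" "e = f + g" for f g
  proof -
    have "cm_mult X g f = 0"
      using central_idempotentsD(2)[OF f central_idempotentsD(1)[OF g]] fg by metis
    then have "cm_mult X e f = f"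
      by (simp only: fg(2) cm_mult_add_left central_idempotentsD(3)[OF f] add_0_right)
    then show ?thesis using below[OF f] fg(2) by (metis add_cancel_left_right)
  qed
  then show ?thesis using assms unfolding central_primitive_idempotents_def by blast
qed

text \<open>Since \<open>p A p = \<complex> p\<close>, a central idempotent \<open>f\<close> below \<open>e\<close> acts on \<open>p\<close> as a scalar \<open>c\<close> with \<open>c\<^sup>2 = c\<close>: it kills
  \<open>p\<close> or fixes it.  As \<open>p\<close> generates \<open>e\<close> as an ideal, killing \<open>p\<close> means killing \<open>e\<close>, and in the other case
  \<open>e - f\<close> kills \<open>e\<close>.  The generation enters only through the hypothesis \<open>gen\<close>, which is weaker than an
  explicit expression of \<open>e\<close> by \<open>p\<close> and easier to verify along a chain of ideal members.\<close>

lemma cpi_of_scalar_corner: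
  assumes A: "subalgebra X A" and e: "e \<in> central_idempotents X A"
    and p: "p \<in> A" "p \<noteq> 0" "cm_mult X p p = p" "cm_mult X e p = p"
    and corner: "\<And>M. M \<in> A \<Longrightarrow> \<exists>c. cm_mult X (cm_mult X p M) p = cm_scale c p"
    and gen: "\<And>f. f \<in> central_idempotents X A \<Longrightarrow> cm_mult X f p = 0 \<Longrightarrow> cm_mult X f e = 0"
  shows "e \<in> central_primitive_idempotents X A"
proof (rule cpiI[OF e])
  show "e \<noteq> 0" using p by (metis cm_mult_zero_left)
  fix f assume f: "f \<in> central_idempotents X A" and ef: "cm_mult X e f = f"
  note fD = central_idempotentsD[OF f] and eD = central_idempotentsD[OF e]
  obtain c where "cm_mult X (cm_mult X p f) p = cm_scale c p" using corner[OF fD(1)] by blast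
  then have fp: "cm_mult X f p = cm_scale c p"
    using p fD(2)[OF p(1)] by (metis cm_mult_assoc)
  have "cm_scale c (cm_scale c p) = cm_mult X f (cm_mult X f p)"
    by (simp add: fp cm_mult_scale_right)
  also have "\<dots> = cm_scale c p"
    using fD(3) fp by (metis cm_mult_assoc)
  finally have "cm_scale (c * c - c) p = 0"
    by (auto simp: cm_scale_def fun_eq_iff algebra_simps)
  \<comment> \<open>\<open>p\<close> is not zero, so the scalar is idempotent.\<close>
  then have "c * c - c = 0" using cm_scale_eq_0 p(2) by blast
  then consider "c = 0" | "c = 1" by (metis eq_iff_diff_eq_0 mult_cancel_right1)
  then show "f = 0 \<or> f = e"
  proof cases
    case 1
    then have "cm_mult X f e = 0" using gen[OF f] fp by (metis cm_scale_simps(1))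
    then show ?thesis using ef eD(2)[OF fD(1)] by metis
  next
    case 2
    have g: "e - f \<in> central_idempotents X A"
      by (rule central_idempotents_diff[OF A e f ef])
    have "cm_mult X (e - f) p = 0" using fp 2 p by (simp add: cm_mult_diff_left)
    then have "cm_mult X (e - f) e = 0" by (rule gen[OF g])
    moreover have "cm_mult X f e = f" using ef eD(2)[OF fD(1)] by metis
    ultimately have "e = f" using eD(3) by (simp add: cm_mult_diff_left)
    then show ?thesis by simp
  qed
qed

lemma rank_one_corner:
  assumes "\<And>x y. p x y = a x * b y"
  shows "\<exists>c. cm_mult X (cm_mult X p M) p = cm_scale c p"
proof
  show "cm_mult X (cm_mult X p M) p = cm_scale (\<Sum>z\<in>X. (\<Sum>w\<in>X. b w * M w z) * a z) p"
    by (auto simp: cm_mult_def cm_scale_def fun_eq_iff assms sum_distrib_left sum_distrib_right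
        algebra_simps)
qed

text \<open>Central idempotents below \<open>z\<close> only see the corner \<open>A z\<close>.  A homomorphism \<open>h\<close> that identifies this corner
  with the corner \<open>B z'\<close> of another algebra therefore transports the primitive ones; \<open>B\<close> may live on a
  different index set.\<close>

lemma cpis_below_corner:
  assumes A: "subalgebra X A" and B: "subalgebra W B"
    and z': "z' \<in> central_idempotents W B" and z: "z = h z'"
    and hA: "\<And>b. b \<in> B \<Longrightarrow> h b \<in> A"
    and h_add: "\<And>b c. b \<in> B \<Longrightarrow> c \<in> B \<Longrightarrow> h (b + c) = h b + h c"
    and h_mult: "\<And>b c. b \<in> B \<Longrightarrow> c \<in> B \<Longrightarrow> h (cm_mult W b c) = cm_mult X (h b) (h c)"
    and h_inj: "inj_on h B"
    and corner: "\<And>M. M \<in> A \<Longrightarrow> \<exists>b\<in>B. cm_mult X M z = h (cm_mult W b z') \<and>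
                                        cm_mult X z M = h (cm_mult W b z')"
  shows "cpis_below X A z = h ` cpis_below W B z'"
proof -
  note z'D = central_idempotentsD[OF z']
  have zA: "z \<in> A" using z'D(1) hA z by simp
  have z_ci: "z \<in> central_idempotents X A"
  proof (rule central_idempotentsI[OF zA])
    show "cm_mult X z z = z" using h_mult z'D z by metis
    show "cm_mult X z N = cm_mult X N z" if "N \<in> A" for N using corner[OF that] by auto
  qed
  have h0: "h 0 = 0"
    using h_add[OF subalgebra_zero[OF B] subalgebra_zero[OF B]] by simp
  have h_eq: "h b = h c \<longleftrightarrow> b = c" if "b \<in> B" "c \<in> B" for b c
    using h_inj that by (auto dest: inj_onD)
  define CA where "CA = {f \<in> central_idempotents X A. cm_mult X f z = f}"
  define CB where "CB = {f \<in> central_idempotents W B. cm_mult W f z' = f}"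
  have to_A: "h f \<in> CA" if "f \<in> CB" for f
  proof -
    have f: "f \<in> central_idempotents W B" "cm_mult W f z' = f" using that by (auto simp: CB_def)
    note fD = central_idempotentsD[OF f(1)]
    have zf: "cm_mult W z' f = f" using f(2) z'D(2)[OF fD(1)] by simp
    have hfz: "cm_mult X (h f) z = h f" and zhf: "cm_mult X z (h f) = h f"
      using h_mult[OF fD(1) z'D(1)] h_mult[OF z'D(1) fD(1)] f(2) zf z by auto
    have "h f \<in> central_idempotents X A"
    proof (rule central_idempotentsI)
      show "h f \<in> A" by (rule hA[OF fD(1)])
      show "cm_mult X (h f) (h f) = h f" using h_mult[OF fD(1) fD(1)] fD(3) by simp
      fix N assume "N \<in> A"
      then obtain b where b: "b \<in> B" and Nz: "cm_mult X N z = h (cm_mult W b z')"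
          "cm_mult X z N = h (cm_mult W b z')" using corner by blast
      have bz: "cm_mult W b z' \<in> B" using b z'D(1) B subalgebra_mult by metis
      have "cm_mult X (h f) N = cm_mult X (h f) (cm_mult X z N)"
        using hfz by (metis cm_mult_assoc)
      also have "\<dots> = h (cm_mult W f (cm_mult W b z'))" using Nz h_mult[OF fD(1) bz] by simp
      also have "\<dots> = h (cm_mult W (cm_mult W b z') f)" using fD(2)[OF bz] by simp
      also have "\<dots> = cm_mult X (cm_mult X N z) (h f)" using Nz h_mult[OF bz fD(1)] by simp
      also have "\<dots> = cm_mult X N (h f)" using zhf by (metis cm_mult_assoc)
      finally show "cm_mult X (h f) N = cm_mult X N (h f)" .
    qed
    then show ?thesis using hfz by (simp add: CA_def)
  qed
  have from_A: "\<exists>f'\<in>CB. f = h f'" if "f \<in> CA" for f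
  proof -
    have f: "f \<in> central_idempotents X A" "cm_mult X f z = f" using that by (auto simp: CA_def)
    note fD = central_idempotentsD[OF f(1)]
    obtain b where b: "b \<in> B" "f = h (cm_mult W b z')" using corner[OF fD(1)] f(2) by metis
    define f' where "f' = cm_mult W b z'"
    have f'B: "f' \<in> B" unfolding f'_def using b z'D(1) B subalgebra_mult by metis
    have fh: "f = h f'" using b f'_def by simp
    have "f' \<in> central_idempotents W B"
    proof (rule central_idempotentsI[OF f'B])
      show "cm_mult W f' N = cm_mult W N f'" if N: "N \<in> B" for N
        using fD(2)[OF hA[OF N]] h_mult[OF f'B N] h_mult[OF N f'B] fh
          h_eq[OF subalgebra_mult[OF B f'B N] subalgebra_mult[OF B N f'B]] by simp
      show "cm_mult W f' f' = f'"
        using h_mult[OF f'B f'B] fD(3) fh h_eq[OF subalgebra_mult[OF B f'B f'B] f'B] by simp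
    qed
    moreover have "cm_mult W f' z' = f'"
      unfolding f'_def using z'D(3) by (metis cm_mult_assoc)
    ultimately show ?thesis using fh by (auto simp: CB_def)
  qed
  have CBsub: "f \<in> B" if "f \<in> CB" for f using that central_idempotentsD(1) by (auto simp: CB_def)
  have sub_A: "f \<in> CA" if "f \<in> central_idempotents X A" "e \<in> CA" "cm_mult X e f = f" for e f
    using that central_idempotentsD(2)[OF z_ci] central_idempotentsD(1)
    unfolding CA_def by (metis (mono_tags, lifting) cm_mult_assoc mem_Collect_eq)
  have sub_B: "f \<in> CB" if "f \<in> central_idempotents W B" "e \<in> CB" "cm_mult W e f = f" for e f
    using that central_idempotentsD(2)[OF z'] central_idempotentsD(1)
    unfolding CB_def by (metis (mono_tags, lifting) cm_mult_assoc mem_Collect_eq)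
  have prim: "h e \<in> central_primitive_idempotents X A \<longleftrightarrow> e \<in> central_primitive_idempotents W B"
    if e: "e \<in> CB" for e
  proof
    assume cpi: "e \<in> central_primitive_idempotents W B"
    show "h e \<in> central_primitive_idempotents X A"
    proof (rule cpiI)
      show "h e \<in> central_idempotents X A" using to_A[OF e] by (simp add: CA_def)
      show "h e \<noteq> 0" using cpiD(2)[OF cpi] h0 h_eq[OF CBsub[OF e] subalgebra_zero[OF B]] by simp
      fix f assume f: "f \<in> central_idempotents X A" "cm_mult X (h e) f = f"
      then have "f \<in> CA" using sub_A to_A[OF e] by blast
      then obtain f' where f': "f' \<in> CB" "f = h f'" using from_A by blast
      have "cm_mult W e f' = 0 \<or> cm_mult W e f' = e"
        using cpi_mult_central_idempotent[OF B cpi] f' by (simp add: CB_def)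
      then show "f = 0 \<or> f = h e"
        using f(2) f'(2) h_mult[OF CBsub[OF e] CBsub[OF f'(1)]] h0 by auto
    qed
  next
    assume cpi: "h e \<in> central_primitive_idempotents X A"
    show "e \<in> central_primitive_idempotents W B"
    proof (rule cpiI)
      show "e \<in> central_idempotents W B" using e by (simp add: CB_def)
      show "e \<noteq> 0" using cpiD(2)[OF cpi] h0 by auto
      fix f assume f: "f \<in> central_idempotents W B" "cm_mult W e f = f"
      then have fB: "f \<in> CB" using sub_B e by blast
      have "cm_mult X (h e) (h f) = 0 \<or> cm_mult X (h e) (h f) = h e"
        using cpi_mult_central_idempotent[OF A cpi] to_A[OF fB] by (simp add: CA_def)
      then show "f = 0 \<or> f = e"
        using f(2) h_mult[OF CBsub[OF e] CBsub[OF fB]] h0 CBsub[OF e] CBsub[OF fB]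
          h_eq subalgebra_zero[OF B] by metis
    qed
  qed
  have "cpis_below X A z = {f \<in> CA. f \<in> central_primitive_idempotents X A}"
    by (auto simp: cpis_below_def CA_def dest: cpiD(1))
  also have "\<dots> = h ` {f \<in> CB. f \<in> central_primitive_idempotents W B}"
    using from_A to_A prim by blast
  also have "{f \<in> CB. f \<in> central_primitive_idempotents W B} = cpis_below W B z'"
    by (auto simp: cpis_below_def CB_def dest: cpiD(1))
  finally show ?thesis .
qed

section \<open>Irreducible characters and primitive central idempotents\<close>

lemma sum_fun_apply1: "(\<Sum>i\<in>I. f i) x = (\<Sum>i\<in>I. f i x)"
  for f :: "'i \<Rightarrow> 'x \<Rightarrow> 'z::comm_monoid_add"
  by (induction I rule: infinite_finite_induct) auto

definition fun_scale :: "complex \<Rightarrow> ('a \<Rightarrow> complex) \<Rightarrow> 'a \<Rightarrow> complex" where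
  "fun_scale c v = (\<lambda>x. c * v x)"

text \<open>The theory of bases and dimension is used for the space of column vectors; vectors are functions
  on the index type, and those over \<open>X\<close> are the ones supported on \<open>X\<close>.\<close>

interpretation fv: vector_space "fun_scale :: complex \<Rightarrow> ('a \<Rightarrow> complex) \<Rightarrow> 'a \<Rightarrow> complex"
  by unfold_locales (simp_all add: fun_scale_def fun_eq_iff algebra_simps)

definition supported :: "'a set \<Rightarrow> ('a \<Rightarrow> complex) set" where
  "supported X = {v. \<forall>x. x \<notin> X \<longrightarrow> v x = 0}"

lemma supported_subspace: "fv.subspace (supported X)"
  by (auto simp: fv.subspace_def supported_def fun_scale_def)

lemma supported_span:
  assumes "finite X"
  obtains D :: "('a \<Rightarrow> complex) set" where "finite D" "supported X \<subseteq> fv.span D"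
proof
  define \<delta> :: "'a \<Rightarrow> 'a \<Rightarrow> complex" where "\<delta> = (\<lambda>x y. of_bool (x = y))"
  show "finite (\<delta> ` X)" using assms by simp
  show "supported X \<subseteq> fv.span (\<delta> ` X)"
  proof
    fix v :: "'a \<Rightarrow> complex" assume v: "v \<in> supported X"
    have "v y = (\<Sum>x\<in>X. fun_scale (v x) (\<delta> x)) y" for y
    proof -
      have "v y = (\<Sum>x\<in>X. if x = y then v y else 0)"
        using v assms by (auto simp: supported_def sum.delta)
      also have "\<dots> = (\<Sum>x\<in>X. fun_scale (v x) (\<delta> x) y)"
        by (intro sum.cong) (auto simp: fun_scale_def \<delta>_def)
      finally show ?thesis by (simp only: sum_fun_apply1)
    qed
    then have "v = (\<Sum>x\<in>X. fun_scale (v x) (\<delta> x))" by blast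
    then show "v \<in> fv.span (\<delta> ` X)"
      by (metis (no_types, lifting) fv.span_sum fv.span_scale fv.span_base imageI)
  qed
qed

lemma subspace_dim_strict_mono:
  assumes D: "finite D" "V \<subseteq> fv.span D" and sub: "fv.subspace U" "fv.subspace V" "U \<subset> V"
  shows "fv.dim U < fv.dim V"
proof -
  obtain v where v: "v \<in> V" "v \<notin> U" using sub by blast
  obtain B where B: "B \<subseteq> U" "fv.independent B" "U \<subseteq> fv.span B" "card B = fv.dim U"
    by (rule fv.basis_exists)
  obtain C where C: "C \<subseteq> V" "fv.independent C" "V \<subseteq> fv.span C" "card C = fv.dim V"
    by (rule fv.basis_exists)
  have "fv.span B = U" using B sub by (metis fv.span_subspace)
  then have ind: "fv.independent (insert v B)" using v B fv.independent_insertI by metis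
  have "C \<subseteq> fv.span D" using C D by (meson subset_trans)
  then have "finite C" using fv.independent_span_bound[OF D(1) C(2)] by blast
  moreover have "insert v B \<subseteq> fv.span C" using v B C sub by blast
  ultimately have "finite (insert v B) \<and> card (insert v B) \<le> card C"
    by (rule fv.independent_span_bound[OF _ ind])
  moreover have "v \<notin> B" using v B by blast
  ultimately have "Suc (card B) \<le> card C" by (metis card_insert_disjoint finite_insert)
  then show ?thesis using B(4) C(4) by linarith
qed

definition act :: "'a set \<Rightarrow> 'a cmat \<Rightarrow> ('a \<Rightarrow> complex) \<Rightarrow> 'a \<Rightarrow> complex" where
  "act X M v = (\<lambda>x. \<Sum>y\<in>X. M x y * v y)"

lemma act_add: "act X M (v + w) = act X M v + act X M w"
  and act_scale: "act X M (fun_scale c v) = fun_scale c (act X M v)"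
  and act_add_mat: "act X (M + N) v = act X M v + act X N v"
  and act_scale_mat: "act X (cm_scale c M) v = fun_scale c (act X M v)"
  by (simp_all add: act_def fun_scale_def cm_scale_def fun_eq_iff algebra_simps sum.distrib sum_distrib_left)

lemma act_zero [simp]: "act X M 0 = 0"
  by (simp add: act_def fun_eq_iff)

lemma act_mult: "act X (cm_mult X M N) v = act X M (act X N v)"
  by (auto simp: act_def cm_mult_def fun_eq_iff sum_distrib_left sum_distrib_right mult.assoc
      intro: sum.swap)

lemma act_one: "finite X \<Longrightarrow> v \<in> supported X \<Longrightarrow> act X (eps X) v = v"
  by (auto simp: act_def eps_def supported_def fun_eq_iff of_bool_def if_distrib[of "\<lambda>c. c * _"]
      sum.delta cong: if_cong conj_cong)

lemma act_supported: "M \<in> Mat X \<Longrightarrow> act X M v \<in> supported X"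
  by (auto simp: act_def supported_def Mat_outside)

lemma act_column: "act X M (\<lambda>x. N x y) = (\<lambda>x. cm_mult X M N x y)"
  by (simp add: act_def cm_mult_def)

definition invariant_subspace :: "'a set \<Rightarrow> 'a cmat set \<Rightarrow> ('a \<Rightarrow> complex) set \<Rightarrow> bool" where
  "invariant_subspace X A W \<longleftrightarrow> fv.subspace W \<and> W \<subseteq> supported X \<and> (\<forall>M\<in>A. \<forall>w\<in>W. act X M w \<in> W)"

lemma jnf_subspace_iff:
  "VectorSpace.subspace class_ring W (module_vec TYPE(complex) n) \<longleftrightarrow>
     W \<subseteq> carrier_vec n \<and> 0\<^sub>v n \<in> W \<and> (\<forall>v\<in>W. \<forall>w\<in>W. v + w \<in> W) \<and> (\<forall>c. \<forall>v\<in>W. c \<cdot>\<^sub>v v \<in> W)"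
  (is "?L \<longleftrightarrow> ?R")
proof
  assume L: ?L
  interpret VectorSpace.subspace class_ring W "module_vec TYPE(complex) n" by fact
  interpret submodule class_ring W "module_vec TYPE(complex) n" by (rule submod)
  show ?R using subset m_closed zero_closed smult_closed by (simp add: module_vec_simps)
next
  assume ?R
  then show ?L
    by (intro VectorSpace.subspace.intro vec_vs submodule.intro vec_module)
      (auto simp: module_vec_simps)
qed

lemma mat_unit_vec_col:
  fixes P :: "complex mat"
  assumes "P \<in> carrier_mat n n" "j < n"
  shows "P *\<^sub>v unit_vec n j = col P j"
  using assms by (intro eq_vecI) (auto simp: scalar_prod_right_unit)

lemma smult_mat_mult_vec:
  fixes P :: "complex mat"
  assumes "P \<in> carrier_mat n n" "v \<in> carrier_vec n"
  shows "(a \<cdot>\<^sub>m P) *\<^sub>v v = a \<cdot>\<^sub>v (P *\<^sub>v v)"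
  using assms by (intro eq_vecI) (auto simp: scalar_prod_def sum_distrib_left mult.assoc)

lemma zero_mat_mult_vec:
  assumes "v \<in> carrier_vec n"
  shows "0\<^sub>m n n *\<^sub>v v = (0\<^sub>v n :: complex vec)"
  using assms by (intro eq_vecI) auto

lemma mat_eq_by_columns:
  assumes "P \<in> carrier_mat n n" "Q \<in> carrier_mat n n"
    and "\<And>j. j < n \<Longrightarrow> P *\<^sub>v unit_vec n j = Q *\<^sub>v unit_vec n j"
  shows "P = (Q :: complex mat)"
proof (rule eq_matI)
  show "dim_row P = dim_row Q" "dim_col P = dim_col Q" using assms by auto
  fix i j assume "i < dim_row Q" "j < dim_col Q"
  then have ij: "i < n" "j < n" using assms by auto
  have "col P j = P *\<^sub>v unit_vec n j" "col Q j = Q *\<^sub>v unit_vec n j"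
    using mat_unit_vec_col assms ij by metis+
  then have "col P j $ i = col Q j $ i" using assms(3) ij by simp
  then show "P $$ (i, j) = Q $$ (i, j)" using assms ij by auto
qed

text \<open>Coordinates with respect to a basis turn the action on a minimal invariant subspace into a matrix
  representation, and minimality into irreducibility.\<close>

lemma irreducible_representation_of_minimal:
  fixes X :: "'a set"
  assumes X: "finite X" and A: "subalgebra X A"
    and W: "invariant_subspace X A W" and nz: "W \<noteq> {0}"
    and min: "\<And>U. invariant_subspace X A U \<Longrightarrow> U \<subseteq> W \<Longrightarrow> U = {0} \<or> U = W"
  obtains n \<rho> where "irreducible_representation X A n \<rho>"
    and "\<And>M. M \<in> A \<Longrightarrow> (\<And>w. w \<in> W \<Longrightarrow> act X M w = w) \<Longrightarrow> \<rho> M = 1\<^sub>m n"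
proof -
  obtain D :: "('a \<Rightarrow> complex) set" where D: "finite D" "supported X \<subseteq> fv.span D" using supported_span[OF X] by blast
  have Wsub: "fv.subspace W" and Wsup: "W \<subseteq> supported X"
    and Wact: "\<And>M w. M \<in> A \<Longrightarrow> w \<in> W \<Longrightarrow> act X M w \<in> W"
    using W by (auto simp: invariant_subspace_def)
  obtain B where B: "B \<subseteq> W" "fv.independent B" "W \<subseteq> fv.span B" by (metis fv.basis_exists)
  have "B \<subseteq> fv.span D" using B(1) Wsup D(2) by (meson subset_trans)
  then have finB: "finite B" using fv.independent_span_bound[OF D(1) B(2)] by blast
  have spanB: "fv.span B = W" using B Wsub by (metis fv.span_subspace)
  define n where "n = card B"
  obtain b where b: "bij_betw b {0..<n} B"
    using ex_bij_betw_nat_finite[OF finB] n_def by blast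
  have bB: "b i \<in> B" if "i < n" for i using b that by (auto simp: bij_betw_def)
  have b_inj: "b i = b j \<longleftrightarrow> i = j" if "i < n" "j < n" for i j
    using b that by (auto simp: bij_betw_def inj_on_def)
  define c where "c w = vec n (\<lambda>i. fv.representation B w (b i))" for w
  have c_dim: "c w \<in> carrier_vec n" for w by (simp add: c_def)
  have c_add: "c (v + w) = c v + c w" if "v \<in> W" "w \<in> W" for v w
    using that B spanB by (auto simp: c_def fv.representation_add)
  have c_scale: "c (fun_scale a w) = a \<cdot>\<^sub>v c w" if "w \<in> W" for a w
    using that B spanB by (auto simp: c_def fv.representation_scale)
  have c0: "c 0 = 0\<^sub>v n" by (auto simp: c_def fv.representation_zero)
  have c_sum: "w = (\<Sum>i<n. fun_scale (c w $ i) (b i))" if "w \<in> W" for w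
  proof -
    have "w = (\<Sum>x\<in>B. fun_scale (fv.representation B w x) x)"
      using fv.sum_representation_eq[of B w B] that B finB spanB by simp
    also have "\<dots> = (\<Sum>i\<in>{0..<n}. fun_scale (fv.representation B w (b i)) (b i))"
      using sum.reindex_bij_betw[OF b, of "\<lambda>x. fun_scale (fv.representation B w x) x"] by simp
    also have "\<dots> = (\<Sum>i<n. fun_scale (c w $ i) (b i))"
      by (intro sum.cong) (auto simp: c_def)
    finally show ?thesis .
  qed
  have c_inj: "v = w" if "v \<in> W" "w \<in> W" "c v = c w" for v w
    using c_sum[OF that(1)] c_sum[OF that(2)] that(3) by simp
  have c_unit: "c (b j) = unit_vec n j" if "j < n" for j
    using that bB[OF that] B b_inj by (auto simp: c_def fv.representation_basis intro!: eq_vecI)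
  have c_surj: "\<exists>w\<in>W. c w = a" if a: "a \<in> carrier_vec n" for a
  proof
    let ?w = "\<Sum>i<n. fun_scale (a $ i) (b i)"
    have part: "(\<Sum>i\<in>I. fun_scale (a $ i) (b i)) \<in> W \<and>
        (\<forall>j<n. c (\<Sum>i\<in>I. fun_scale (a $ i) (b i)) $ j = (if j \<in> I then a $ j else 0))"
      if "finite I" "I \<subseteq> {..<n}" for I
      using that
    proof (induction I rule: finite_induct)
      case empty
      have "(\<Sum>i\<in>{}. fun_scale (f i) (b i)) = 0" for f :: "nat \<Rightarrow> complex"
        by (rule sum.empty)
      then show ?case using fv.subspace_0[OF Wsub] c0 by (simp only: act_zero) simp
    next
      case (insert i I)
      let ?s = "\<Sum>i\<in>I. fun_scale (a $ i) (b i)" and ?t = "fun_scale (a $ i) (b i)"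
      have i: "i < n" using insert by auto
      have t: "?t \<in> W" "b i \<in> W" using bB[OF i] B Wsub by (auto intro: fv.subspace_scale)
      have s: "?s \<in> W" using insert by auto
      have eq: "(\<Sum>i\<in>insert i I. fun_scale (a $ i) (b i)) = ?t + ?s"
        by (rule sum.insert[OF insert.hyps])
      have "c (?t + ?s) = a $ i \<cdot>\<^sub>v unit_vec n i + c ?s"
        using c_add[OF t(1) s] c_scale[OF t(2)] c_unit[OF i] by simp
      then have "c (?t + ?s) $ j = (if j \<in> insert i I then a $ j else 0)" if "j < n" for j
        using insert that i c_dim[of ?s] by auto
      then show ?case unfolding eq using fv.subspace_add[OF Wsub t(1) s] by blast
    qed
    from part[of "{..<n}"] show "?w \<in> W" by simp
    from part[of "{..<n}"] show "c ?w = a"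
      using a c_dim[of ?w] by (intro eq_vecI) auto
  qed
  \<comment> \<open>Column \<open>j\<close> holds the coordinates of the image of the \<open>j\<close>-th basis vector.\<close>
  define \<rho> where "\<rho> M = mat n n (\<lambda>(i, j). c (act X M (b j)) $ i)" for M
  have \<rho>_dim: "\<rho> M \<in> carrier_mat n n" for M by (simp add: \<rho>_def)
  have \<rho>_unit: "\<rho> M *\<^sub>v unit_vec n j = c (act X M (b j))" if "j < n" "M \<in> A" for M j
  proof -
    have "col (\<rho> M) j = c (act X M (b j))"
      using that(1) c_dim[of "act X M (b j)"] by (intro eq_vecI) (auto simp: \<rho>_def)
    then show ?thesis using mat_unit_vec_col[OF \<rho>_dim that(1)] by simp
  qed
  have \<rho>_act: "\<rho> M *\<^sub>v c w = c (act X M w)" if M: "M \<in> A" and w: "w \<in> W" for M w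
  proof -
    have part: "(\<Sum>j\<in>I. fun_scale (c w $ j) (b j)) \<in> W \<and>
        (\<forall>i<n. c (act X M (\<Sum>j\<in>I. fun_scale (c w $ j) (b j))) $ i =
           (\<Sum>j\<in>I. \<rho> M $$ (i, j) * c w $ j))"
      if "finite I" "I \<subseteq> {..<n}" for I
      using that
    proof (induction I rule: finite_induct)
      case empty
      have "(\<Sum>i\<in>{}. fun_scale (f i) (b i)) = 0" for f :: "nat \<Rightarrow> complex"
        by (rule sum.empty)
      then show ?case using fv.subspace_0[OF Wsub] c0 by (simp only: act_zero) simp
    next
      case (insert k I)
      let ?s = "\<Sum>j\<in>I. fun_scale (c w $ j) (b j)" and ?t = "fun_scale (c w $ k) (b k)"
      have k: "k < n" using insert by auto
      have t: "?t \<in> W" "b k \<in> W" using bB[OF k] B Wsub by (auto intro: fv.subspace_scale)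
      have s: "?s \<in> W" using insert by auto
      have eq: "(\<Sum>j\<in>insert k I. fun_scale (c w $ j) (b j)) = ?t + ?s"
        by (rule sum.insert[OF insert.hyps])
      have "c (act X M (?t + ?s)) = c w $ k \<cdot>\<^sub>v c (act X M (b k)) + c (act X M ?s)"
        using c_add[OF Wact[OF M t(1)] Wact[OF M s]] c_scale[OF Wact[OF M t(2)]]
        by (simp add: act_add act_scale)
      then have "c (act X M (?t + ?s)) $ i = (\<Sum>j\<in>insert k I. \<rho> M $$ (i, j) * c w $ j)" if "i < n" for i
        using insert that k c_dim[of "act X M ?s"] c_dim[of "act X M (b k)"] by (simp add: \<rho>_def)
      then show ?case unfolding eq using fv.subspace_add[OF Wsub t(1) s] by blast
    qed
    from part[of "{..<n}"] have "c (act X M w) $ i = (\<Sum>j<n. \<rho> M $$ (i, j) * c w $ j)" if "i < n" for i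
      using that c_sum[OF w] by simp
    then show ?thesis
      using c_dim[of w] c_dim[of "act X M w"] \<rho>_dim[of M]
      by (intro eq_vecI) (auto simp: scalar_prod_def lessThan_atLeast0)
  qed
  have bW: "b j \<in> W" if "j < n" for j using bB[OF that] B by blast
  have rep: "representation X A n \<rho>"
    unfolding representation_def
  proof (intro conjI ballI allI)
    fix M assume M: "M \<in> A"
    show "\<rho> M \<in> carrier_mat n n" by (rule \<rho>_dim)
    show "\<rho> (cm_scale a M) = a \<cdot>\<^sub>m \<rho> M" for a
    proof (rule mat_eq_by_columns[of _ n])
      fix j assume j: "j < n"
      show "\<rho> (cm_scale a M) *\<^sub>v unit_vec n j = a \<cdot>\<^sub>m \<rho> M *\<^sub>v unit_vec n j"
        using \<rho>_unit[OF j subalgebra_scale[OF A M]] \<rho>_unit[OF j M] c_scale[OF Wact[OF M bW[OF j]]]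
        by (simp add: act_scale_mat smult_mat_mult_vec[OF \<rho>_dim])
    qed (auto simp: \<rho>_dim)
    fix N assume N: "N \<in> A"
    show "\<rho> (M + N) = \<rho> M + \<rho> N"
    proof (rule mat_eq_by_columns[of _ n])
      fix j assume j: "j < n"
      show "\<rho> (M + N) *\<^sub>v unit_vec n j = (\<rho> M + \<rho> N) *\<^sub>v unit_vec n j"
        using \<rho>_unit[OF j subalgebra_add[OF A M N]] \<rho>_unit[OF j M] \<rho>_unit[OF j N]
          c_add[OF Wact[OF M bW[OF j]] Wact[OF N bW[OF j]]]
        by (simp add: act_add_mat add_mult_distrib_mat_vec[OF \<rho>_dim \<rho>_dim])
    qed (auto simp: \<rho>_dim)
    show "\<rho> (cm_mult X M N) = \<rho> M * \<rho> N"
    proof (rule mat_eq_by_columns[of _ n])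
      show "\<rho> M * \<rho> N \<in> carrier_mat n n" using \<rho>_dim by (meson mult_carrier_mat)
      fix j assume j: "j < n"
      have "\<rho> (cm_mult X M N) *\<^sub>v unit_vec n j = \<rho> M *\<^sub>v (\<rho> N *\<^sub>v unit_vec n j)"
        using \<rho>_unit[OF j subalgebra_mult[OF A M N]] \<rho>_unit[OF j N]
          \<rho>_act[OF M Wact[OF N bW[OF j]]] by (simp add: act_mult)
      then show "\<rho> (cm_mult X M N) *\<^sub>v unit_vec n j = \<rho> M * \<rho> N *\<^sub>v unit_vec n j"
        using assoc_mult_mat_vec[OF \<rho>_dim \<rho>_dim, of "unit_vec n j" M N] by simp
    qed (auto simp: \<rho>_dim)
  next
    show "\<rho> (eps X) = 1\<^sub>m n"
    proof (rule mat_eq_by_columns[of _ n])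
      fix j assume j: "j < n"
      show "\<rho> (eps X) *\<^sub>v unit_vec n j = 1\<^sub>m n *\<^sub>v unit_vec n j"
        using \<rho>_unit[OF j subalgebra_one[OF A]] act_one[OF X] bW[OF j] Wsup c_unit[OF j]
        by (auto simp: subset_eq)
    qed (auto simp: \<rho>_dim)
  qed
  have npos: "n > 0"
  proof (rule ccontr)
    assume "\<not> n > 0"
    then have "B = {}" using n_def finB by simp
    then show False using spanB nz by simp
  qed
  have "irreducible_representation X A n \<rho>"
    unfolding irreducible_representation_def
  proof (intro conjI allI impI rep npos)
    fix V assume V: "VectorSpace.subspace class_ring V (module_vec TYPE(complex) n) \<and>
          (\<forall>M\<in>A. \<forall>w\<in>V. \<rho> M *\<^sub>v w \<in> V)"
    then have Vs: "V \<subseteq> carrier_vec n" "0\<^sub>v n \<in> V" "\<And>v w. v \<in> V \<Longrightarrow> w \<in> V \<Longrightarrow> v + w \<in> V"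
        "\<And>c v. v \<in> V \<Longrightarrow> c \<cdot>\<^sub>v v \<in> V" and Vact: "\<And>M w. M \<in> A \<Longrightarrow> w \<in> V \<Longrightarrow> \<rho> M *\<^sub>v w \<in> V"
      unfolding jnf_subspace_iff by blast+
    \<comment> \<open>Pull an invariant space of coordinate vectors back to \<open>W\<close>, where minimality applies.\<close>
    define U where "U = {w \<in> W. c w \<in> V}"
    have "fv.subspace U"
      unfolding fv.subspace_def U_def
      using Vs c0 c_add c_scale Wsub
      by (auto simp: fv.subspace_0 fv.subspace_add fv.subspace_scale)
    then have "invariant_subspace X A U"
      unfolding invariant_subspace_def using Wsup Wact Vact \<rho>_act by (fastforce simp: U_def)
    then consider "U = {0}" | "U = W" using min[of U] U_def by blast
    then show "V = {0\<^sub>v n} \<or> V = carrier_vec n"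
    proof cases
      case 1
      have "v = 0\<^sub>v n" if v: "v \<in> V" for v
      proof -
        obtain w where "w \<in> W" "c w = v" using c_surj v Vs(1) by blast
        then have "w \<in> U" using v U_def by blast
        then show ?thesis using 1 c0 \<open>c w = v\<close> by simp
      qed
      then show ?thesis using Vs(2) by blast
    next
      case 2
      then have "v \<in> V" if "v \<in> carrier_vec n" for v using c_surj[OF that] U_def by blast
      then show ?thesis using Vs(1) by blast
    qed
  qed
  moreover have "\<rho> M = 1\<^sub>m n" if M: "M \<in> A" and fix_w: "\<And>w. w \<in> W \<Longrightarrow> act X M w = w" for M
  proof (rule mat_eq_by_columns[of _ n])
    fix j assume j: "j < n"
    show "\<rho> M *\<^sub>v unit_vec n j = 1\<^sub>m n *\<^sub>v unit_vec n j"
      using \<rho>_unit[OF j M] fix_w[OF bW[OF j]] c_unit[OF j] by simp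
  qed (auto simp: \<rho>_dim)
  ultimately show ?thesis using that by blast
qed

definition fixed_space :: "'a set \<Rightarrow> 'a cmat \<Rightarrow> ('a \<Rightarrow> complex) set" where
  "fixed_space X M = {v \<in> supported X. act X M v = v}"

lemma fixed_space_subspace: "fv.subspace (fixed_space X M)"
  using supported_subspace[of X]
  by (simp add: fv.subspace_def fixed_space_def act_add act_scale)

lemma column_in_fixed_space:
  assumes "N \<in> Mat X"
  shows "(\<forall>y. (\<lambda>x. N x y) \<in> fixed_space X M) \<longleftrightarrow> cm_mult X M N = N"
  using assms by (simp add: fixed_space_def act_column supported_def Mat_outside fun_eq_iff) blast

text \<open>The space of vectors fixed by \<open>e\<close> is a nonzero invariant subspace of the natural module.  An
  invariant subspace of it of least positive dimension is minimal, and \<open>e\<close> acts on it as the identity.\<close>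

lemma irreducible_representation_exists:
  assumes X: "finite X" and A: "subalgebra X A"
    and e: "e \<in> central_idempotents X A" and "e \<noteq> 0"
  obtains n \<rho> where "irreducible_representation X A n \<rho>" "\<rho> e = 1\<^sub>m n"
proof -
  obtain D :: "('a \<Rightarrow> complex) set" where D: "finite D" "supported X \<subseteq> fv.span D"
    using supported_span[OF X] by blast
  note eD = central_idempotentsD[OF e]
  have "invariant_subspace X A (fixed_space X e)"
    unfolding invariant_subspace_def
  proof (intro conjI ballI fixed_space_subspace)
    show "fixed_space X e \<subseteq> supported X" by (auto simp: fixed_space_def)
    fix M w assume M: "M \<in> A" and w: "w \<in> fixed_space X e"
    have "act X e (act X M w) = act X M (act X e w)"
      using eD(2)[OF M] by (metis act_mult)
    then show "act X M w \<in> fixed_space X e"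
      using w act_supported[OF subalgebra_Mat[OF A M]] by (simp add: fixed_space_def)
  qed
  moreover have "fixed_space X e \<noteq> {0}"
  proof
    assume "fixed_space X e = {0}"
    moreover have "\<forall>y. (\<lambda>x. e x y) \<in> fixed_space X e"
      using column_in_fixed_space[OF subalgebra_Mat[OF A eD(1)]] eD(3) by blast
    ultimately have "\<forall>y. (\<lambda>x. e x y) = 0" by blast
    then have "e = 0" by (simp add: fun_eq_iff)
    then show False using \<open>e \<noteq> 0\<close> by blast
  qed
  moreover define Q where "Q W \<longleftrightarrow> invariant_subspace X A W \<and> W \<noteq> {0} \<and> W \<subseteq> fixed_space X e" for W
  ultimately have "Q (fixed_space X e)" by blast
  then obtain W where QW: "Q W" and least: "\<And>U. Q U \<Longrightarrow> fv.dim W \<le> fv.dim U"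
    using ex_has_least_nat[of Q _ fv.dim] by blast
  then have W: "invariant_subspace X A W" "W \<noteq> {0}" "W \<subseteq> fixed_space X e"
    unfolding Q_def by blast+
  have "U = {0} \<or> U = W" if U: "invariant_subspace X A U" "U \<subseteq> W" for U
  proof (rule ccontr)
    assume "\<not> ?thesis"
    then have ne: "U \<noteq> {0}" "U \<subset> W" using U by blast+
    have "W \<subseteq> fv.span D" using W(1) D(2) unfolding invariant_subspace_def by (meson subset_trans)
    then have "fv.dim U < fv.dim W"
      using subspace_dim_strict_mono[OF D(1)] U W ne unfolding invariant_subspace_def by blast
    moreover have "fv.dim W \<le> fv.dim U" using least[of U] U W(3) ne(1) unfolding Q_def by blast
    ultimately show False by simp
  qed
  then obtain n \<rho> where \<rho>: "irreducible_representation X A n \<rho>"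
    "\<And>M. M \<in> A \<Longrightarrow> (\<And>w. w \<in> W \<Longrightarrow> act X M w = w) \<Longrightarrow> \<rho> M = 1\<^sub>m n"
    using irreducible_representation_of_minimal[OF X A W(1,2)] by metis
  have "\<rho> e = 1\<^sub>m n"
    using \<rho>(2)[OF eD(1)] W(3) unfolding fixed_space_def by blast
  then show ?thesis using \<rho>(1) that by blast
qed

lemma representationD:
  assumes "representation X A n \<rho>"
  shows "M \<in> A \<Longrightarrow> \<rho> M \<in> carrier_mat n n" "\<rho> (eps X) = 1\<^sub>m n"
    "M \<in> A \<Longrightarrow> N \<in> A \<Longrightarrow> \<rho> (M + N) = \<rho> M + \<rho> N"
    "M \<in> A \<Longrightarrow> N \<in> A \<Longrightarrow> \<rho> (cm_mult X M N) = \<rho> M * \<rho> N"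
    "M \<in> A \<Longrightarrow> \<rho> (cm_scale c M) = c \<cdot>\<^sub>m \<rho> M"
  using assms unfolding representation_def by blast+

lemma representation_zero:
  assumes "subalgebra X A" "representation X A n \<rho>"
  shows "\<rho> 0 = 0\<^sub>m n n"
proof -
  have "\<rho> (cm_scale 0 (eps X)) = 0 \<cdot>\<^sub>m \<rho> (eps X)"
    by (rule representationD(5)[OF assms(2) subalgebra_one[OF assms(1)]])
  also have "0 \<cdot>\<^sub>m \<rho> (eps X) = (0\<^sub>m n n :: complex mat)"
    unfolding representationD(2)[OF assms(2)] by (intro eq_matI) auto
  finally show ?thesis by simp
qed

lemma representation_mult_vec:
  assumes "representation X A n \<rho>" "M \<in> A" "N \<in> A" "v \<in> carrier_vec n"
  shows "\<rho> (cm_mult X M N) *\<^sub>v v = \<rho> M *\<^sub>v (\<rho> N *\<^sub>v v)"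
  using assms by (simp add: representationD(4)[OF assms(1-3)])
    (meson assoc_mult_mat_vec representationD(1))

text \<open>The image of a central idempotent is an invariant subspace, hence zero or everything.\<close>

lemma irreducible_central_idempotent:
  assumes A: "subalgebra X A" and \<rho>: "irreducible_representation X A n \<rho>"
    and e: "e \<in> central_idempotents X A"
  shows "\<rho> e = 1\<^sub>m n \<or> \<rho> e = 0\<^sub>m n n"
proof -
  note eD = central_idempotentsD[OF e]
  have rep: "representation X A n \<rho>" using \<rho> by (simp add: irreducible_representation_def)
  note rD = representationD[OF rep] and rM = representation_mult_vec[OF rep]
  have re: "\<rho> e \<in> carrier_mat n n" by (rule rD(1)[OF eD(1)])
  define V where "V = {\<rho> e *\<^sub>v v | v. v \<in> carrier_vec n}"
  have VI: "\<rho> e *\<^sub>v v \<in> V" if "v \<in> carrier_vec n" for v using that V_def by blast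
  have "VectorSpace.subspace class_ring V (module_vec TYPE(complex) n)"
    unfolding jnf_subspace_iff
  proof (intro conjI ballI allI)
    show "V \<subseteq> carrier_vec n" using re V_def by auto
    have "\<rho> e *\<^sub>v 0\<^sub>v n = 0\<^sub>v n" using re by (intro eq_vecI) auto
    then show "0\<^sub>v n \<in> V" using VI[of "0\<^sub>v n"] by simp
    fix v assume "v \<in> V"
    then obtain v' where v': "v = \<rho> e *\<^sub>v v'" "v' \<in> carrier_vec n" using V_def by blast
    have "c \<cdot>\<^sub>v v = \<rho> e *\<^sub>v (c \<cdot>\<^sub>v v')" for c using v' re by (simp add: mult_mat_vec)
    then show "c \<cdot>\<^sub>v v \<in> V" for c using VI[of "c \<cdot>\<^sub>v v'"] v' by simp
    fix w assume "w \<in> V"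
    then obtain w' where w': "w = \<rho> e *\<^sub>v w'" "w' \<in> carrier_vec n" using V_def by blast
    have "v + w = \<rho> e *\<^sub>v (v' + w')" using v' w' re by (simp add: mult_add_distrib_mat_vec)
    then show "v + w \<in> V" using VI[of "v' + w'"] v' w' by simp
  qed
  moreover have "\<rho> M *\<^sub>v w \<in> V" if M: "M \<in> A" and w: "w \<in> V" for M w
  proof -
    obtain w' where w': "w = \<rho> e *\<^sub>v w'" "w' \<in> carrier_vec n" using w V_def by blast
    have "\<rho> M *\<^sub>v w = \<rho> e *\<^sub>v (\<rho> M *\<^sub>v w')"
      using rM[OF M eD(1) w'(2)] rM[OF eD(1) M w'(2)] eD(2)[OF M] w' by simp
    then show ?thesis using VI[of "\<rho> M *\<^sub>v w'"] rD(1)[OF M] w' by simp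
  qed
  ultimately consider "V = {0\<^sub>v n}" | "V = carrier_vec n"
    using \<rho> unfolding irreducible_representation_def by blast
  then show ?thesis
  proof cases
    case 1
    have "\<rho> e = 0\<^sub>m n n"
    proof (rule mat_eq_by_columns[OF re])
      fix j assume "j < n"
      have "\<rho> e *\<^sub>v unit_vec n j = 0\<^sub>v n" using VI[of "unit_vec n j"] 1 by simp
      then show "\<rho> e *\<^sub>v unit_vec n j = 0\<^sub>m n n *\<^sub>v unit_vec n j"
        by (simp add: zero_mat_mult_vec)
    qed simp
    then show ?thesis by blast
  next
    case 2
    have "\<rho> e = 1\<^sub>m n"
    proof (rule mat_eq_by_columns[OF re])
      fix j assume "j < n"
      have "unit_vec n j \<in> V" using 2 by simp
      then obtain v where v: "unit_vec n j = \<rho> e *\<^sub>v v" "v \<in> carrier_vec n" using V_def by blast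
      have "\<rho> e *\<^sub>v unit_vec n j = unit_vec n j"
        using rM[OF eD(1) eD(1) v(2)] eD(3) v by simp
      then show "\<rho> e *\<^sub>v unit_vec n j = 1\<^sub>m n *\<^sub>v unit_vec n j" by simp
    qed simp
    then show ?thesis by blast
  qed
qed

lemma character_nonzero_iff:
  assumes A: "subalgebra X A" and \<rho>: "irreducible_representation X A n \<rho>"
    and e: "e \<in> central_idempotents X A"
  shows "character A n \<rho> e \<noteq> 0 \<longleftrightarrow> \<rho> e = 1\<^sub>m n"
proof -
  have n: "n > 0" using \<rho> by (simp add: irreducible_representation_def)
  have "\<rho> e = 1\<^sub>m n \<or> \<rho> e = 0\<^sub>m n n" by (rule irreducible_central_idempotent[OF assms])
  then show ?thesis
  proof
    assume "\<rho> e = 1\<^sub>m n"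
    then show ?thesis using n central_idempotentsD(1)[OF e] by (simp add: character_def)
  next
    assume r: "\<rho> e = 0\<^sub>m n n"
    have "(1\<^sub>m n :: complex mat) $$ (0, 0) \<noteq> 0\<^sub>m n n $$ (0, 0)" using n by simp
    then have "\<rho> e \<noteq> 1\<^sub>m n" using r by metis
    then show ?thesis using r by (simp add: character_def)
  qed
qed

text \<open>Among the central idempotents that act as the identity, one with a fixed space of least dimension
  is primitive: if it split, one of the two parts would act as the identity.  Two distinct primitive central
  idempotents are orthogonal and cannot both act as the identity.\<close>

lemma irreducible_unique_cpi:
  assumes X: "finite X" and A: "subalgebra X A" and \<rho>: "irreducible_representation X A n \<rho>"
  shows "\<exists>!e. e \<in> central_primitive_idempotents X A \<and> character A n \<rho> e \<noteq> 0"
proof -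
  have rep: "representation X A n \<rho>" and n: "n > 0"
    using \<rho> by (simp_all add: irreducible_representation_def)
  note rD = representationD[OF rep]
  obtain D :: "('a \<Rightarrow> complex) set" where D: "finite D" "supported X \<subseteq> fv.span D"
    using supported_span[OF X] by blast
  have neq: "(1\<^sub>m n :: complex mat) \<noteq> 0\<^sub>m n n"
  proof
    assume eq: "(1\<^sub>m n :: complex mat) = 0\<^sub>m n n"
    have "(1\<^sub>m n :: complex mat) $$ (0, 0) = 0" unfolding eq using n by simp
    then show False using n by simp
  qed
  define Q where "Q f \<longleftrightarrow> f \<in> central_idempotents X A \<and> \<rho> f = 1\<^sub>m n" for f
  have "Q (eps X)" using central_idempotents_one[OF X A] rD(2) Q_def by blast
  then obtain f where Qf: "Q f"
    and least: "\<And>g. Q g \<Longrightarrow> fv.dim (fixed_space X f) \<le> fv.dim (fixed_space X g)"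
    using ex_has_least_nat[of Q _ "\<lambda>f. fv.dim (fixed_space X f)"] by blast
  then have f: "f \<in> central_idempotents X A" "\<rho> f = 1\<^sub>m n" unfolding Q_def by blast+
  note fD = central_idempotentsD[OF f(1)]
  have minimal: "g = f" if g: "g \<in> central_idempotents X A" "cm_mult X f g = g" "\<rho> g = 1\<^sub>m n" for g
  proof -
    note gD = central_idempotentsD[OF g(1)]
    have "act X f v = v" if "act X g v = v" for v using that g(2) act_mult by metis
    then have sub: "fixed_space X g \<subseteq> fixed_space X f" unfolding fixed_space_def by blast
    have "fixed_space X g = fixed_space X f"
    proof (rule ccontr)
      assume "fixed_space X g \<noteq> fixed_space X f"
      then have "fixed_space X g \<subset> fixed_space X f" using sub by blast
      moreover have "fixed_space X f \<subseteq> fv.span D" using D(2) unfolding fixed_space_def by blast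
      ultimately have "fv.dim (fixed_space X g) < fv.dim (fixed_space X f)"
        by (intro subspace_dim_strict_mono[OF D(1)] fixed_space_subspace)
      then show False using least[of g] g unfolding Q_def by (metis not_less)
    qed
    then have "cm_mult X g f = f"
      using column_in_fixed_space[OF subalgebra_Mat[OF A fD(1)], of g]
        column_in_fixed_space[OF subalgebra_Mat[OF A fD(1)], of f] fD(3) by simp
    then show ?thesis using g(2) gD(2)[OF fD(1)] by metis
  qed
  have cpi: "f \<in> central_primitive_idempotents X A"
  proof (rule cpiI[OF f(1)])
    show "f \<noteq> 0" using f(2) representation_zero[OF A rep] neq by metis
    fix g assume g: "g \<in> central_idempotents X A" "cm_mult X f g = g"
    note gD = central_idempotentsD[OF g(1)]
    have h: "f - g \<in> central_idempotents X A" by (rule central_idempotents_diff[OF A f(1) g])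
    have fh: "cm_mult X f (f - g) = f - g" using fD(3) g(2) by (simp add: cm_mult_diff_right)
    have "\<rho> f = \<rho> (f - g) + \<rho> g"
      using rD(3)[OF central_idempotentsD(1)[OF h] gD(1)] by simp
    then have "\<rho> g = 1\<^sub>m n \<or> \<rho> (f - g) = 1\<^sub>m n"
      using irreducible_central_idempotent[OF A \<rho> g(1)] irreducible_central_idempotent[OF A \<rho> h]
        f(2) neq by auto
    then show "g = 0 \<or> g = f"
      using minimal[OF g] minimal[OF h fh] by (metis add_cancel_left_right diff_add_cancel)
  qed
  have uniq: "e = f" if e: "e \<in> central_primitive_idempotents X A" "character A n \<rho> e \<noteq> 0" for e
  proof (rule ccontr)
    assume "e \<noteq> f"
    then have "cm_mult X e f = 0" by (rule cpi_orthogonal[OF A e(1) cpi])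
    moreover have "\<rho> e = 1\<^sub>m n" using character_nonzero_iff[OF A \<rho> cpiD(1)[OF e(1)]] e(2) by blast
    ultimately have "\<rho> 0 = 1\<^sub>m n * 1\<^sub>m n"
      using rD(4)[OF central_idempotentsD(1)[OF cpiD(1)[OF e(1)]] fD(1)] f(2) by metis
    then show False using neq representation_zero[OF A rep] by simp
  qed
  show ?thesis
  proof (rule ex1I[of _ f])
    show "f \<in> central_primitive_idempotents X A \<and> character A n \<rho> f \<noteq> 0"
      using cpi character_nonzero_iff[OF A \<rho> f(1)] f(2) by blast
  qed (use uniq in blast)
qed

lemma idempotent_of_eqI:
  assumes "finite X" "subalgebra X A" "\<chi> \<in> Irr X A"
    and "e \<in> central_primitive_idempotents X A" "\<chi> e \<noteq> 0"
  shows "idempotent_of X A \<chi> = e"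
proof -
  obtain n \<rho> where "\<chi> = character A n \<rho>" "irreducible_representation X A n \<rho>"
    using assms(3) unfolding Irr_def by blast
  then have "\<exists>!e. e \<in> central_primitive_idempotents X A \<and> \<chi> e \<noteq> 0"
    using irreducible_unique_cpi[OF assms(1,2)] by blast
  then show ?thesis unfolding idempotent_of_def using assms(4,5) by (intro the1_equality) blast+
qed

lemma idempotent_of_Irr:
  assumes "finite X" "subalgebra X A" "\<chi> \<in> Irr X A"
  shows "idempotent_of X A \<chi> \<in> central_primitive_idempotents X A \<and> \<chi> (idempotent_of X A \<chi>) \<noteq> 0"
proof -
  obtain n \<rho> where "\<chi> = character A n \<rho>" "irreducible_representation X A n \<rho>"
    using assms(3) unfolding Irr_def by blast
  then have "\<exists>!e. e \<in> central_primitive_idempotents X A \<and> \<chi> e \<noteq> 0"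
    using irreducible_unique_cpi[OF assms(1,2)] by blast
  then show ?thesis unfolding idempotent_of_def by (rule theI')
qed

lemma idempotent_of_surj:
  assumes X: "finite X" and A: "subalgebra X A" and e: "e \<in> central_primitive_idempotents X A"
  obtains \<chi> where "\<chi> \<in> Irr X A" "idempotent_of X A \<chi> = e"
proof -
  obtain n \<rho> where \<rho>: "irreducible_representation X A n \<rho>" "\<rho> e = 1\<^sub>m n"
    using irreducible_representation_exists[OF X A cpiD[OF e]] by blast
  have irr: "character A n \<rho> \<in> Irr X A" using \<rho> Irr_def by blast
  have "character A n \<rho> e \<noteq> 0" using character_nonzero_iff[OF A \<rho>(1) cpiD(1)[OF e]] \<rho>(2) by blast
  then have "idempotent_of X A (character A n \<rho>) = e" by (rule idempotent_of_eqI[OF X A irr e])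
  then show ?thesis using irr that by blast
qed

text \<open>The map from irreducible characters to primitive central idempotents is onto.  Removing one fibre
  removes exactly one idempotent, and the definite description of the removed character needs that fibre to
  be a single character; this is the hypothesis \<open>uniq\<close>.\<close>

lemma idempotents_of_nontrivial_characters:
  assumes X: "finite X" and A: "subalgebra X A" and e: "e \<in> central_primitive_idempotents X A"
    and uniq: "\<And>\<chi> \<chi>'. \<chi> \<in> Irr X A \<Longrightarrow> \<chi>' \<in> Irr X A \<Longrightarrow> \<chi> e \<noteq> 0 \<Longrightarrow> \<chi>' e \<noteq> 0 \<Longrightarrow> \<chi> = \<chi>'"
  shows "idempotent_of X A ` (Irr X A - {character_of_idempotent X A e}) =
           central_primitive_idempotents X A - {e}"
proof -
  have nz: "\<chi> e \<noteq> 0" if "\<chi> \<in> Irr X A" "idempotent_of X A \<chi> = e" for \<chi>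
    using idempotent_of_Irr[OF X A that(1)] that(2) by simp
  obtain \<chi> where \<chi>: "\<chi> \<in> Irr X A" "idempotent_of X A \<chi> = e" by (rule idempotent_of_surj[OF X A e])
  have char: "character_of_idempotent X A e = \<chi>"
    unfolding character_of_idempotent_def using \<chi> uniq nz by (intro the_equality) blast+
  have iff: "\<psi> = \<chi> \<longleftrightarrow> idempotent_of X A \<psi> = e" if "\<psi> \<in> Irr X A" for \<psi>
    using that uniq nz \<chi> by blast
  show ?thesis
  proof (intro equalityI subsetI)
    fix f assume "f \<in> idempotent_of X A ` (Irr X A - {character_of_idempotent X A e})"
    then obtain \<psi> where "\<psi> \<in> Irr X A" "\<psi> \<noteq> \<chi>" "f = idempotent_of X A \<psi>" unfolding char by blast
    then show "f \<in> central_primitive_idempotents X A - {e}"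
      using idempotent_of_Irr[OF X A] iff by blast
  next
    fix f assume f: "f \<in> central_primitive_idempotents X A - {e}"
    then obtain \<psi> where \<psi>: "\<psi> \<in> Irr X A" "idempotent_of X A \<psi> = f"
      using idempotent_of_surj[OF X A, of f] by blast
    then have "\<psi> \<noteq> \<chi>" using iff f by blast
    then show "f \<in> idempotent_of X A ` (Irr X A - {character_of_idempotent X A e})"
      unfolding char using \<psi> by blast
  qed
qed

text \<open>Take a nonzero vector \<open>w = p w\<close>.  By irreducibility the vectors \<open>M w\<close> fill the representation space,
  and \<open>p M w = p M p w\<close> is a multiple of \<open>w\<close>.  So \<open>p\<close> is represented by a rank-one idempotent.\<close>

lemma trace_of_scalar_corner:
  assumes A: "subalgebra X A" and \<rho>: "irreducible_representation X A n \<rho>"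
    and p: "p \<in> A" "cm_mult X p p = p" "\<rho> p \<noteq> 0\<^sub>m n n"
    and corner: "\<And>M. M \<in> A \<Longrightarrow> cm_mult X (cm_mult X p M) p = cm_scale (\<phi> M) p"
  shows "(\<Sum>i<n. \<rho> p $$ (i, i)) = 1"
proof -
  have rep: "representation X A n \<rho>" using \<rho> by (simp add: irreducible_representation_def)
  note rD = representationD[OF rep] and rM = representation_mult_vec[OF rep]
  have rp: "\<rho> p \<in> carrier_mat n n" by (rule rD(1)[OF p(1)])
  obtain j where j: "j < n" "\<rho> p *\<^sub>v unit_vec n j \<noteq> 0\<^sub>v n"
  proof (rule ccontr)
    assume "\<not> thesis"
    then have "\<rho> p *\<^sub>v unit_vec n j = 0\<^sub>v n" if "j < n" for j using that \<open>\<And>j. j < n \<Longrightarrow> _ \<Longrightarrow> thesis\<close> by blast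
    then have "\<rho> p = 0\<^sub>m n n" by (intro mat_eq_by_columns[OF rp]) (auto simp: zero_mat_mult_vec)
    then show False using p(3) by blast
  qed
  define w where "w = \<rho> p *\<^sub>v unit_vec n j"
  have w: "w \<in> carrier_vec n" "w \<noteq> 0\<^sub>v n" using rp j w_def by auto
  have pw: "\<rho> p *\<^sub>v w = w" using rM[OF p(1) p(1), of "unit_vec n j"] p(2) w_def by simp
  define V where "V = {\<rho> M *\<^sub>v w | M. M \<in> A}"
  have VI: "\<rho> M *\<^sub>v w \<in> V" if "M \<in> A" for M using that V_def by blast
  have "VectorSpace.subspace class_ring V (module_vec TYPE(complex) n)"
    unfolding jnf_subspace_iff
  proof (intro conjI ballI allI)
    show "V \<subseteq> carrier_vec n" using rD(1) w V_def by fastforce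
    have "\<rho> 0 *\<^sub>v w = 0\<^sub>v n" using representation_zero[OF A rep] w by (simp add: zero_mat_mult_vec)
    then show "0\<^sub>v n \<in> V" using VI[OF subalgebra_zero[OF A]] by simp
    fix v assume "v \<in> V"
    then obtain M where M: "v = \<rho> M *\<^sub>v w" "M \<in> A" using V_def by blast
    show "c \<cdot>\<^sub>v v \<in> V" for c
      using VI[OF subalgebra_scale[OF A M(2)], of c] rD(5)[OF M(2)] M
        smult_mat_mult_vec[OF rD(1)[OF M(2)] w(1)] by simp
    fix v' assume "v' \<in> V"
    then obtain N where N: "v' = \<rho> N *\<^sub>v w" "N \<in> A" using V_def by blast
    show "v + v' \<in> V"
      using VI[OF subalgebra_add[OF A M(2) N(2)]] rD(3)[OF M(2) N(2)] M N
        add_mult_distrib_mat_vec[OF rD(1)[OF M(2)] rD(1)[OF N(2)] w(1)] by simp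
  qed
  moreover have "\<rho> M *\<^sub>v v \<in> V" if M: "M \<in> A" and v: "v \<in> V" for M v
  proof -
    obtain N where N: "v = \<rho> N *\<^sub>v w" "N \<in> A" using v V_def by blast
    show ?thesis using VI[OF subalgebra_mult[OF A M N(2)]] rM[OF M N(2) w(1)] N by simp
  qed
  ultimately have "V = {0\<^sub>v n} \<or> V = carrier_vec n"
    using \<rho> unfolding irreducible_representation_def by blast
  moreover have "w \<in> V" using VI[OF p(1)] pw by simp
  ultimately have Vall: "V = carrier_vec n" using w by blast
  have "\<exists>M\<in>A. unit_vec n j = \<rho> M *\<^sub>v w" for j
  proof -
    have "unit_vec n j \<in> V" unfolding Vall by simp
    then show ?thesis using V_def by blast
  qed
  then obtain m where m: "\<And>j. m j \<in> A" "\<And>j. unit_vec n j = \<rho> (m j) *\<^sub>v w" by metis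
  have col_p: "\<rho> p *\<^sub>v unit_vec n j = \<phi> (m j) \<cdot>\<^sub>v w" for j
  proof -
    have "\<rho> p *\<^sub>v unit_vec n j = \<rho> p *\<^sub>v (\<rho> (m j) *\<^sub>v (\<rho> p *\<^sub>v w))"
      using m(2)[of j] pw by simp
    also have "\<dots> = \<rho> (cm_mult X (cm_mult X p (m j)) p) *\<^sub>v w"
      using rM[OF p(1) m(1)] rM[OF subalgebra_mult[OF A p(1) m(1)] p(1) w(1)] pw w(1) by simp
    also have "\<dots> = \<phi> (m j) \<cdot>\<^sub>v w"
      using corner[OF m(1)] rD(5)[OF p(1)] smult_mat_mult_vec[OF rp w(1)] pw by simp
    finally show ?thesis .
  qed
  have entry: "\<rho> p $$ (i, j) = \<phi> (m j) * w $ i" if ij: "i < n" "j < n" for i j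
  proof -
    have "\<rho> p $$ (i, j) = col (\<rho> p) j $ i" using rp ij by simp
    also have "col (\<rho> p) j = \<phi> (m j) \<cdot>\<^sub>v w" using mat_unit_vec_col[OF rp ij(2)] col_p[of j] by simp
    finally show ?thesis using w(1) ij by simp
  qed
  obtain i where i: "i < n" "w $ i \<noteq> 0"
    using w by (metis carrier_vecD eq_vecI index_zero_vec(1) index_zero_vec(2))
  have "w $ i = (\<rho> p *\<^sub>v w) $ i" using pw by simp
  also have "\<dots> = (\<Sum>j<n. \<rho> p $$ (i, j) * w $ j)"
    using rp w(1) i by (auto simp: scalar_prod_def lessThan_atLeast0 intro!: sum.cong)
  also have "\<dots> = (\<Sum>j<n. \<phi> (m j) * w $ j) * w $ i"
    using i by (simp add: entry sum_distrib_left sum_distrib_right mult.commute mult.left_commute)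
  also have "(\<Sum>j<n. \<phi> (m j) * w $ j) = (\<Sum>j<n. \<rho> p $$ (j, j))"
    by (intro sum.cong) (auto simp: entry)
  finally show ?thesis using i by simp
qed

text \<open>If \<open>\<chi>\<close> does not vanish at \<open>e\<close>, then \<open>e\<close> acts as the identity, and cyclicity of the trace gives
  \<open>\<chi> M = \<Sum> \<chi> (M K\<^sub>i p L\<^sub>i) = \<Sum> \<chi> (p L\<^sub>i M K\<^sub>i p)\<close>, where \<open>p N p\<close> is the multiple \<open>\<phi> N\<close> of \<open>p\<close> and \<open>p\<close> has trace 1.
  The resulting formula does not mention \<open>\<chi>\<close>.\<close>

lemma scalar_corner_character_unique:
  assumes A: "subalgebra X A" and e: "e \<in> central_idempotents X A"
    and p: "p \<in> A" "cm_mult X p p = p"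
    and corner: "\<And>M. M \<in> A \<Longrightarrow> cm_mult X (cm_mult X p M) p = cm_scale (\<phi> M) p"
    and KL: "\<And>i. i \<in> I \<Longrightarrow> K i \<in> A" "\<And>i. i \<in> I \<Longrightarrow> L i \<in> A"
    and e_sum: "e = (\<Sum>i\<in>I. cm_mult X (cm_mult X (K i) p) (L i))"
    and \<chi>: "\<chi> \<in> Irr X A" "\<chi> e \<noteq> 0"
  shows "\<chi> = (\<lambda>M. if M \<in> A then \<Sum>i\<in>I. \<phi> (cm_mult X (cm_mult X (L i) M) (K i)) else 0)"
proof -
  obtain n \<rho> where \<rho>: "irreducible_representation X A n \<rho>" and \<chi>_def: "\<chi> = character A n \<rho>"
    using \<chi>(1) unfolding Irr_def by blast
  have rep: "representation X A n \<rho>" and n: "n > 0"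
    using \<rho> by (simp_all add: irreducible_representation_def)
  note rD = representationD[OF rep]
  note Am = subalgebra_mult[OF A]
  have \<rho>e: "\<rho> e = 1\<^sub>m n" using character_nonzero_iff[OF A \<rho> e] \<chi> \<chi>_def by blast
  define \<tau> where "\<tau> M = (\<Sum>i<n. \<rho> M $$ (i, i))" for M
  have \<tau>_add: "\<tau> (M + N) = \<tau> M + \<tau> N" if "M \<in> A" "N \<in> A" for M N
    using rD(1)[OF that(1)] rD(1)[OF that(2)] rD(3)[OF that] by (simp add: \<tau>_def sum.distrib)
  have \<tau>_scale: "\<tau> (cm_scale c M) = c * \<tau> M" if "M \<in> A" for c M
    using rD(1)[OF that] rD(5)[OF that] by (simp add: \<tau>_def sum_distrib_left)
  have \<tau>_zero: "\<tau> 0 = 0" using representation_zero[OF A rep] by (simp add: \<tau>_def)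
  have \<tau>_sum: "\<tau> (\<Sum>i\<in>J. F i) = (\<Sum>i\<in>J. \<tau> (F i))" if "\<And>i. i \<in> J \<Longrightarrow> F i \<in> A" for J and F :: "'c \<Rightarrow> 'a cmat"
    using that
  proof (induction J rule: infinite_finite_induct)
    case (infinite J)
    then show ?case using \<tau>_zero by (metis sum.infinite)
  next
    case empty
    then show ?case using \<tau>_zero by (metis sum.empty)
  next
    case (insert i J)
    have eq: "(\<Sum>i\<in>insert i J. F i) = F i + (\<Sum>i\<in>J. F i)" by (rule sum.insert[OF insert.hyps])
    have "(\<Sum>i\<in>J. F i) \<in> A" using insert.prems by (intro subalgebra_sum[OF A]) blast
    then have "\<tau> (F i + (\<Sum>i\<in>J. F i)) = \<tau> (F i) + \<tau> (\<Sum>i\<in>J. F i)"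
      by (intro \<tau>_add) (use insert.prems in blast)+
    also have "\<dots> = (\<Sum>i\<in>insert i J. \<tau> (F i))" using insert by simp
    finally show ?case unfolding eq .
  qed
  have \<tau>_cyc: "\<tau> (cm_mult X M N) = \<tau> (cm_mult X N M)" if "M \<in> A" "N \<in> A" for M N
  proof -
    have *: "\<tau> (cm_mult X M N) = (\<Sum>i<n. \<Sum>j<n. \<rho> M $$ (i, j) * \<rho> N $$ (j, i))"
      if "M \<in> A" "N \<in> A" for M N
      using rD(1)[OF that(1)] rD(1)[OF that(2)] rD(4)[OF that]
      by (auto simp: \<tau>_def scalar_prod_def lessThan_atLeast0 intro!: sum.cong)
    show ?thesis unfolding *[OF that] *[OF that(2,1)]
      by (subst sum.swap) (simp add: mult.commute)
  qed
  have \<rho>p: "\<rho> p \<noteq> 0\<^sub>m n n"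
  proof
    assume p0: "\<rho> p = 0\<^sub>m n n"
    have "\<tau> (cm_mult X (cm_mult X (K i) p) (L i)) = 0" if i: "i \<in> I" for i
    proof -
      have "\<rho> (cm_mult X (cm_mult X (K i) p) (L i)) = 0\<^sub>m n n"
        using rD(4)[OF Am[OF KL(1)[OF i] p(1)] KL(2)[OF i]] rD(4)[OF KL(1)[OF i] p(1)] p0
          rD(1)[OF KL(1)[OF i]] rD(1)[OF KL(2)[OF i]] by simp
      then show ?thesis by (simp add: \<tau>_def)
    qed
    moreover have "cm_mult X (cm_mult X (K i) p) (L i) \<in> A" if "i \<in> I" for i
      using Am KL p that by metis
    ultimately have "\<tau> e = 0" unfolding e_sum by (simp add: \<tau>_sum)
    moreover have "\<tau> e = of_nat n" using \<rho>e by (simp add: \<tau>_def)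
    ultimately show False using n by simp
  qed
  have \<tau>p: "\<tau> p = 1" unfolding \<tau>_def by (rule trace_of_scalar_corner[OF A \<rho> p \<rho>p corner])
  have "\<tau> M = (\<Sum>i\<in>I. \<phi> (cm_mult X (cm_mult X (L i) M) (K i)))" if M: "M \<in> A" for M
  proof -
    have "\<tau> M = \<tau> (cm_mult X M e)"
      using rD(4)[OF M central_idempotentsD(1)[OF e]] \<rho>e rD(1)[OF M] by (simp add: \<tau>_def)
    also have "cm_mult X M e = (\<Sum>i\<in>I. cm_mult X (cm_mult X (cm_mult X M (K i)) p) (L i))"
      unfolding e_sum by (simp only: cm_mult_sum_right cm_mult_assoc)
    also have "\<tau> \<dots> = (\<Sum>i\<in>I. \<tau> (cm_mult X (cm_mult X (cm_mult X M (K i)) p) (L i)))"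
      using Am KL p M by (intro \<tau>_sum) metis
    also have "\<dots> = (\<Sum>i\<in>I. \<phi> (cm_mult X (cm_mult X (L i) M) (K i)))"
    proof (rule sum.cong[OF refl])
      fix i assume i: "i \<in> I"
      let ?N = "cm_mult X (cm_mult X (L i) M) (K i)"
      have N: "?N \<in> A" and MK: "cm_mult X M (K i) \<in> A" and MKp: "cm_mult X (cm_mult X M (K i)) p \<in> A"
        using Am KL[OF i] p M by metis+
      have Np: "cm_mult X ?N p \<in> A" using Am N p by metis
      have "\<tau> (cm_mult X (cm_mult X (cm_mult X M (K i)) p) (L i)) = \<tau> (cm_mult X ?N p)"
        unfolding \<tau>_cyc[OF MKp KL(2)[OF i]] by (simp only: cm_mult_assoc)
      also have "cm_mult X ?N p = cm_mult X (cm_mult X ?N p) p" using p(2) by (simp only: cm_mult_assoc)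
      also have "\<tau> \<dots> = \<tau> (cm_mult X (cm_mult X p ?N) p)"
        unfolding \<tau>_cyc[OF Np p(1)] by (simp only: cm_mult_assoc)
      also have "\<dots> = \<phi> ?N" using corner[OF N] \<tau>_scale[OF p(1)] \<tau>p by simp
      finally show "\<tau> (cm_mult X (cm_mult X (cm_mult X M (K i)) p) (L i)) = \<phi> ?N" .
    qed
    finally show ?thesis .
  qed
  then show ?thesis unfolding \<chi>_def character_def \<tau>_def by (simp add: fun_eq_iff)
qed

text \<open>A matrix \<open>p\<close> of rank one satisfies \<open>p M p \<in> \<complex> p\<close> for every \<open>M\<close>, so both preceding criteria apply.  This
  settles primitivity and uniqueness of the character for the trivial idempotents.\<close>

lemma rank_one_ideal:
  assumes A: "subalgebra X A" and e: "e \<in> central_idempotents X A"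
    and p: "p \<in> A" "p \<noteq> 0" "cm_mult X p p = p" "cm_mult X e p = p"
    and rank: "\<And>x y. p x y = a x * b y"
    and KL: "\<And>i. i \<in> I \<Longrightarrow> K i \<in> A" "\<And>i. i \<in> I \<Longrightarrow> L i \<in> A"
    and e_sum: "e = (\<Sum>i\<in>I. cm_mult X (cm_mult X (K i) p) (L i))"
  shows "e \<in> central_primitive_idempotents X A"
    and "\<lbrakk>\<chi> \<in> Irr X A; \<chi>' \<in> Irr X A; \<chi> e \<noteq> 0; \<chi>' e \<noteq> 0\<rbrakk> \<Longrightarrow> \<chi> = \<chi>'"
proof -
  have corner: "\<exists>c. cm_mult X (cm_mult X p M) p = cm_scale c p" for M
    by (rule rank_one_corner[OF rank])
  show "e \<in> central_primitive_idempotents X A"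
  proof (rule cpi_of_scalar_corner[OF A e p corner])
    fix f assume f: "f \<in> central_idempotents X A" and fp: "cm_mult X f p = 0"
    have "cm_mult X f (cm_mult X (cm_mult X (K i) p) (L i)) = 0" if i: "i \<in> I" for i
    proof -
      have "cm_mult X f (cm_mult X (cm_mult X (K i) p) (L i)) =
          cm_mult X (cm_mult X (cm_mult X f (K i)) p) (L i)" by (simp only: cm_mult_assoc)
      also have "cm_mult X f (K i) = cm_mult X (K i) f" by (rule central_idempotentsD(2)[OF f KL(1)[OF i]])
      also have "cm_mult X (cm_mult X (cm_mult X (K i) f) p) (L i) = 0"
        unfolding cm_mult_assoc[of X "K i" f p] fp by simp
      finally show ?thesis .
    qed
    then show "cm_mult X f e = 0" unfolding e_sum by (simp add: cm_mult_sum_right)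
  qed
  obtain \<phi> where \<phi>: "\<And>M. cm_mult X (cm_mult X p M) p = cm_scale (\<phi> M) p"
    using corner by metis
  show "\<chi> = \<chi>'" if "\<chi> \<in> Irr X A" "\<chi>' \<in> Irr X A" "\<chi> e \<noteq> 0" "\<chi>' e \<noteq> 0"
    using scalar_corner_character_unique[OF A e p(1,3) \<phi> KL e_sum that(1,3)]
      scalar_corner_character_unique[OF A e p(1,3) \<phi> KL e_sum that(2,4)] by simp
qed

section \<open>Association schemes and their trivial idempotents\<close>

lemma scheme_finite: "scheme X S \<Longrightarrow> finite X"
  and scheme_partition: "scheme X S \<Longrightarrow> partition_on (X \<times> X) S"
  and scheme_Id: "scheme X S \<Longrightarrow> Id_on X \<in> S"
  and scheme_converse: "scheme X S \<Longrightarrow> s \<in> S \<Longrightarrow> s\<inverse> \<in> S"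
  by (simp_all add: scheme_def coherent_configuration_def)

lemma scheme_card_const:
  assumes "scheme X S" "s \<in> S" "t \<in> S" "u \<in> S" "(x, y) \<in> u" "(x', y') \<in> u"
  shows "card {z. (x, z) \<in> s \<and> (z, y) \<in> t} = card {z. (x', z) \<in> s \<and> (z, y') \<in> t}"
proof -
  have "\<forall>s\<in>S. \<forall>t\<in>S. \<forall>u\<in>S. \<forall>(x, y)\<in>u. \<forall>(x', y')\<in>u.
        card {z. (x, z) \<in> s \<and> (z, y) \<in> t} = card {z. (x', z) \<in> s \<and> (z, y') \<in> t}"
    using assms(1) unfolding scheme_def coherent_configuration_def by (elim conjE)
  from this[rule_format, OF assms(2-4)] show ?thesis using assms(5,6) by blast
qed

lemma scheme_subset: "scheme X S \<Longrightarrow> s \<in> S \<Longrightarrow> s \<subseteq> X \<times> X"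
  using scheme_partition partition_onD1 by blast

lemma scheme_mem: "scheme X S \<Longrightarrow> s \<in> S \<Longrightarrow> (x, y) \<in> s \<Longrightarrow> x \<in> X \<and> y \<in> X"
  using scheme_subset by blast

lemma scheme_nonempty: "scheme X S \<Longrightarrow> s \<in> S \<Longrightarrow> s \<noteq> {}"
  using scheme_partition partition_onD3 by blast

lemma scheme_unique: "scheme X S \<Longrightarrow> s \<in> S \<Longrightarrow> t \<in> S \<Longrightarrow> p \<in> s \<Longrightarrow> p \<in> t \<Longrightarrow> s = t"
  using scheme_partition partition_onD2 unfolding disjoint_def by blast

lemma scheme_exists:
  assumes "scheme X S" "x \<in> X" "y \<in> X"
  obtains s where "s \<in> S" "(x, y) \<in> s"
proof -
  have "(x, y) \<in> \<Union>S" using partition_onD1[OF scheme_partition[OF assms(1)]] assms(2,3) by auto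
  then show thesis using that by blast
qed

lemma scheme_finite_relations: "scheme X S \<Longrightarrow> finite S"
  using scheme_finite scheme_subset by (metis PowI finite_Pow_iff finite_SigmaI rev_finite_subset subsetI)

lemma scheme_carrier_nonempty: "scheme X S \<Longrightarrow> X \<noteq> {}"
  using scheme_Id scheme_nonempty by (metis Id_on_empty)

lemma intersection_number_eq:
  assumes "scheme X S" "s \<in> S" "t \<in> S" "u \<in> S" "(x, y) \<in> u"
  shows "intersection_number s t u = card {z. (x, z) \<in> s \<and> (z, y) \<in> t}"
  unfolding intersection_number_def
proof (rule the_equality)
  show "\<forall>(x', y')\<in>u. card {z. (x', z) \<in> s \<and> (z, y') \<in> t} = card {z. (x, z) \<in> s \<and> (z, y) \<in> t}"
    using scheme_card_const[OF assms(1-4) _ assms(5)] by blast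
  fix n assume "\<forall>(x, y)\<in>u. card {z. (x, z) \<in> s \<and> (z, y) \<in> t} = n"
  then show "n = card {z. (x, z) \<in> s \<and> (z, y) \<in> t}" using assms(5) by fastforce
qed

lemma valency_eq:
  assumes "scheme X S" "s \<in> S" "x \<in> X"
  shows "valency X s = card (s `` {x})"
proof -
  have "valency X s = card {z. (x, z) \<in> s \<and> (z, x) \<in> s\<inverse>}"
    unfolding valency_def
    using assms by (intro intersection_number_eq scheme_converse scheme_Id) auto
  also have "{z. (x, z) \<in> s \<and> (z, x) \<in> s\<inverse>} = s `` {x}" by auto
  finally show ?thesis .
qed

lemma scheme_image_subset: "scheme X S \<Longrightarrow> s \<in> S \<Longrightarrow> s `` {x} \<subseteq> X"
  using scheme_subset by blast

lemma scheme_image_finite: "scheme X S \<Longrightarrow> s \<in> S \<Longrightarrow> finite (s `` {x})"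
  using scheme_image_subset scheme_finite finite_subset by metis

lemma valency_pos:
  assumes "scheme X S" "s \<in> S"
  shows "valency X s > 0"
proof -
  obtain x y where xy: "(x, y) \<in> s" using scheme_nonempty[OF assms] by auto
  then have "s `` {x} \<noteq> {}" "x \<in> X" using scheme_mem[OF assms] by auto
  then show ?thesis
    using valency_eq[OF assms] scheme_image_finite[OF assms] by (simp add: card_gt_0_iff)
qed

lemma scheme_image_nonempty: "scheme X S \<Longrightarrow> s \<in> S \<Longrightarrow> x \<in> X \<Longrightarrow> s `` {x} \<noteq> {}"
  using valency_pos valency_eq by (metis card.empty less_numeral_extra(3))

lemma valency_converse:
  assumes "scheme X S" "s \<in> S"
  shows "valency X (s\<inverse>) = valency X s"
proof -
  have *: "card t = card X * valency X t" if t: "t \<in> S" for t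
  proof -
    have "t = (SIGMA x:X. t `` {x})" using scheme_subset[OF assms(1) t] by auto
    then have "card t = (\<Sum>x\<in>X. card (t `` {x}))"
      using scheme_finite[OF assms(1)] scheme_image_finite[OF assms(1) t] by (metis card_SigmaI)
    also have "\<dots> = (\<Sum>x\<in>X. valency X t)"
      by (rule sum.cong) (simp_all add: valency_eq[OF assms(1) t])
    also have "\<dots> = card X * valency X t" by simp
    finally show ?thesis .
  qed
  have "card (s\<inverse>) = card s" by (rule card_inverse)
  then show ?thesis
    using *[OF assms(2)] *[OF scheme_converse[OF assms]] scheme_carrier_nonempty[OF assms(1)]
      scheme_finite[OF assms(1)] by simp
qed

lemma sigma_in_Mat: "scheme X S \<Longrightarrow> s \<in> S \<Longrightarrow> sigma s \<in> Mat X"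
  by (auto simp: Mat_def sigma_def dest: scheme_mem)

lemma sigma_product:
  assumes "finite X" "s \<subseteq> X \<times> X"
  shows "cm_mult X (sigma s) (sigma t) x y = of_nat (card {z. (x, z) \<in> s \<and> (z, y) \<in> t})"
proof -
  have "cm_mult X (sigma s) (sigma t) x y = (\<Sum>z\<in>X. of_bool ((x, z) \<in> s \<and> (z, y) \<in> t))"
    by (simp add: cm_mult_def sigma_def flip: of_bool_conj)
  also have "\<dots> = of_nat (card {z \<in> X. (x, z) \<in> s \<and> (z, y) \<in> t})" using assms(1) by (simp add: Int_def)
  also have "{z \<in> X. (x, z) \<in> s \<and> (z, y) \<in> t} = {z. (x, z) \<in> s \<and> (z, y) \<in> t}" using assms(2) by blast
  finally show ?thesis .
qed

text \<open>This description makes closure of the adjacency algebra under multiplication the statement that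
  intersection numbers are constant on relations.\<close>

lemma adjacency_algebra_iff:
  assumes S: "scheme X S"
  shows "M \<in> adjacency_algebra S \<longleftrightarrow>
    M \<in> Mat X \<and> (\<forall>s\<in>S. \<forall>x y x' y'. (x, y) \<in> s \<and> (x', y') \<in> s \<longrightarrow> M x y = M x' y')"
    (is "_ \<longleftrightarrow> ?R")
proof -
  have entry: "(\<Sum>s\<in>S. cm_scale (c s) (sigma s)) x y = c s" if s: "s \<in> S" "(x, y) \<in> s" for c s x y
  proof -
    have "(\<Sum>s\<in>S. cm_scale (c s) (sigma s)) x y = (\<Sum>s'\<in>S. if s' = s then c s else 0)"
      unfolding sum_fun_apply2
      by (rule sum.cong[OF refl]) (use s scheme_unique[OF S] in \<open>auto simp: cm_scale_def sigma_def\<close>)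
    then show ?thesis using s scheme_finite_relations[OF S] by simp
  qed
  have out: "(\<Sum>s\<in>S. cm_scale (c s) (sigma s)) x y = 0" if "\<not> (x \<in> X \<and> y \<in> X)" for c x y
    unfolding sum_fun_apply2 using that scheme_mem[OF S]
    by (intro sum.neutral) (auto simp: cm_scale_def sigma_def)
  show ?thesis
  proof
    assume "M \<in> adjacency_algebra S"
    then obtain c where M: "M = (\<Sum>s\<in>S. cm_scale (c s) (sigma s))" unfolding adjacency_algebra_def by blast
    have "M \<in> Mat X" using out[of _ _ c] unfolding M by (intro Mat_I) blast
    moreover have "M x y = c s" if "s \<in> S" "(x, y) \<in> s" for s x y
      using entry[OF that] M by simp
    ultimately show ?R by simp
  next
    assume R: ?R
    define c where "c s = (case (SOME p. p \<in> s) of (x, y) \<Rightarrow> M x y)" for s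
    have c: "M x y = c s" if s: "s \<in> S" "(x, y) \<in> s" for s x y
    proof -
      obtain x' y' where p: "(SOME p. p \<in> s) = (x', y')" by fastforce
      have "(x', y') \<in> s" using someI[of "\<lambda>p. p \<in> s", OF s(2)] p by simp
      then have "M x y = M x' y'" using R s by blast
      then show ?thesis by (simp only: c_def p prod.case)
    qed
    have "M = (\<Sum>s\<in>S. cm_scale (c s) (sigma s))"
    proof (intro ext)
      fix x y
      show "M x y = (\<Sum>s\<in>S. cm_scale (c s) (sigma s)) x y"
      proof (cases "x \<in> X \<and> y \<in> X")
        case True
        then obtain s where s: "s \<in> S" "(x, y) \<in> s" using scheme_exists[OF S] by blast
        show ?thesis using c[OF s] entry[OF s, of c] by simp
      next
        case False
        have "M \<in> Mat X" using R by (rule conjunct1)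
        then have "M x y = 0" by (rule Mat_outside) (use False in blast)
        then show ?thesis using out[OF False, of c] by simp
      qed
    qed
    then show "M \<in> adjacency_algebra S"
      unfolding adjacency_algebra_def by (intro CollectI exI[of _ c] conjI TrueI)
  qed
qed

lemma adjacency_algebra_const:
  assumes S: "scheme X S" and M: "M \<in> adjacency_algebra S"
    and s: "s \<in> S" "(x, y) \<in> s" "(x', y') \<in> s"
  shows "M x y = M x' y'"
proof -
  have "\<forall>s\<in>S. \<forall>x y x' y'. (x, y) \<in> s \<and> (x', y') \<in> s \<longrightarrow> M x y = M x' y'"
    by (rule conjunct2[OF iffD1[OF adjacency_algebra_iff[OF S] M]])
  from this[rule_format, OF s(1) conjI, OF s(2,3)] show ?thesis .
qed

lemma sigma_in_adjacency_algebra: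
  assumes S: "scheme X S" and "s \<in> S"
  shows "sigma s \<in> adjacency_algebra S"
  unfolding adjacency_algebra_iff[OF S]
proof (intro conjI ballI allI impI)
  show "sigma s \<in> Mat X" by (rule sigma_in_Mat[OF assms])
  fix t x y x' y' assume "t \<in> S" "(x, y) \<in> t \<and> (x', y') \<in> t"
  then have "(x, y) \<in> s \<longleftrightarrow> (x', y') \<in> s" using scheme_unique[OF S _ assms(2)] by blast
  then show "sigma s x y = sigma s x' y'" by (simp add: sigma_def)
qed

lemma eps_eq_sigma: "eps X = sigma (Id_on X)"
  by (intro ext) (auto simp: eps_def sigma_def Id_on_iff)

lemma adjacency_algebra_subalgebra:
  assumes S: "scheme X S"
  shows "subalgebra X (adjacency_algebra S)"
proof -
  let ?A = "adjacency_algebra S"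
  note iff = adjacency_algebra_iff[OF S]
  have Mat: "M \<in> Mat X" if "M \<in> ?A" for M by (rule conjunct1[OF iffD1[OF iff that]])
  have one: "eps X \<in> ?A"
    unfolding eps_eq_sigma by (rule sigma_in_adjacency_algebra[OF S scheme_Id[OF S]])
  have add: "M + N \<in> ?A" if M: "M \<in> ?A" and N: "N \<in> ?A" for M N
    unfolding iff
  proof (intro conjI ballI allI impI)
    show "M + N \<in> Mat X" using M N Mat by (blast intro: Mat_add)
    fix s x y x' y' assume "s \<in> S" "(x, y) \<in> s \<and> (x', y') \<in> s"
    then have "M x y = M x' y'" "N x y = N x' y'"
      using adjacency_algebra_const[OF S M] adjacency_algebra_const[OF S N] by blast+
    then show "(M + N) x y = (M + N) x' y'" by simp
  qed
  have scale: "cm_scale c M \<in> ?A" if M: "M \<in> ?A" for c M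
    unfolding iff
  proof (intro conjI ballI allI impI)
    show "cm_scale c M \<in> Mat X" using M Mat by (blast intro: Mat_scale)
    fix s x y x' y' assume "s \<in> S" "(x, y) \<in> s \<and> (x', y') \<in> s"
    then have "M x y = M x' y'" using adjacency_algebra_const[OF S M] by blast
    then show "cm_scale c M x y = cm_scale c M x' y'" by (simp add: cm_scale_def)
  qed
  have mult: "cm_mult X M N \<in> ?A" if M: "M \<in> ?A" and N: "N \<in> ?A" for M N
    unfolding iff
  proof (intro conjI ballI allI impI)
    show "cm_mult X M N \<in> Mat X" using M N Mat by (blast intro: Mat_mult)
    fix u x y x' y' assume u: "u \<in> S" "(x, y) \<in> u \<and> (x', y') \<in> u"
    obtain c where c: "M = (\<Sum>s\<in>S. cm_scale (c s) (sigma s))"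
      using M unfolding adjacency_algebra_def by blast
    obtain d where d: "N = (\<Sum>s\<in>S. cm_scale (d s) (sigma s))"
      using N unfolding adjacency_algebra_def by blast
    have expand: "cm_mult X M N x y = (\<Sum>t\<in>S. \<Sum>s\<in>S. c s * (d t * cm_mult X (sigma s) (sigma t) x y))" for x y
      unfolding c d cm_mult_sum_left cm_mult_sum_right cm_mult_scale_left cm_mult_scale_right
        sum_fun_apply2 by (simp add: cm_scale_def sum_distrib_left mult.left_commute)
    have prod_const: "cm_mult X (sigma s) (sigma t) x y = cm_mult X (sigma s) (sigma t) x' y'"
      if "s \<in> S" "t \<in> S" for s t
      using scheme_card_const[OF S that u(1)] u(2)
        sigma_product[OF scheme_finite[OF S] scheme_subset[OF S that(1)]] by simp
    show "cm_mult X M N x y = cm_mult X M N x' y'"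
      unfolding expand by (intro sum.cong refl) (simp add: prod_const)
  qed
  show ?thesis unfolding subalgebra_def using Mat one add scale mult by blast
qed

lemma Jm_in_adjacency_algebra: "scheme X S \<Longrightarrow> Jm X X \<in> adjacency_algebra S"
  by (auto simp: adjacency_algebra_iff Mat_def Jm_def dest: scheme_mem)

lemma adjacency_algebra_spanned:
  assumes S: "scheme X S" and M: "M \<in> adjacency_algebra S"
    and C: "subalgebra X C" "\<And>s. s \<in> S \<Longrightarrow> sigma s \<in> C"
  shows "M \<in> C"
proof -
  obtain c where c: "M = (\<Sum>s\<in>S. cm_scale (c s) (sigma s))"
    using M unfolding adjacency_algebra_def by blast
  show ?thesis unfolding c by (intro subalgebra_sum[OF C(1)] subalgebra_scale[OF C(1)] C(2))
qed

text \<open>Row and column sums of an adjacency matrix agree, since a relation and its converse have the same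
  valency.\<close>

lemma sigma_Jm:
  assumes S: "scheme X S" and s: "s \<in> S"
  shows "cm_mult X (sigma s) (Jm X V) = cm_scale (of_nat (valency X s)) (Jm X V)"
    and "cm_mult X (Jm V X) (sigma s) = cm_scale (of_nat (valency X s)) (Jm V X)"
proof -
  note X = scheme_finite[OF S]
  have row: "(\<Sum>z\<in>X. of_bool ((x, z) \<in> t)) = (of_nat (if x \<in> X then valency X t else 0) :: complex)"
    if t: "t \<in> S" for t x
  proof -
    have "(\<Sum>z\<in>X. of_bool ((x, z) \<in> t)) = (of_nat (card (X \<inter> {z. (x, z) \<in> t})) :: complex)"
      using X by simp
    also have "X \<inter> {z. (x, z) \<in> t} = t `` {x}" using scheme_mem[OF S t] by auto
    also have "card (t `` {x}) = (if x \<in> X then valency X t else 0)"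
    proof (cases "x \<in> X")
      case False
      then have "t `` {x} = {}" using scheme_mem[OF S t] by blast
      then show ?thesis using False by simp
    qed (simp add: valency_eq[OF S t])
    finally show ?thesis .
  qed
  show "cm_mult X (sigma s) (Jm X V) = cm_scale (of_nat (valency X s)) (Jm X V)"
    using row[OF s] by (simp add: cm_mult_def sigma_def Jm_def cm_scale_def fun_eq_iff flip: sum_distrib_right)
  have "(\<Sum>z\<in>X. of_bool ((z, y) \<in> s)) = (of_nat (if y \<in> X then valency X s else 0) :: complex)" for y
    using row[OF scheme_converse[OF S s], of y] valency_converse[OF S s] by simp
  then show "cm_mult X (Jm V X) (sigma s) = cm_scale (of_nat (valency X s)) (Jm V X)"
    by (simp add: cm_mult_def sigma_def Jm_def cm_scale_def fun_eq_iff mult.commute flip: sum_distrib_left)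
qed

lemma generated_subalgebra_commutes:
  assumes X: "finite X" and G: "G \<subseteq> Mat X" and comm: "\<And>g. g \<in> G \<Longrightarrow> cm_mult X e g = cm_mult X g e"
    and e: "e \<in> Mat X" and N: "N \<in> generated_subalgebra X G"
  shows "cm_mult X e N = cm_mult X N e"
proof -
  let ?C = "{M \<in> Mat X. cm_mult X e M = cm_mult X M e}"
  have "subalgebra X ?C"
    unfolding subalgebra_def
  proof (intro conjI ballI allI)
    show "eps X \<in> ?C" using X e by (simp add: eps_in_Mat cm_mult_one_left cm_mult_one_right)
    fix M assume M: "M \<in> ?C"
    then show "cm_scale c M \<in> ?C" for c by (simp add: Mat_scale cm_mult_scale_left cm_mult_scale_right)
    fix N assume N: "N \<in> ?C"
    show "M + N \<in> ?C" using M N by (simp add: Mat_add cm_mult_add_left cm_mult_add_right)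
    have "cm_mult X e (cm_mult X M N) = cm_mult X (cm_mult X M N) e"
      using M N by (metis (mono_tags, lifting) cm_mult_assoc mem_Collect_eq)
    then show "cm_mult X M N \<in> ?C" using M N Mat_mult by blast
  qed blast
  moreover have "G \<subseteq> ?C" using G comm by blast
  ultimately show ?thesis using generated_subalgebra_least[of X ?C G] N by blast
qed

text \<open>The idempotent \<open>J / |X|\<close> has rank one itself; it is central because row and column sums agree.\<close>

theorem trivial_idempotent_A_primitive:
  assumes S: "scheme X S"
  defines "e \<equiv> trivial_idempotent_A X" and "A \<equiv> adjacency_algebra S"
  shows "e \<in> central_primitive_idempotents X A"
    and "\<lbrakk>\<chi> \<in> Irr X A; \<chi>' \<in> Irr X A; \<chi> e \<noteq> 0; \<chi>' e \<noteq> 0\<rbrakk> \<Longrightarrow> \<chi> = \<chi>'"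
proof -
  note X = scheme_finite[OF S]
  have n: "card X \<noteq> 0" using X scheme_carrier_nonempty[OF S] by simp
  have A: "subalgebra X A" unfolding A_def by (rule adjacency_algebra_subalgebra[OF S])
  have eA: "e \<in> A"
    unfolding e_def trivial_idempotent_A_def A_def
    by (rule subalgebra_scale[OF adjacency_algebra_subalgebra[OF S] Jm_in_adjacency_algebra[OF S]])
  have idem: "cm_mult X e e = e"
    using X n by (simp add: e_def trivial_idempotent_A_def cm_mult_scale_left cm_mult_scale_right cm_mult_Jm)
  have comm: "cm_mult X e N = cm_mult X N e" if NA: "N \<in> A" for N
  proof -
    obtain c where N: "N = (\<Sum>s\<in>S. cm_scale (c s) (sigma s))"
      using NA unfolding A_def adjacency_algebra_def by blast
    have "cm_mult X e (sigma s) = cm_mult X (sigma s) e" if "s \<in> S" for s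
      unfolding e_def trivial_idempotent_A_def cm_mult_scale_left cm_mult_scale_right
        sigma_Jm[OF S that] by (rule refl)
    then show ?thesis
      unfolding N cm_mult_sum_left cm_mult_sum_right cm_mult_scale_left cm_mult_scale_right
      by (intro sum.cong refl arg_cong[where f = "cm_scale _"])
  qed
  have e: "e \<in> central_idempotents X A" by (rule central_idempotentsI[OF eA comm idem])
  obtain x where "x \<in> X" using scheme_carrier_nonempty[OF S] by blast
  then have "e x x \<noteq> 0" using n by (simp add: e_def trivial_idempotent_A_def cm_scale_def Jm_def)
  then have nz: "e \<noteq> 0" by auto
  have rank: "e x y = (1 / of_nat (card X) * of_bool (x \<in> X)) * of_bool (y \<in> X)" for x y
    by (simp add: e_def trivial_idempotent_A_def cm_scale_def Jm_def)
  have sum: "e = (\<Sum>i\<in>{()}. cm_mult X (cm_mult X e e) e)" by (simp add: idem)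
  show "e \<in> central_primitive_idempotents X A"
    by (rule rank_one_ideal(1)[where K = "\<lambda>_. e" and L = "\<lambda>_. e", OF A e eA nz idem idem rank eA eA sum])
  show "\<chi> = \<chi>'" if "\<chi> \<in> Irr X A" "\<chi>' \<in> Irr X A" "\<chi> e \<noteq> 0" "\<chi>' e \<noteq> 0"
    by (rule rank_one_ideal(2)[where K = "\<lambda>_. e" and L = "\<lambda>_. e", OF A e eA nz idem idem rank eA eA sum that])
qed

corollary idempotents_of_Irr_nontrivial_A:
  assumes S: "scheme X S"
  shows "idempotent_of X (adjacency_algebra S) ` Irr_nontrivial_A X S =
    central_primitive_idempotents X (adjacency_algebra S) - {trivial_idempotent_A X}"
  unfolding Irr_nontrivial_A_def Let_def
  by (rule idempotents_of_nontrivial_characters[OF scheme_finite[OF S]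
        adjacency_algebra_subalgebra[OF S] trivial_idempotent_A_primitive(1)[OF S]])
    (rule trivial_idempotent_A_primitive(2)[OF S])

lemma terwilliger_generators_Mat:
  assumes S: "scheme X S"
  shows "sigma ` S \<union> (\<lambda>s. eps (s `` {x\<^sub>0})) ` S \<subseteq> Mat X"
  using sigma_in_Mat[OF S] scheme_image_subset[OF S] eps_in_Mat by fast

lemma terwilliger_subalgebra:
  "scheme X S \<Longrightarrow> subalgebra X (terwilliger_algebra X S x\<^sub>0)"
  unfolding terwilliger_algebra_def
  by (rule generated_subalgebra_subalgebra[OF terwilliger_generators_Mat])

lemma sigma_in_terwilliger: "s \<in> S \<Longrightarrow> sigma s \<in> terwilliger_algebra X S x\<^sub>0"
  and eps_in_terwilliger: "s \<in> S \<Longrightarrow> eps (s `` {x\<^sub>0}) \<in> terwilliger_algebra X S x\<^sub>0"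
  using generated_subalgebra_generators[of "sigma ` S \<union> (\<lambda>s. eps (s `` {x\<^sub>0})) ` S" X]
  unfolding terwilliger_algebra_def by blast+

lemma eps_Jm_eps:
  assumes "finite X" "U \<subseteq> X" "V \<subseteq> X"
  shows "cm_mult X (cm_mult X (eps U) (Jm X X)) (eps V) = Jm U V"
  unfolding cm_mult_eps_left[OF assms(1)] cm_mult_eps_right[OF assms(1)]
  using assms(2,3) by (auto simp: Jm_def fun_eq_iff)

lemma Jm_in_terwilliger:
  assumes S: "scheme X S" and "s \<in> S" "t \<in> S"
  shows "Jm (s `` {x\<^sub>0}) (t `` {x\<^sub>0}) \<in> terwilliger_algebra X S x\<^sub>0"
proof -
  let ?A = "terwilliger_algebra X S x\<^sub>0"
  note A = terwilliger_subalgebra[OF S]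
  have "Jm X X \<in> ?A"
    by (rule adjacency_algebra_spanned[OF S Jm_in_adjacency_algebra[OF S] A sigma_in_terwilliger])
  then have "cm_mult X (cm_mult X (eps (s `` {x\<^sub>0})) (Jm X X)) (eps (t `` {x\<^sub>0})) \<in> ?A"
    using assms(2,3) subalgebra_mult[OF A] eps_in_terwilliger by metis
  then show ?thesis
    using eps_Jm_eps[OF scheme_finite[OF S] scheme_image_subset[OF S assms(2)] scheme_image_subset[OF S assms(3)]]
    by simp
qed

lemma trivial_idempotent_T_entry:
  assumes S: "scheme X S" and s: "s \<in> S" "(x\<^sub>0, x) \<in> s"
  shows "trivial_idempotent_T X S x\<^sub>0 x y = of_bool ((x\<^sub>0, y) \<in> s) / of_nat (valency X s)"
    and "trivial_idempotent_T X S x\<^sub>0 y x = of_bool ((x\<^sub>0, y) \<in> s) / of_nat (valency X s)"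
proof -
  have "trivial_idempotent_T X S x\<^sub>0 x y =
      (\<Sum>t\<in>S. if t = s then of_bool ((x\<^sub>0, y) \<in> s) / of_nat (valency X s) else 0)"
    unfolding trivial_idempotent_T_def sum_fun_apply2
    by (rule sum.cong[OF refl]) (use s scheme_unique[OF S] in \<open>auto simp: cm_scale_def Jm_def\<close>)
  then show "trivial_idempotent_T X S x\<^sub>0 x y = of_bool ((x\<^sub>0, y) \<in> s) / of_nat (valency X s)"
    using s scheme_finite_relations[OF S] by simp
  then show "trivial_idempotent_T X S x\<^sub>0 y x = of_bool ((x\<^sub>0, y) \<in> s) / of_nat (valency X s)"
    by (simp add: trivial_idempotent_T_def sum_fun_apply2 cm_scale_def Jm_def conj_commute)
qed

lemma trivial_idempotent_T_in:
  assumes S: "scheme X S"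
  shows "trivial_idempotent_T X S x\<^sub>0 \<in> terwilliger_algebra X S x\<^sub>0"
  unfolding trivial_idempotent_T_def
  using terwilliger_subalgebra[OF S] Jm_in_terwilliger[OF S]
  by (intro subalgebra_sum subalgebra_scale) blast+

text \<open>On the cell \<open>x\<^sub>0s \<times> x\<^sub>0r\<close> both products are constant; the constants agree because both count the pairs
  of \<open>u\<close> between \<open>x\<^sub>0s\<close> and \<open>x\<^sub>0r\<close>.\<close>

lemma trivial_idempotent_T_sigma:
  assumes S: "scheme X S" and x0: "x\<^sub>0 \<in> X" and u: "u \<in> S"
  defines "e \<equiv> trivial_idempotent_T X S x\<^sub>0"
  shows "cm_mult X e (sigma u) = cm_mult X (sigma u) e"
proof (intro ext)
  fix x y
  note X = scheme_finite[OF S]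
  have eMat: "e \<in> Mat X"
    unfolding e_def by (rule subalgebra_Mat[OF terwilliger_subalgebra[OF S] trivial_idempotent_T_in[OF S]])
  show "cm_mult X e (sigma u) x y = cm_mult X (sigma u) e x y"
  proof (cases "x \<in> X \<and> y \<in> X")
    case False
    then show ?thesis using Mat_mult[OF eMat sigma_in_Mat[OF S u]] Mat_mult[OF sigma_in_Mat[OF S u] eMat]
        Mat_outside by metis
  next
    case True
    then obtain s r where s: "s \<in> S" "(x\<^sub>0, x) \<in> s" and r: "r \<in> S" "(x\<^sub>0, y) \<in> r"
      using scheme_exists[OF S x0] by metis
    define f where "f y = card {z. (x\<^sub>0, z) \<in> s \<and> (z, y) \<in> u}" for y
    define g where "g x = card {z. (x\<^sub>0, z) \<in> r \<and> (z, x) \<in> u\<inverse>}" for x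
    have f_const: "f y' = f y" if "(x\<^sub>0, y') \<in> r" for y'
      unfolding f_def by (rule scheme_card_const[OF S s(1) u r(1) that r(2)])
    have g_const: "g x' = g x" if "(x\<^sub>0, x') \<in> s" for x'
      unfolding g_def by (rule scheme_card_const[OF S r(1) scheme_converse[OF S u] s(1) that s(2)])
    have "valency X r * f y = (\<Sum>y'\<in>r `` {x\<^sub>0}. f y')"
      using f_const valency_eq[OF S r(1) x0] by simp
    also have "\<dots> = card (SIGMA y':r `` {x\<^sub>0}. {z. (x\<^sub>0, z) \<in> s \<and> (z, y') \<in> u})"
      unfolding f_def
      by (rule card_SigmaI[symmetric])
        (use scheme_image_finite[OF S] r s in \<open>auto intro: finite_subset[of _ "s `` {x\<^sub>0}"]\<close>)
    also have "\<dots> = card (SIGMA x':s `` {x\<^sub>0}. {z. (x\<^sub>0, z) \<in> r \<and> (z, x') \<in> u\<inverse>})"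
      by (rule bij_betw_same_card[of prod.swap]) (auto simp: bij_betw_def inj_on_def image_iff)
    also have "\<dots> = (\<Sum>x'\<in>s `` {x\<^sub>0}. g x')"
      unfolding g_def
      by (rule card_SigmaI)
        (use scheme_image_finite[OF S] r s in \<open>auto intro: finite_subset[of _ "r `` {x\<^sub>0}"]\<close>)
    also have "\<dots> = valency X s * g x" using g_const valency_eq[OF S s(1) x0] by simp
    \<comment> \<open>Both sides are the number of pairs of \<open>u\<close> in \<open>x\<^sub>0s \<times> x\<^sub>0r\<close>.\<close>
    finally have count: "valency X r * f y = valency X s * g x" .
    have "cm_mult X e (sigma u) x y = (\<Sum>z\<in>X. of_bool ((x\<^sub>0, z) \<in> s \<and> (z, y) \<in> u) / of_nat (valency X s))"
      unfolding cm_mult_def e_def trivial_idempotent_T_entry(1)[OF S s] sigma_def by (simp add: of_bool_conj)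
    also have "\<dots> = of_nat (card (X \<inter> {z. (x\<^sub>0, z) \<in> s \<and> (z, y) \<in> u})) / of_nat (valency X s)"
      using X by (simp flip: sum_divide_distrib)
    also have "X \<inter> {z. (x\<^sub>0, z) \<in> s \<and> (z, y) \<in> u} = {z. (x\<^sub>0, z) \<in> s \<and> (z, y) \<in> u}"
      using scheme_mem[OF S u] by blast
    finally have L: "cm_mult X e (sigma u) x y = of_nat (f y) / of_nat (valency X s)" unfolding f_def .
    have "cm_mult X (sigma u) e x y = (\<Sum>z\<in>X. of_bool ((x\<^sub>0, z) \<in> r \<and> (z, x) \<in> u\<inverse>) / of_nat (valency X r))"
      unfolding cm_mult_def e_def trivial_idempotent_T_entry(2)[OF S r] sigma_def
      by (simp add: of_bool_conj mult.commute)
    also have "\<dots> = of_nat (card (X \<inter> {z. (x\<^sub>0, z) \<in> r \<and> (z, x) \<in> u\<inverse>})) / of_nat (valency X r)"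
      using X by (simp flip: sum_divide_distrib)
    also have "X \<inter> {z. (x\<^sub>0, z) \<in> r \<and> (z, x) \<in> u\<inverse>} = {z. (x\<^sub>0, z) \<in> r \<and> (z, x) \<in> u\<inverse>}"
      using scheme_mem[OF S u] by blast
    finally have R: "cm_mult X (sigma u) e x y = of_nat (g x) / of_nat (valency X r)" unfolding g_def .
    have "of_nat (valency X r) * of_nat (f y) = (of_nat (valency X s) * of_nat (g x) :: complex)"
      using count by (metis of_nat_mult)
    then show ?thesis unfolding L R
      using valency_pos[OF S s(1)] valency_pos[OF S r(1)] by (simp add: field_simps)
  qed
qed

text \<open>The matrix unit \<open>p\<close> at \<open>x\<^sub>0\<close> has rank one, and \<open>J\<close> restricted to \<open>x\<^sub>0s \<times> x\<^sub>0s\<close> is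
  \<open>J\<close> on \<open>x\<^sub>0s \<times> {x\<^sub>0}\<close> times \<open>p\<close> times \<open>J\<close> on \<open>{x\<^sub>0} \<times> x\<^sub>0s\<close>; so the trivial idempotent lies in the ideal
  generated by \<open>p\<close>.\<close>

theorem trivial_idempotent_T_primitive:
  assumes S: "scheme X S" and x0: "x\<^sub>0 \<in> X"
  defines "e \<equiv> trivial_idempotent_T X S x\<^sub>0" and "A \<equiv> terwilliger_algebra X S x\<^sub>0"
  shows "e \<in> central_primitive_idempotents X A"
    and "\<lbrakk>\<chi> \<in> Irr X A; \<chi>' \<in> Irr X A; \<chi> e \<noteq> 0; \<chi>' e \<noteq> 0\<rbrakk> \<Longrightarrow> \<chi> = \<chi>'"
proof -
  note X = scheme_finite[OF S]
  have A: "subalgebra X A" unfolding A_def by (rule terwilliger_subalgebra[OF S])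
  have eA: "e \<in> A" unfolding e_def A_def by (rule trivial_idempotent_T_in[OF S])
  have eMat: "e \<in> Mat X" by (rule subalgebra_Mat[OF A eA])
  have comm: "cm_mult X e N = cm_mult X N e" if "N \<in> A" for N
  proof (rule generated_subalgebra_commutes[OF X terwilliger_generators_Mat[OF S] _ eMat])
    show "N \<in> generated_subalgebra X (sigma ` S \<union> (\<lambda>s. eps (s `` {x\<^sub>0})) ` S)"
      using that unfolding A_def terwilliger_algebra_def .
    have "cm_mult X e (eps (s `` {x\<^sub>0})) = cm_mult X (eps (s `` {x\<^sub>0})) e" if s: "s \<in> S" for s
    proof (intro ext)
      fix x y
      have "e x y * of_bool ((x\<^sub>0, y) \<in> s) = of_bool ((x\<^sub>0, x) \<in> s) * e x y"
        unfolding e_def using trivial_idempotent_T_entry(1)[OF S s, of x\<^sub>0 x y]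
          trivial_idempotent_T_entry(2)[OF S s, of x\<^sub>0 y x] by auto
      moreover have "y \<in> s `` {x\<^sub>0} \<inter> X \<longleftrightarrow> (x\<^sub>0, y) \<in> s" "x \<in> s `` {x\<^sub>0} \<inter> X \<longleftrightarrow> (x\<^sub>0, x) \<in> s"
        using scheme_mem[OF S s] by auto
      ultimately show "cm_mult X e (eps (s `` {x\<^sub>0})) x y = cm_mult X (eps (s `` {x\<^sub>0})) e x y"
        unfolding cm_mult_eps_left[OF X] cm_mult_eps_right[OF X] by simp
    qed
    then show "cm_mult X e g = cm_mult X g e"
      if "g \<in> sigma ` S \<union> (\<lambda>s. eps (s `` {x\<^sub>0})) ` S" for g
      using that trivial_idempotent_T_sigma[OF S x0] unfolding e_def by blast
  qed
  have Id0: "Id_on X `` {x\<^sub>0} = {x\<^sub>0}" using x0 by auto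
  have v1: "valency X (Id_on X) = 1" using valency_eq[OF S scheme_Id[OF S] x0] Id0 by simp
  define p where "p = Jm {x\<^sub>0} {x\<^sub>0}"
  \<comment> \<open>The normalizing factor \<open>1 / n\<^sub>s\<close> is put into \<open>K s\<close>.\<close>
  define K where "K s = cm_scale (1 / of_nat (valency X s)) (Jm (s `` {x\<^sub>0}) {x\<^sub>0})" for s
  define L where "L s = Jm {x\<^sub>0} (s `` {x\<^sub>0})" for s
  have J: "Jm (s `` {x\<^sub>0}) (t `` {x\<^sub>0}) \<in> A" if "s \<in> S" "t \<in> S" for s t
    unfolding A_def by (rule Jm_in_terwilliger[OF S that])
  have pA: "p \<in> A" and KA: "\<And>s. s \<in> S \<Longrightarrow> K s \<in> A" and LA: "\<And>s. s \<in> S \<Longrightarrow> L s \<in> A"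
    unfolding p_def K_def L_def
    using J[OF _ scheme_Id[OF S]] J[OF scheme_Id[OF S]] J[OF scheme_Id[OF S] scheme_Id[OF S]]
    unfolding Id0 by (auto intro!: subalgebra_scale[OF A])
  have card1: "card ({x\<^sub>0} \<inter> {x\<^sub>0} \<inter> X) = 1" using x0 by simp
  have pp: "cm_mult X p p = p" unfolding p_def cm_mult_Jm[OF X] card1 by simp
  have nz: "p \<noteq> 0"
  proof
    assume "p = 0"
    then have "p x\<^sub>0 x\<^sub>0 = 0" by simp
    then show False by (simp add: p_def Jm_def)
  qed
  have e_sum: "e = (\<Sum>s\<in>S. cm_mult X (cm_mult X (K s) p) (L s))"
    unfolding e_def trivial_idempotent_T_def K_def L_def p_def cm_mult_scale_left cm_mult_Jm[OF X] card1
    by simp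
  have ee: "cm_mult X e e = e"
  proof -
    have "cm_mult X e (Jm (s `` {x\<^sub>0}) V) = Jm (s `` {x\<^sub>0}) V" if s: "s \<in> S" for s and V :: "'a set"
    proof -
      have "(\<Sum>t\<in>S. cm_mult X (cm_scale (1 / of_nat (valency X t)) (Jm (t `` {x\<^sub>0}) (t `` {x\<^sub>0}))) (Jm (s `` {x\<^sub>0}) V)) =
          (\<Sum>t\<in>S. if t = s then Jm (s `` {x\<^sub>0}) V else 0)"
      proof (rule sum.cong[OF refl])
        fix t assume t: "t \<in> S"
        show "cm_mult X (cm_scale (1 / of_nat (valency X t)) (Jm (t `` {x\<^sub>0}) (t `` {x\<^sub>0}))) (Jm (s `` {x\<^sub>0}) V) =
            (if t = s then Jm (s `` {x\<^sub>0}) V else 0)"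
        proof (cases "t = s")
          case True
          have "card (s `` {x\<^sub>0} \<inter> s `` {x\<^sub>0} \<inter> X) = valency X s"
            using valency_eq[OF S s x0] scheme_image_subset[OF S s] by (simp add: Int_absorb2)
          then show ?thesis using True valency_pos[OF S s]
            unfolding cm_mult_scale_left cm_mult_Jm[OF X] by simp
        next
          case False
          then have "t `` {x\<^sub>0} \<inter> s `` {x\<^sub>0} = {}" using scheme_unique[OF S t s] by blast
          then show ?thesis using False unfolding cm_mult_scale_left cm_mult_Jm[OF X] by simp
        qed
      qed
      also have "\<dots> = Jm (s `` {x\<^sub>0}) V" using s scheme_finite_relations[OF S] by (simp only: sum.delta) simp
      finally show ?thesis unfolding e_def trivial_idempotent_T_def cm_mult_sum_left .
    qed
    note eJ = this
    have "cm_mult X e (\<Sum>s\<in>S. cm_scale (1 / of_nat (valency X s)) (Jm (s `` {x\<^sub>0}) (s `` {x\<^sub>0}))) =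
        (\<Sum>s\<in>S. cm_scale (1 / of_nat (valency X s)) (Jm (s `` {x\<^sub>0}) (s `` {x\<^sub>0})))"
      unfolding cm_mult_sum_right by (rule sum.cong[OF refl]) (simp only: cm_mult_scale_right eJ)
    then show ?thesis by (simp only: e_def trivial_idempotent_T_def)
  qed
  have e: "e \<in> central_idempotents X A" by (rule central_idempotentsI[OF eA comm ee])
  have ep: "cm_mult X e p = p"
  proof (intro ext)
    fix x y
    have "cm_mult X e p x y = (\<Sum>z\<in>X. if z = x\<^sub>0 then e x x\<^sub>0 * of_bool (y = x\<^sub>0) else 0)"
      unfolding cm_mult_def p_def Jm_def by (rule sum.cong) auto
    also have "\<dots> = e x x\<^sub>0 * of_bool (y = x\<^sub>0)" using X x0 by simp
    also have "e x x\<^sub>0 = of_bool (x = x\<^sub>0)"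
      unfolding e_def using trivial_idempotent_T_entry(2)[OF S scheme_Id[OF S], of x\<^sub>0 x\<^sub>0 x] x0 v1
      by (auto simp: Id_on_iff)
    finally show "cm_mult X e p x y = p x y" by (simp add: p_def Jm_def)
  qed
  have rank: "p x y = of_bool (x = x\<^sub>0) * of_bool (y = x\<^sub>0)" for x y by (simp add: p_def Jm_def)
  show "e \<in> central_primitive_idempotents X A"
    by (rule rank_one_ideal(1)[where K = K and L = L, OF A e pA nz pp ep rank KA LA e_sum])
  show "\<chi> = \<chi>'" if "\<chi> \<in> Irr X A" "\<chi>' \<in> Irr X A" "\<chi> e \<noteq> 0" "\<chi>' e \<noteq> 0"
    by (rule rank_one_ideal(2)[where K = K and L = L, OF A e pA nz pp ep rank KA LA e_sum that])
qed

corollary idempotents_of_Irr_nontrivial_T: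
  assumes S: "scheme X S" and x0: "x\<^sub>0 \<in> X"
  shows "idempotent_of X (terwilliger_algebra X S x\<^sub>0) ` Irr_nontrivial_T X S x\<^sub>0 =
    central_primitive_idempotents X (terwilliger_algebra X S x\<^sub>0) - {trivial_idempotent_T X S x\<^sub>0}"
  unfolding Irr_nontrivial_T_def Let_def
  by (rule idempotents_of_nontrivial_characters[OF scheme_finite[OF S]
        terwilliger_subalgebra[OF S] trivial_idempotent_T_primitive(1)[OF S x0]])
    (rule trivial_idempotent_T_primitive(2)[OF S x0])

section \<open>Wreath products\<close>

lemma schemeI:
  assumes "finite X" "partition_on (X \<times> X) S" "Id_on X \<in> S" "\<And>s. s \<in> S \<Longrightarrow> s\<inverse> \<in> S"
    and "\<And>s t u x y x' y'. \<lbrakk>s \<in> S; t \<in> S; u \<in> S; (x, y) \<in> u; (x', y') \<in> u\<rbrakk> \<Longrightarrow>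
      card {z. (x, z) \<in> s \<and> (z, y) \<in> t} = card {z. (x', z) \<in> s \<and> (z, y') \<in> t}"
  shows "scheme X S"
  unfolding scheme_def coherent_configuration_def
proof (intro conjI)
  show "\<exists>D\<subseteq>S. \<Union>D = Id_on X" using assms(3) by (intro exI[of _ "{Id_on X}"]) simp
  show "\<forall>s\<in>S. \<forall>t\<in>S. \<forall>u\<in>S. \<forall>(x, y)\<in>u. \<forall>(x', y')\<in>u.
      card {z. (x, z) \<in> s \<and> (z, y) \<in> t} = card {z. (x', z) \<in> s \<and> (z, y') \<in> t}"
    using assms(5) by (intro ballI) (simp add: split_beta)
  show "\<forall>s\<in>S. s\<inverse> \<in> S" using assms(4) by blast
qed (fact assms(1-3))+

text \<open>On a single point there is no off-diagonal relation; removing \<open>{}\<close> covers this case.\<close>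

definition complete_relations :: "'b set \<Rightarrow> ('b \<times> 'b) set set" where
  "complete_relations F = {Id_on F, F \<times> F - Id_on F} - {{}}"

lemma complete_scheme:
  assumes F: "finite F" "F \<noteq> {}"
  shows "scheme F (complete_relations F)"
proof (rule schemeI[OF F(1)])
  let ?off = "F \<times> F - Id_on F"
  have Id_ne: "Id_on F \<noteq> {}" using F(2) by (simp add: Id_on_def)
  show "partition_on (F \<times> F) (complete_relations F)"
    by (rule partition_onI) (auto simp: complete_relations_def disjnt_def)
  show "Id_on F \<in> complete_relations F" using Id_ne by (simp add: complete_relations_def)
  show "s\<inverse> \<in> complete_relations F" if "s \<in> complete_relations F" for s
  proof -
    have "(Id_on F)\<inverse> = Id_on F" "?off\<inverse> = ?off" by auto
    then show ?thesis using that by (auto simp: complete_relations_def)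
  qed
  fix s t u x y x' y'
  assume s: "s \<in> complete_relations F" and t: "t \<in> complete_relations F"
    and u: "u \<in> complete_relations F" and xy: "(x, y) \<in> u" "(x', y') \<in> u"
  have F_mem: "x \<in> F" "y \<in> F" "x' \<in> F" "y' \<in> F" and eq: "x = y \<longleftrightarrow> x' = y'"
    using u xy by (auto simp: complete_relations_def)
  have *: "card {z. (x, z) \<in> s \<and> (z, y) \<in> t} =
      (if s = Id_on F then if t = Id_on F then of_bool (x = y) else of_bool (x \<noteq> y)
       else if t = Id_on F then of_bool (x \<noteq> y) else card F - (if x = y then 1 else 2))"
    if x: "x \<in> F" and y: "y \<in> F" for x y
  proof -
    consider "s = Id_on F" "t = Id_on F" | "s = Id_on F" "t \<noteq> Id_on F" "t = ?off"
      | "s \<noteq> Id_on F" "t = Id_on F" "s = ?off" | "s \<noteq> Id_on F" "t \<noteq> Id_on F" "s = ?off" "t = ?off"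
      using s t by (auto simp: complete_relations_def)
    then show ?thesis
    proof cases
      case 1
      then have "{z. (x, z) \<in> s \<and> (z, y) \<in> t} = (if x = y then {x} else {})" using x by auto
      then show ?thesis using 1 by simp
    next
      case 2
      then have "{z. (x, z) \<in> s \<and> (z, y) \<in> t} = (if x \<noteq> y then {x} else {})" using x y by auto
      then show ?thesis using 2 by simp
    next
      case 3
      then have "{z. (x, z) \<in> s \<and> (z, y) \<in> t} = (if x \<noteq> y then {y} else {})" using x y by auto
      then show ?thesis using 3 by simp
    next
      case 4
      then have "{z. (x, z) \<in> s \<and> (z, y) \<in> t} = F - {x, y}" using x y by auto
      moreover have "card (F - {x, y}) = card F - card {x, y}"
        using x y by (intro card_Diff_subset) auto
      ultimately show ?thesis using 4 by (cases "x = y") simp_all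
    qed
  qed
  show "card {z. (x, z) \<in> s \<and> (z, y) \<in> t} = card {z. (x', z) \<in> s \<and> (z, y') \<in> t}"
    unfolding *[OF F_mem(1,2)] *[OF F_mem(3,4)] using eq by simp
qed

lemma mem_wreath_tilde [simp]:
  "((x, y), (x', y')) \<in> wreath_tilde Y s \<longleftrightarrow> (x, x') \<in> s \<and> y = y' \<and> y \<in> Y"
  by (auto simp: wreath_tilde_def)

lemma mem_wreath_bar [simp]:
  "((x, y), (x', y')) \<in> wreath_bar X t \<longleftrightarrow> x \<in> X \<and> x' \<in> X \<and> (y, y') \<in> t"
  by (auto simp: wreath_bar_def)

lemma off_diagonal:
  assumes "scheme Y T" "t \<in> T" "t \<noteq> Id_on Y" "(y, y') \<in> t"
  shows "y \<noteq> y'"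
  using scheme_unique[OF assms(1,2) scheme_Id[OF assms(1)] assms(4)] scheme_mem[OF assms(1,2,4)] assms(3)
  by blast

lemma wreath_cases:
  assumes "w \<in> wreath X S Y T"
  obtains (tilde) s where "s \<in> S" "w = wreath_tilde Y s"
    | (bar) t where "t \<in> T" "t \<noteq> Id_on Y" "w = wreath_bar X t"
  using assms unfolding wreath_def by blast

text \<open>In each of the four combinations of the two kinds of relations, the points counted by an
  intersection number form a product of a subset of \<open>X\<close> and a subset of \<open>Y\<close>.\<close>

lemma wreath_scheme:
  assumes S: "scheme X S" and T: "scheme Y T"
  shows "scheme (X \<times> Y) (wreath X S Y T)"
proof (rule schemeI)
  let ?W = "wreath X S Y T"
  show "finite (X \<times> Y)" using scheme_finite[OF S] scheme_finite[OF T] by simp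
  show "Id_on (X \<times> Y) \<in> ?W"
  proof -
    have "Id_on (X \<times> Y) = wreath_tilde Y (Id_on X)" by (auto simp: wreath_tilde_def)
    then show ?thesis using scheme_Id[OF S] by (simp add: wreath_def)
  qed
  show "w\<inverse> \<in> ?W" if "w \<in> ?W" for w
    using that
  proof (cases rule: wreath_cases)
    case (tilde s)
    have "w\<inverse> = wreath_tilde Y (s\<inverse>)" unfolding tilde by (auto simp: wreath_tilde_def)
    then show ?thesis using scheme_converse[OF S tilde(1)] by (simp add: wreath_def)
  next
    case (bar t)
    have "w\<inverse> = wreath_bar X (t\<inverse>)" unfolding bar by (auto simp: wreath_bar_def)
    moreover have "t\<inverse> \<noteq> Id_on Y" using bar(2) by (metis converse_Id_on converse_converse)
    ultimately show ?thesis using scheme_converse[OF T bar(1)] by (simp add: wreath_def)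
  qed
  have nonempty: "w \<noteq> {}" if "w \<in> ?W" for w
    using that
  proof (cases rule: wreath_cases)
    case (tilde s)
    obtain x x' where "(x, x') \<in> s" using scheme_nonempty[OF S tilde(1)] by fastforce
    moreover obtain y where "y \<in> Y" using scheme_carrier_nonempty[OF T] by blast
    ultimately have "((x, y), (x', y)) \<in> w" unfolding tilde by simp
    then show ?thesis by blast
  next
    case (bar t)
    obtain y y' where "(y, y') \<in> t" using scheme_nonempty[OF T bar(1)] by fastforce
    moreover obtain x where "x \<in> X" using scheme_carrier_nonempty[OF S] by blast
    ultimately have "((x, y), (x, y')) \<in> w" unfolding bar by simp
    then show ?thesis by blast
  qed
  have cover: "\<exists>w\<in>?W. ((x, y), (x', y')) \<in> w" if mem: "x \<in> X" "x' \<in> X" "y \<in> Y" "y' \<in> Y" for x y x' y'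
  proof (cases "y = y'")
    case True
    obtain s where "s \<in> S" "(x, x') \<in> s" using scheme_exists[OF S mem(1,2)] .
    then have "((x, y), (x', y')) \<in> wreath_tilde Y s" "wreath_tilde Y s \<in> ?W"
      using True mem by (simp_all add: wreath_def)
    then show ?thesis by blast
  next
    case False
    obtain t where t: "t \<in> T" "(y, y') \<in> t" using scheme_exists[OF T mem(3,4)] .
    then have "t \<noteq> Id_on Y" using False by auto
    then have "((x, y), (x', y')) \<in> wreath_bar X t" "wreath_bar X t \<in> ?W"
      using t mem by (simp_all add: wreath_def)
    then show ?thesis by blast
  qed
  have sub: "w \<subseteq> (X \<times> Y) \<times> (X \<times> Y)" if "w \<in> ?W" for w
    using that
  proof (cases rule: wreath_cases)
    case (tilde s)
    then show ?thesis using scheme_mem[OF S tilde(1)] by (auto simp: wreath_tilde_def)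
  next
    case (bar t)
    then show ?thesis using scheme_mem[OF T bar(1)] by (auto simp: wreath_bar_def)
  qed
  have disj: "v = w" if v: "v \<in> ?W" and w: "w \<in> ?W" and p: "p \<in> v" "p \<in> w" for v w p
  proof -
    obtain x y x' y' where p_eq: "p = ((x, y), (x', y'))" by (metis surj_pair)
    show ?thesis using v
    proof (cases rule: wreath_cases)
      case (tilde s)
      note ts = this
      have yy: "y = y'" "(x, x') \<in> s" using p(1) unfolding ts p_eq by simp_all
      show ?thesis using w
      proof (cases rule: wreath_cases)
        case (tilde s')
        have "(x, x') \<in> s'" using p(2) unfolding tilde p_eq by simp
        then show ?thesis using scheme_unique[OF S ts(1) tilde(1) yy(2)] ts tilde by simp
      next
        case (bar t)
        have "(y, y') \<in> t" using p(2) unfolding bar p_eq by simp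
        then show ?thesis using off_diagonal[OF T bar(1,2)] yy by blast
      qed
    next
      case (bar t)
      note bt = this
      have yt: "(y, y') \<in> t" using p(1) unfolding bt p_eq by simp
      show ?thesis using w
      proof (cases rule: wreath_cases)
        case (tilde s')
        have "y = y'" using p(2) unfolding tilde p_eq by simp
        then show ?thesis using off_diagonal[OF T bt(1,2) yt] by blast
      next
        case (bar t')
        have "(y, y') \<in> t'" using p(2) unfolding bar p_eq by simp
        then show ?thesis using scheme_unique[OF T bt(1) bar(1) yt] bt bar by simp
      qed
    qed
  qed
  show "partition_on ((X \<times> Y) \<times> (X \<times> Y)) ?W"
  proof (rule partition_onI)
    show "\<Union>?W = (X \<times> Y) \<times> (X \<times> Y)"
    proof
      show "\<Union>?W \<subseteq> (X \<times> Y) \<times> (X \<times> Y)" using sub by blast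
      show "(X \<times> Y) \<times> (X \<times> Y) \<subseteq> \<Union>?W" using cover by fast
    qed
    show "disjnt p q" if "p \<in> ?W" "q \<in> ?W" "p \<noteq> q" for p q
      using disj[OF that(1,2)] that(3) unfolding disjnt_def by blast
    show "{} \<notin> ?W" using nonempty by blast
  qed
  fix v w u p q p' q'
  assume v: "v \<in> ?W" and w: "w \<in> ?W" and u: "u \<in> ?W" and pq: "(p, q) \<in> u" "(p', q') \<in> u"
  obtain x y where p: "p = (x, y)" by fastforce
  obtain x1 y1 where q: "q = (x1, y1)" by fastforce
  obtain x' y' where p': "p' = (x', y')" by fastforce
  obtain x1' y1' where q': "q' = (x1', y1')" by fastforce
  have mem: "x \<in> X" "x1 \<in> X" "y \<in> Y" "y1 \<in> Y" "x' \<in> X" "x1' \<in> X" "y' \<in> Y" "y1' \<in> Y"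
    using sub[OF u] pq unfolding p q p' q' by auto
  have eq: "y = y1 \<longleftrightarrow> y' = y1'"
    using u
  proof (cases rule: wreath_cases)
    case (tilde s)
    then show ?thesis using pq unfolding p q p' q' by simp
  next
    case (bar t)
    then show ?thesis using pq off_diagonal[OF T bar(1,2)] unfolding p q p' q' by fastforce
  qed
  have T_eq: "(y, y1) \<in> t \<longleftrightarrow> (y', y1') \<in> t" if t: "t \<in> T" for t
    using u
  proof (cases rule: wreath_cases)
    case (tilde s)
    then have "y = y1" "y' = y1'" using pq unfolding p q p' q' by simp_all
    then have "(y, y1) \<in> Id_on Y" "(y', y1') \<in> Id_on Y" using mem by auto
    then show ?thesis using scheme_unique[OF T t scheme_Id[OF T]] by blast
  next
    case (bar t')
    then have "(y, y1) \<in> t'" "(y', y1') \<in> t'" using pq unfolding p q p' q' by simp_all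
    then show ?thesis using scheme_unique[OF T t bar(1)] by blast
  qed
  have T_rel: "\<exists>t\<in>T. (y, y1) \<in> t \<and> (y', y1') \<in> t"
    using scheme_exists[OF T mem(3,4)] T_eq by metis
  have S_rel: "\<exists>s\<in>S. (x, x1) \<in> s \<and> (x', x1') \<in> s" if "y = y1"
    using u
  proof (cases rule: wreath_cases)
    case (tilde s)
    then show ?thesis using pq unfolding p q p' q' by auto
  next
    case (bar t)
    have "(y, y1) \<in> t" using pq(1) unfolding bar(3) p q by simp
    then show ?thesis using off_diagonal[OF T bar(1,2)] that by blast
  qed
  let ?c = "\<lambda>p q. card {z. (p, z) \<in> v \<and> (z, q) \<in> w}"
  show "?c p q = ?c p' q'"
    using v
  proof (cases rule: wreath_cases)
    case (tilde s)
    note vs = this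
    show ?thesis using w
    proof (cases rule: wreath_cases)
      case (tilde s')
      have *: "?c (x, y) (x1, y1) =
          (if y = y1 then card {z. (x, z) \<in> s \<and> (z, x1) \<in> s'} else 0)" if "y \<in> Y" for x y x1 y1
      proof -
        have "{z. ((x, y), z) \<in> v \<and> (z, (x1, y1)) \<in> w} =
            (if y = y1 then {z. (x, z) \<in> s \<and> (z, x1) \<in> s'} \<times> {y} else {})"
          unfolding vs tilde using that by auto
        then show ?thesis by (simp add: card_cartesian_product)
      qed
      show ?thesis
      proof (cases "y = y1")
        case True
        then obtain r where r: "r \<in> S" "(x, x1) \<in> r" "(x', x1') \<in> r" using S_rel by blast
        show ?thesis unfolding p q p' q' *[OF mem(3)] *[OF mem(7)]
          unfolding scheme_card_const[OF S vs(1) tilde(1) r] using eq True by simp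
      next
        case False
        then show ?thesis unfolding p q p' q' *[OF mem(3)] *[OF mem(7)] using eq by simp
      qed
    next
      case (bar t')
      have *: "?c (x, y) (x1, y1) = valency X s * of_bool ((y, y1) \<in> t')"
        if "x \<in> X" "x1 \<in> X" "y \<in> Y" for x y x1 y1
      proof -
        have "{z. ((x, y), z) \<in> v \<and> (z, (x1, y1)) \<in> w} = s `` {x} \<times> (if (y, y1) \<in> t' then {y} else {})"
          unfolding vs bar using that scheme_mem[OF S vs(1)] by auto
        then show ?thesis using valency_eq[OF S vs(1) that(1)] by (simp add: card_cartesian_product)
      qed
      show ?thesis unfolding p q p' q' *[OF mem(1-3)] *[OF mem(5-7)] T_eq[OF bar(1)] by simp
    qed
  next
    case (bar t)
    note vt = this
    show ?thesis using w
    proof (cases rule: wreath_cases)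
      case (tilde s')
      have *: "?c (x, y) (x1, y1) = valency X (s'\<inverse>) * of_bool ((y, y1) \<in> t)"
        if "x \<in> X" "x1 \<in> X" "y1 \<in> Y" for x y x1 y1
      proof -
        have "{z. ((x, y), z) \<in> v \<and> (z, (x1, y1)) \<in> w} = s'\<inverse> `` {x1} \<times> (if (y, y1) \<in> t then {y1} else {})"
          unfolding vt tilde using that scheme_mem[OF S tilde(1)] by auto
        then show ?thesis
          using valency_eq[OF S scheme_converse[OF S tilde(1)] that(2)] by (simp add: card_cartesian_product)
      qed
      show ?thesis unfolding p q p' q' *[OF mem(1,2,4)] *[OF mem(5,6,8)] T_eq[OF vt(1)] by simp
    next
      case (bar t')
      have *: "?c (x, y) (x1, y1) = card X * card {z. (y, z) \<in> t \<and> (z, y1) \<in> t'}"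
        if "x \<in> X" "x1 \<in> X" for x y x1 y1
      proof -
        have "{z. ((x, y), z) \<in> v \<and> (z, (x1, y1)) \<in> w} = X \<times> {z. (y, z) \<in> t \<and> (z, y1) \<in> t'}"
          unfolding vt bar using that by auto
        then show ?thesis by (simp add: card_cartesian_product)
      qed
      obtain r where r: "r \<in> T" "(y, y1) \<in> r" "(y', y1') \<in> r" using T_rel by blast
      show ?thesis unfolding p q p' q' *[OF mem(1,2)] *[OF mem(5,6)]
        unfolding scheme_card_const[OF T vt(1) bar(1) r] ..
    qed
  qed
qed

text \<open>A relation coming from \<open>S\<close> never becomes empty on \<open>X \<times> F\<close>, one coming from \<open>t\<close> exactly if \<open>t\<close> misses
  \<open>F \<times> F\<close>, and the diagonal of \<open>F\<close> arises from that of \<open>Y\<close> only.  With complete relations on a fibre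
  this computes \<open>U\<^sup>(\<^sup>t\<^sup>)\<close>.\<close>

lemma restrict_wreath:
  assumes S: "scheme X S" and T: "scheme Y T" and F: "F \<subseteq> Y" "F \<noteq> {}"
  shows "restrict_relations (X \<times> F) (wreath X S Y T) = wreath X S F (restrict_relations F T)"
proof -
  let ?R = "(X \<times> F) \<times> (X \<times> F)"
  have tilde: "wreath_tilde Y s \<inter> ?R = wreath_tilde F s" "wreath_tilde F s \<noteq> {}" if s: "s \<in> S" for s
  proof -
    show "wreath_tilde Y s \<inter> ?R = wreath_tilde F s"
      using F scheme_mem[OF S s] by (auto simp: wreath_tilde_def)
    obtain x x' where "(x, x') \<in> s" using scheme_nonempty[OF S s] by fastforce
    moreover obtain y where "y \<in> F" using F by blast
    ultimately have "((x, y), (x', y)) \<in> wreath_tilde F s" by simp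
    then show "wreath_tilde F s \<noteq> {}" by blast
  qed
  have bar: "wreath_bar X t \<inter> ?R = wreath_bar X (t \<inter> F \<times> F)" for t
    by (auto simp: wreath_bar_def)
  have bar_empty: "wreath_bar X r = {} \<longleftrightarrow> r = {}" for r :: "('b \<times> 'b) set"
    using scheme_carrier_nonempty[OF S] by (auto simp: wreath_bar_def)
  have off: "restrict_relations F T - {Id_on F} = {t \<inter> F \<times> F | t. t \<in> T - {Id_on Y}} - {{}}"
  proof -
    have IdF: "Id_on Y \<inter> F \<times> F = Id_on F" using F(1) by auto
    have ne: "t \<inter> F \<times> F \<noteq> Id_on F" if "t \<in> T - {Id_on Y}" for t
    proof
      assume eq: "t \<inter> F \<times> F = Id_on F"
      obtain y where "y \<in> F" using F by blast
      then have "(y, y) \<in> t" using eq by blast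
      then show False using off_diagonal[OF T, of t] that by blast
    qed
    show ?thesis
    proof (intro equalityI subsetI)
      fix r assume "r \<in> restrict_relations F T - {Id_on F}"
      then obtain t where t: "t \<in> T" "r = t \<inter> F \<times> F" "r \<noteq> {}" "r \<noteq> Id_on F"
        unfolding restrict_relations_def by blast
      then have "t \<noteq> Id_on Y" using IdF by metis
      then show "r \<in> {t \<inter> F \<times> F | t. t \<in> T - {Id_on Y}} - {{}}" using t by blast
    next
      fix r assume "r \<in> {t \<inter> F \<times> F | t. t \<in> T - {Id_on Y}} - {{}}"
      then obtain t where t: "t \<in> T - {Id_on Y}" "r = t \<inter> F \<times> F" "r \<noteq> {}" by blast
      then have "r \<noteq> Id_on F" using ne[OF t(1)] by simp
      then show "r \<in> restrict_relations F T - {Id_on F}"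
        unfolding restrict_relations_def using t by blast
    qed
  qed
  have "restrict_relations (X \<times> F) (wreath X S Y T) =
      wreath_tilde F ` S \<union> wreath_bar X ` ({t \<inter> F \<times> F | t. t \<in> T - {Id_on Y}} - {{}})"
  proof (intro equalityI subsetI)
    fix w assume "w \<in> restrict_relations (X \<times> F) (wreath X S Y T)"
    then obtain v where v: "v \<in> wreath X S Y T" "w = v \<inter> ?R" "w \<noteq> {}"
      unfolding restrict_relations_def by blast
    from v(1) show "w \<in> wreath_tilde F ` S \<union> wreath_bar X ` ({t \<inter> F \<times> F | t. t \<in> T - {Id_on Y}} - {{}})"
    proof (cases rule: wreath_cases)
      case (tilde s)
      then show ?thesis using \<open>\<And>s. s \<in> S \<Longrightarrow> wreath_tilde Y s \<inter> ?R = wreath_tilde F s\<close> v by blast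
    next
      case t: (bar t)
      then have "w = wreath_bar X (t \<inter> F \<times> F)" using v bar by simp
      moreover from this have "t \<inter> F \<times> F \<noteq> {}" using v(3) bar_empty by metis
      ultimately show ?thesis using t by blast
    qed
  next
    fix w assume "w \<in> wreath_tilde F ` S \<union> wreath_bar X ` ({t \<inter> F \<times> F | t. t \<in> T - {Id_on Y}} - {{}})"
    then show "w \<in> restrict_relations (X \<times> F) (wreath X S Y T)"
    proof
      assume "w \<in> wreath_tilde F ` S"
      then obtain s where s: "s \<in> S" "w = wreath_tilde F s" by blast
      then have "w = wreath_tilde Y s \<inter> ?R" "w \<noteq> {}" "wreath_tilde Y s \<in> wreath X S Y T"
        using tilde[OF s(1)] by (auto simp: wreath_def)
      then show ?thesis unfolding restrict_relations_def by blast
    next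
      assume "w \<in> wreath_bar X ` ({t \<inter> F \<times> F | t. t \<in> T - {Id_on Y}} - {{}})"
      then obtain t where t: "t \<in> T - {Id_on Y}" "t \<inter> F \<times> F \<noteq> {}" "w = wreath_bar X (t \<inter> F \<times> F)" by blast
      then have "w = wreath_bar X t \<inter> ?R" "w \<noteq> {}" "wreath_bar X t \<in> wreath X S Y T"
        using bar bar_empty by (auto simp: wreath_def)
      then show ?thesis unfolding restrict_relations_def by blast
    qed
  qed
  then show ?thesis unfolding wreath_def off .
qed

lemma restrict_singleton:
  assumes T: "scheme Y T" and "y \<in> Y"
  shows "restrict_relations {y} T = complete_relations {y}"
proof -
  have r: "t \<inter> {y} \<times> {y} = (if t = Id_on Y then {(y, y)} else {})" if "t \<in> T" for t
    using off_diagonal[OF T that] assms(2) by auto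
  have "restrict_relations {y} T = {{(y, y)}}"
  proof (intro equalityI subsetI)
    fix u assume "u \<in> restrict_relations {y} T"
    then obtain t where "t \<in> T" "u = t \<inter> {y} \<times> {y}" "u \<noteq> {}" unfolding restrict_relations_def by blast
    then show "u \<in> {{(y, y)}}" using r by (metis singletonI)
  next
    fix u assume "u \<in> {{(y, y)}}"
    then have "u = Id_on Y \<inter> {y} \<times> {y}" "u \<noteq> {}" using r[OF scheme_Id[OF T]] by simp_all
    then show "u \<in> restrict_relations {y} T" unfolding restrict_relations_def using scheme_Id[OF T] by blast
  qed
  moreover have "Id_on {y} = {(y, y)}" "{y} \<times> {y} - Id_on {y} = {}" by auto
  moreover have "{{(y, y)}} = {{(y, y)}, {}} - {{}}" by blast
  ultimately show ?thesis by (simp only: complete_relations_def)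
qed

lemma one_class_relations:
  assumes T: "scheme Y T" and one: "one_class_scheme T"
  shows "T = {Id_on Y, Y \<times> Y - Id_on Y}"
proof -
  obtain a b where ab: "T = {a, b}" "a \<noteq> b"
    using one unfolding one_class_scheme_def by (meson card_2_iff)
  then obtain t where t: "T = {Id_on Y, t}" "t \<noteq> Id_on Y" using scheme_Id[OF T] by blast
  have "\<Union>T = Y \<times> Y" using partition_onD1[OF scheme_partition[OF T]] by simp
  then have "Id_on Y \<union> t = Y \<times> Y" unfolding t(1) by simp
  moreover have "t \<inter> Id_on Y = {}"
    using scheme_unique[OF T, of t "Id_on Y"] t by blast
  ultimately have "t = Y \<times> Y - Id_on Y" by blast
  then show ?thesis using t(1) by simp
qed

lemma restrict_one_class:
  fixes T :: "('b \<times> 'b) set set"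
  assumes T: "scheme Y T" and one: "one_class_scheme T" and F: "F \<subseteq> Y" "F \<noteq> {}"
  shows "restrict_relations F T = complete_relations F"
proof -
  have eq: "Id_on Y \<inter> F \<times> F = Id_on F" "(Y \<times> Y - Id_on Y) \<inter> F \<times> F = F \<times> F - Id_on F"
    using F(1) by auto
  have "{u \<inter> F \<times> F | u. u \<in> {a, b}} = {a \<inter> F \<times> F, b \<inter> F \<times> F}" for a b :: "('b \<times> 'b) set"
    by blast
  from this[of "Id_on Y" "Y \<times> Y - Id_on Y"] show ?thesis
    unfolding restrict_relations_def complete_relations_def one_class_relations[OF T one, symmetric] eq
    by (rule arg_cong[where f = "\<lambda>R. R - {{}}"])
qed

lemma sigma_wreath_tilde: "sigma (wreath_tilde Y s) = kron (sigma s) (eps Y)"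
  by (auto simp: sigma_def kron_def eps_def fun_eq_iff)

lemma sigma_wreath_bar: "sigma (wreath_bar X t) = kron (Jm X X) (sigma t)"
  by (auto simp: sigma_def kron_def Jm_def fun_eq_iff)

lemma wreath_tilde_image: "y\<^sub>0 \<in> Y \<Longrightarrow> wreath_tilde Y s `` {(x\<^sub>0, y\<^sub>0)} = s `` {x\<^sub>0} \<times> {y\<^sub>0}"
  by (auto simp: wreath_tilde_def)

lemma wreath_bar_image: "x\<^sub>0 \<in> X \<Longrightarrow> wreath_bar X t `` {(x\<^sub>0, y\<^sub>0)} = X \<times> t `` {y\<^sub>0}"
  by (auto simp: wreath_bar_def)

text \<open>The cells of the wreath product at \<open>(x\<^sub>0, y\<^sub>0)\<close> are the cells of \<open>S\<close> in the fibre over \<open>y\<^sub>0\<close> and the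
  full sets \<open>X \<times> y\<^sub>0t\<close>, which explains the two summands.\<close>

lemma trivial_idempotent_T_wreath:
  assumes S: "scheme X S" and T: "scheme Y T" and x0: "x\<^sub>0 \<in> X" and y0: "y\<^sub>0 \<in> Y"
  shows "trivial_idempotent_T (X \<times> Y) (wreath X S Y T) (x\<^sub>0, y\<^sub>0) =
    kron (trivial_idempotent_T X S x\<^sub>0) (eps {y\<^sub>0}) +
    (\<Sum>t\<in>T - {Id_on Y}. kron (trivial_idempotent_A X)
       (cm_scale (1 / of_nat (valency Y t)) (Jm (t `` {y\<^sub>0}) (t `` {y\<^sub>0}))))"
proof -
  note W = wreath_scheme[OF S T]
  let ?g = "\<lambda>w. cm_scale (1 / of_nat (valency (X \<times> Y) w)) (Jm (w `` {(x\<^sub>0, y\<^sub>0)}) (w `` {(x\<^sub>0, y\<^sub>0)}))"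
  have xy: "(x\<^sub>0, y\<^sub>0) \<in> X \<times> Y" using x0 y0 by simp
  have inj_tilde: "inj_on (wreath_tilde Y) S"
  proof (rule inj_onI)
    fix s s' assume s: "s \<in> S" and s': "s' \<in> S" and eq: "wreath_tilde Y s = wreath_tilde Y s'"
    obtain a b where ab: "(a, b) \<in> s" using scheme_nonempty[OF S s] by fastforce
    then have "((a, y\<^sub>0), (b, y\<^sub>0)) \<in> wreath_tilde Y s'" using y0 unfolding eq[symmetric] by simp
    then show "s = s'" using scheme_unique[OF S s s' ab] by simp
  qed
  have inj_bar: "inj_on (wreath_bar X) (T - {Id_on Y})"
  proof (rule inj_onI)
    fix t t' assume t: "t \<in> T - {Id_on Y}" and t': "t' \<in> T - {Id_on Y}"
      and eq: "wreath_bar X t = wreath_bar X t'"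
    obtain a b where ab: "(a, b) \<in> t" using scheme_nonempty[OF T, of t] t by fastforce
    then have "((x\<^sub>0, a), (x\<^sub>0, b)) \<in> wreath_bar X t'" using x0 unfolding eq[symmetric] by simp
    then show "t = t'" using scheme_unique[OF T _ _ ab, of t'] t t' by simp
  qed
  have disj: "wreath_tilde Y ` S \<inter> wreath_bar X ` (T - {Id_on Y}) = {}"
  proof -
    have "wreath_tilde Y s \<noteq> wreath_bar X t" if s: "s \<in> S" and t: "t \<in> T - {Id_on Y}" for s t
    proof
      assume eq: "wreath_tilde Y s = wreath_bar X t"
      obtain a b where ab: "(a, b) \<in> t" using scheme_nonempty[OF T, of t] t by fastforce
      then have "((x\<^sub>0, a), (x\<^sub>0, b)) \<in> wreath_tilde Y s" using x0 unfolding eq by simp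
      then have "a = b" by simp
      then show False using off_diagonal[OF T _ _ ab] t by blast
    qed
    then show ?thesis by blast
  qed
  have fin: "finite (wreath_tilde Y ` S)" "finite (wreath_bar X ` (T - {Id_on Y}))"
    using scheme_finite_relations[OF S] scheme_finite_relations[OF T] by simp_all
  have tilde: "?g (wreath_tilde Y s) =
      kron (cm_scale (1 / of_nat (valency X s)) (Jm (s `` {x\<^sub>0}) (s `` {x\<^sub>0}))) (eps {y\<^sub>0})"
    if s: "s \<in> S" for s
  proof -
    have "wreath_tilde Y s \<in> wreath X S Y T" using s by (simp add: wreath_def)
    then have "valency (X \<times> Y) (wreath_tilde Y s) = valency X s"
      by (simp only: valency_eq[OF W _ xy] wreath_tilde_image[OF y0] valency_eq[OF S s x0]
          card_cartesian_product) simp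
    moreover have "eps {y\<^sub>0} = Jm {y\<^sub>0} {y\<^sub>0}" by (auto simp: eps_def Jm_def fun_eq_iff)
    ultimately show ?thesis unfolding wreath_tilde_image[OF y0] kron_scale_left by (simp add: kron_Jm)
  qed
  have bar: "?g (wreath_bar X t) = kron (trivial_idempotent_A X)
       (cm_scale (1 / of_nat (valency Y t)) (Jm (t `` {y\<^sub>0}) (t `` {y\<^sub>0})))"
    if t: "t \<in> T - {Id_on Y}" for t
  proof -
    have "wreath_bar X t \<in> wreath X S Y T" using t by (simp add: wreath_def)
    moreover have "t \<in> T" using t by blast
    ultimately have "valency (X \<times> Y) (wreath_bar X t) = card X * valency Y t"
      by (simp only: valency_eq[OF W _ xy] wreath_bar_image[OF x0] valency_eq[OF T _ y0]
          card_cartesian_product)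
    then show ?thesis
      unfolding wreath_bar_image[OF x0] trivial_idempotent_A_def kron_scale_left kron_scale_right
      by (simp add: kron_Jm mult.commute)
  qed
  have "trivial_idempotent_T (X \<times> Y) (wreath X S Y T) (x\<^sub>0, y\<^sub>0) =
      (\<Sum>w\<in>wreath_tilde Y ` S. ?g w) + (\<Sum>w\<in>wreath_bar X ` (T - {Id_on Y}). ?g w)"
    unfolding trivial_idempotent_T_def wreath_def[of X S Y T] by (rule sum.union_disjoint[OF fin disj])
  also have "(\<Sum>w\<in>wreath_tilde Y ` S. ?g w) = (\<Sum>s\<in>S. ?g (wreath_tilde Y s))"
    by (simp only: sum.reindex[OF inj_tilde] o_def)
  also have "\<dots> = (\<Sum>s\<in>S. kron (cm_scale (1 / of_nat (valency X s)) (Jm (s `` {x\<^sub>0}) (s `` {x\<^sub>0}))) (eps {y\<^sub>0}))"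
    by (rule sum.cong[OF refl tilde])
  also have "\<dots> = kron (trivial_idempotent_T X S x\<^sub>0) (eps {y\<^sub>0})"
    unfolding trivial_idempotent_T_def kron_sum_left ..
  also have "(\<Sum>w\<in>wreath_bar X ` (T - {Id_on Y}). ?g w) = (\<Sum>t\<in>T - {Id_on Y}. ?g (wreath_bar X t))"
    by (simp only: sum.reindex[OF inj_bar] o_def)
  also have "\<dots> = (\<Sum>t\<in>T - {Id_on Y}. kron (trivial_idempotent_A X)
       (cm_scale (1 / of_nat (valency Y t)) (Jm (t `` {y\<^sub>0}) (t `` {y\<^sub>0}))))"
    by (rule sum.cong[OF refl bar])
  finally show ?thesis .
qed

section \<open>Corners of the Terwilliger algebra of a wreath product\<close>

text \<open>The corner condition is inherited by sums and products, so it suffices to check it on generators.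
  Centrality of \<open>h z'\<close> is a by-product.\<close>

lemma cpis_below_generated_corner:
  fixes h :: "'b cmat \<Rightarrow> 'a cmat"
  assumes X: "finite X" and G: "G \<subseteq> Mat X" and W: "finite W" and B: "subalgebra W B"
    and z': "z' \<in> central_idempotents W B"
    and hA: "\<And>b. b \<in> B \<Longrightarrow> h b \<in> generated_subalgebra X G"
    and h_add: "\<And>b c. b \<in> B \<Longrightarrow> c \<in> B \<Longrightarrow> h (b + c) = h b + h c"
    and h_scale: "\<And>a b. b \<in> B \<Longrightarrow> h (cm_scale a b) = cm_scale a (h b)"
    and h_mult: "\<And>b c. b \<in> B \<Longrightarrow> c \<in> B \<Longrightarrow> h (cm_mult W b c) = cm_mult X (h b) (h c)"
    and h_inj: "inj_on h B"
    and gen: "\<And>g. g \<in> G \<Longrightarrow> \<exists>b\<in>B. cm_mult X g (h z') = h (cm_mult W b z') \<and>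
                                    cm_mult X (h z') g = h (cm_mult W b z')"
  shows "cpis_below X (generated_subalgebra X G) (h z') = h ` cpis_below W B z'"
    and "h z' \<in> central_idempotents X (generated_subalgebra X G)"
proof -
  let ?A = "generated_subalgebra X G" and ?z = "h z'"
  note A = generated_subalgebra_subalgebra[OF G]
  note z'D = central_idempotentsD[OF z']
  have zM: "?z \<in> Mat X" by (rule subalgebra_Mat[OF A hA[OF z'D(1)]])
  let ?P = "\<lambda>M b. cm_mult X M ?z = h (cm_mult W b z') \<and> cm_mult X ?z M = h (cm_mult W b z')"
  let ?C = "{M \<in> Mat X. \<exists>b\<in>B. ?P M b}"
  have bz: "cm_mult W b z' \<in> B" if "b \<in> B" for b by (rule subalgebra_mult[OF B that z'D(1)])
  have "subalgebra X ?C"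
    unfolding subalgebra_def
  proof (intro conjI ballI allI)
    have "cm_mult W (eps W) z' = z'" by (rule cm_mult_one_left[OF W subalgebra_Mat[OF B z'D(1)]])
    then have "?P (eps X) (eps W)"
      using cm_mult_one_left[OF X zM] cm_mult_one_right[OF X zM] by simp
    then show "eps X \<in> ?C" using subalgebra_one[OF B] eps_in_Mat[of X X] by blast
    fix M assume M: "M \<in> ?C"
    then obtain b where b: "b \<in> B" "?P M b" and MM: "M \<in> Mat X" by blast
    show "cm_scale a M \<in> ?C" for a
    proof -
      have "?P (cm_scale a M) (cm_scale a b)"
        using b h_scale[OF bz[OF b(1)], of a] by (simp add: cm_mult_scale_left cm_mult_scale_right)
      then show ?thesis using subalgebra_scale[OF B b(1)] Mat_scale[OF MM] by blast
    qed
    fix N assume N: "N \<in> ?C"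
    then obtain c where c: "c \<in> B" "?P N c" and NM: "N \<in> Mat X" by blast
    have "?P (M + N) (b + c)"
      using b(2) c(2) h_add[OF bz[OF b(1)] bz[OF c(1)]]
      by (simp only: cm_mult_add_left cm_mult_add_right)
    then show "M + N \<in> ?C" using subalgebra_add[OF B b(1) c(1)] Mat_add[OF MM NM] by blast
    have zz: "cm_mult W z' (cm_mult W c z') = cm_mult W c z'"
      using z'D(2)[OF bz[OF c(1)]] z'D(3) by (simp only: cm_mult_assoc)
    have bzc: "cm_mult W (cm_mult W b z') (cm_mult W c z') = cm_mult W (cm_mult W b c) z'"
      using zz by (simp only: cm_mult_assoc)
    have zc: "cm_mult X ?z (h (cm_mult W c z')) = h (cm_mult W c z')"
      using h_mult[OF z'D(1) bz[OF c(1)]] zz by simp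
    have hb: "cm_mult X (h (cm_mult W b z')) ?z = h (cm_mult W b z')"
      using h_mult[OF bz[OF b(1)] z'D(1)] z'D(3) by (simp only: cm_mult_assoc)
    have hbc: "cm_mult X (h (cm_mult W b z')) (h (cm_mult W c z')) = h (cm_mult W (cm_mult W b c) z')"
      using h_mult[OF bz[OF b(1)] bz[OF c(1)]] bzc by simp
    have "cm_mult X (cm_mult X M N) ?z = cm_mult X M (cm_mult X ?z (h (cm_mult W c z')))"
      using c(2) zc by (simp only: cm_mult_assoc)
    also have "\<dots> = cm_mult X (cm_mult X M ?z) (h (cm_mult W c z'))" by (simp only: cm_mult_assoc)
    also have "\<dots> = h (cm_mult W (cm_mult W b c) z')" using b(2) hbc by simp
    finally have right: "cm_mult X (cm_mult X M N) ?z = h (cm_mult W (cm_mult W b c) z')" .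
    have "cm_mult X ?z (cm_mult X M N) = cm_mult X (cm_mult X (h (cm_mult W b z')) ?z) N"
      unfolding hb using b(2) by (simp only: cm_mult_assoc[symmetric])
    also have "\<dots> = cm_mult X (h (cm_mult W b z')) (cm_mult X ?z N)" by (simp only: cm_mult_assoc)
    also have "\<dots> = h (cm_mult W (cm_mult W b c) z')" using c(2) hbc by simp
    finally have "?P (cm_mult X M N) (cm_mult W b c)" using right by blast
    then show "cm_mult X M N \<in> ?C" using subalgebra_mult[OF B b(1) c(1)] Mat_mult[OF MM NM] by blast
  qed blast
  moreover have "G \<subseteq> ?C" using gen G by blast
  ultimately have AC: "?A \<subseteq> ?C" by (rule generated_subalgebra_least)
  then have corner: "\<exists>b\<in>B. ?P M b" if "M \<in> ?A" for M using that by blast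
  show "cpis_below X ?A ?z = h ` cpis_below W B z'"
    by (rule cpis_below_corner[OF A B z' refl hA h_add h_mult h_inj corner])
  show "?z \<in> central_idempotents X ?A"
  proof (rule central_idempotentsI[OF hA[OF z'D(1)]])
    show "cm_mult X ?z ?z = ?z" using h_mult[OF z'D(1) z'D(1)] z'D(3) by simp
    show "cm_mult X ?z N = cm_mult X N ?z" if "N \<in> ?A" for N using corner[OF that] by metis
  qed
qed

lemma cm_mult_eps_eps: "finite X \<Longrightarrow> cm_mult X (eps U) (eps V) = eps (U \<inter> V \<inter> X)"
  by (simp add: cm_mult_eps_left) (auto simp: eps_def fun_eq_iff)

lemma eps_sum_cells:
  assumes S: "scheme X S" and x0: "x\<^sub>0 \<in> X"
  shows "eps X = (\<Sum>s\<in>S. eps (s `` {x\<^sub>0}))"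
proof (intro ext)
  fix x y
  show "eps X x y = (\<Sum>s\<in>S. eps (s `` {x\<^sub>0})) x y"
  proof (cases "x \<in> X \<and> x = y")
    case True
    then obtain r where r: "r \<in> S" "(x\<^sub>0, x) \<in> r" using scheme_exists[OF S x0] by blast
    have "(\<Sum>s\<in>S. eps (s `` {x\<^sub>0}) x y) = (\<Sum>s\<in>S. if s = r then 1 else 0)"
      by (rule sum.cong[OF refl]) (use r True scheme_unique[OF S] in \<open>auto simp: eps_def\<close>)
    also have "\<dots> = 1" using r scheme_finite_relations[OF S] by simp
    finally show ?thesis using True by (auto simp: sum_fun_apply2 eps_def)
  next
    case False
    then have "(\<Sum>s\<in>S. eps (s `` {x\<^sub>0}) x y) = 0"
      by (intro sum.neutral) (auto simp: eps_def dest: scheme_mem[OF S])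
    then show ?thesis using False by (auto simp: sum_fun_apply2 eps_def)
  qed
qed

text \<open>Row and column sums of the trivial idempotent are 1.  Hence \<open>I - e\<close> kills \<open>J\<close>, and therefore every
  generator \<open>J \<otimes> \<sigma>\<^sub>t\<close> of the Terwilliger algebra of a wreath product.\<close>

lemma trivial_idempotent_T_Jm:
  assumes S: "scheme X S" and x0: "x\<^sub>0 \<in> X"
  shows "cm_mult X (Jm V X) (trivial_idempotent_T X S x\<^sub>0) = Jm V X"
    and "cm_mult X (trivial_idempotent_T X S x\<^sub>0) (Jm X V) = Jm X V"
proof -
  let ?e = "trivial_idempotent_T X S x\<^sub>0"
  have eM: "?e \<in> Mat X"
    by (rule subalgebra_Mat[OF terwilliger_subalgebra[OF S] trivial_idempotent_T_in[OF S]])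
  have sums: "(\<Sum>z\<in>X. ?e z y) = of_bool (y \<in> X)" "(\<Sum>z\<in>X. ?e y z) = of_bool (y \<in> X)" for y
  proof -
    have "(\<Sum>z\<in>X. ?e z y) = of_bool (y \<in> X) \<and> (\<Sum>z\<in>X. ?e y z) = of_bool (y \<in> X)"
    proof (cases "y \<in> X")
      case True
      then obtain s where s: "s \<in> S" "(x\<^sub>0, y) \<in> s" using scheme_exists[OF S x0] by blast
      have "(\<Sum>z\<in>X. of_bool ((x\<^sub>0, z) \<in> s) / of_nat (valency X s)) = (1 :: complex)"
      proof -
        have "(\<Sum>z\<in>X. of_bool ((x\<^sub>0, z) \<in> s) / of_nat (valency X s)) =
            (of_nat (card (X \<inter> {z. (x\<^sub>0, z) \<in> s})) / of_nat (valency X s) :: complex)"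
          using scheme_finite[OF S] by (simp flip: sum_divide_distrib)
        also have "X \<inter> {z. (x\<^sub>0, z) \<in> s} = s `` {x\<^sub>0}" using scheme_mem[OF S s(1)] by auto
        finally show ?thesis using valency_eq[OF S s(1) x0] valency_pos[OF S s(1)] by simp
      qed
      then show ?thesis using True by (simp add: trivial_idempotent_T_entry[OF S s])
    next
      case False
      then show ?thesis using Mat_outside[OF eM] by simp
    qed
    then show "(\<Sum>z\<in>X. ?e z y) = of_bool (y \<in> X)" "(\<Sum>z\<in>X. ?e y z) = of_bool (y \<in> X)" by blast+
  qed
  show "cm_mult X (Jm V X) ?e = Jm V X"
  proof (intro ext)
    fix x y
    have "cm_mult X (Jm V X) ?e x y = of_bool (x \<in> V) * (\<Sum>z\<in>X. ?e z y)"
      by (simp add: cm_mult_def Jm_def sum_distrib_left)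
    then show "cm_mult X (Jm V X) ?e x y = Jm V X x y" unfolding sums by (simp add: Jm_def)
  qed
  show "cm_mult X ?e (Jm X V) = Jm X V"
  proof (intro ext)
    fix x y
    have "cm_mult X ?e (Jm X V) x y = (\<Sum>z\<in>X. ?e x z) * of_bool (y \<in> V)"
      by (simp add: cm_mult_def Jm_def sum_distrib_right)
    then show "cm_mult X ?e (Jm X V) x y = Jm X V x y" unfolding sums by (simp add: Jm_def)
  qed
qed

lemma trivial_idempotent_A_Jm:
  assumes "finite X" "X \<noteq> {}"
  shows "cm_mult X (Jm V X) (trivial_idempotent_A X) = Jm V X"
    and "cm_mult X (trivial_idempotent_A X) (Jm X V) = Jm X V"
  using assms by (simp_all add: trivial_idempotent_A_def cm_mult_scale_left cm_mult_scale_right cm_mult_Jm)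

locale pointed_wreath =
  fixes X :: "'a set" and S :: "('a \<times> 'a) set set" and Y :: "'b set" and T :: "('b \<times> 'b) set set"
    and x\<^sub>0 :: 'a and y\<^sub>0 :: 'b
  assumes S: "scheme X S" and T: "scheme Y T" and x0: "x\<^sub>0 \<in> X" and y0: "y\<^sub>0 \<in> Y"
begin

abbreviation "TW \<equiv> terwilliger_algebra (X \<times> Y) (wreath X S Y T) (x\<^sub>0, y\<^sub>0)"

abbreviation "GW \<equiv> sigma ` wreath X S Y T \<union> (\<lambda>s. eps (s `` {(x\<^sub>0, y\<^sub>0)})) ` wreath X S Y T"

abbreviation "fiber t \<equiv> t `` {y\<^sub>0}"

lemma finX: "finite X" and finY: "finite Y" and finXY: "finite (X \<times> Y)" and X_ne: "X \<noteq> {}"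
  using scheme_finite[OF S] scheme_finite[OF T] x0 by auto

lemmas TW_subalgebra = terwilliger_subalgebra[OF wreath_scheme[OF S T], of "(x\<^sub>0, y\<^sub>0)"]
lemmas GW_Mat = terwilliger_generators_Mat[OF wreath_scheme[OF S T], of "(x\<^sub>0, y\<^sub>0)"]

lemma fiber_subset: "t \<in> T \<Longrightarrow> fiber t \<subseteq> Y"
  by (rule scheme_image_subset[OF T])

lemma fiber_Id: "fiber (Id_on Y) = {y\<^sub>0}"
  using y0 by auto

lemma fiber_ne: "t \<in> T \<Longrightarrow> fiber t \<noteq> {}"
  by (rule scheme_image_nonempty[OF T _ y0])

lemma fiber_disjoint: "t \<in> T \<Longrightarrow> t' \<in> T \<Longrightarrow> t \<noteq> t' \<Longrightarrow> fiber t \<inter> fiber t' = {}"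
  using scheme_unique[OF T] by blast

lemma y0_notin_fiber: "t \<in> T \<Longrightarrow> t \<noteq> Id_on Y \<Longrightarrow> y\<^sub>0 \<notin> fiber t"
  using off_diagonal[OF T] by blast

lemma generator_cases:
  assumes "g \<in> GW"
  obtains (tilde) s where "s \<in> S" "g = kron (sigma s) (eps Y)"
    | (bar) t where "t \<in> T" "t \<noteq> Id_on Y" "g = kron (Jm X X) (sigma t)"
    | (eps_tilde) s where "s \<in> S" "g = kron (eps (s `` {x\<^sub>0})) (eps {y\<^sub>0})"
    | (eps_bar) t where "t \<in> T" "t \<noteq> Id_on Y" "g = kron (eps X) (eps (fiber t))"
proof -
  obtain w where w: "w \<in> wreath X S Y T" and g: "g = sigma w \<or> g = eps (w `` {(x\<^sub>0, y\<^sub>0)})"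
    using assms by blast
  from w show thesis
  proof (cases rule: wreath_cases)
    case t: (tilde s)
    then have "g = kron (sigma s) (eps Y) \<or> g = kron (eps (s `` {x\<^sub>0})) (eps {y\<^sub>0})"
      using g by (simp only: sigma_wreath_tilde wreath_tilde_image[OF y0] kron_eps)
    then show thesis using t(1) tilde eps_tilde by blast
  next
    case t: (bar t)
    then have "g = kron (Jm X X) (sigma t) \<or> g = kron (eps X) (eps (fiber t))"
      using g by (simp only: sigma_wreath_bar wreath_bar_image[OF x0] kron_eps)
    then show thesis using t(1,2) bar eps_bar by blast
  qed
qed

lemma TW_tilde: "s \<in> S \<Longrightarrow> kron (sigma s) (eps Y) \<in> TW"
  using sigma_in_terwilliger[of "wreath_tilde Y s" "wreath X S Y T" "X \<times> Y"]
  unfolding sigma_wreath_tilde by (simp add: wreath_def)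

lemma TW_bar: "t \<in> T \<Longrightarrow> t \<noteq> Id_on Y \<Longrightarrow> kron (Jm X X) (sigma t) \<in> TW"
  using sigma_in_terwilliger[of "wreath_bar X t" "wreath X S Y T" "X \<times> Y"]
  unfolding sigma_wreath_bar by (simp add: wreath_def)

lemma TW_eps_tilde: "s \<in> S \<Longrightarrow> kron (eps (s `` {x\<^sub>0})) (eps {y\<^sub>0}) \<in> TW"
  using eps_in_terwilliger[of "wreath_tilde Y s" "wreath X S Y T" "(x\<^sub>0, y\<^sub>0)" "X \<times> Y"]
  unfolding wreath_tilde_image[OF y0] kron_eps by (simp add: wreath_def)

lemma TW_eps:
  assumes t: "t \<in> T"
  shows "kron (eps X) (eps (fiber t)) \<in> TW"
proof (cases "t = Id_on Y")
  case True
  show ?thesis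
    unfolding True fiber_Id eps_sum_cells[OF S x0] kron_sum_left
    by (rule subalgebra_sum[OF TW_subalgebra TW_eps_tilde])
next
  case False
  then show ?thesis
    using eps_in_terwilliger[of "wreath_bar X t" "wreath X S Y T" "(x\<^sub>0, y\<^sub>0)" "X \<times> Y"] t
    unfolding wreath_bar_image[OF x0] kron_eps by (simp add: wreath_def)
qed

lemma eps_Y_left: "F \<subseteq> Y \<Longrightarrow> cm_mult Y (eps Y) (eps F) = eps F"
  and eps_Y_right: "F \<subseteq> Y \<Longrightarrow> cm_mult Y (eps F) (eps Y) = eps F"
  using cm_mult_one_left[OF finY] cm_mult_one_right[OF finY] eps_in_Mat by blast+

lemma TW_sigma_eps:
  assumes s: "s \<in> S" and t: "t \<in> T"
  shows "kron (sigma s) (eps (fiber t)) \<in> TW"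
proof -
  have "cm_mult (X \<times> Y) (kron (sigma s) (eps Y)) (kron (eps X) (eps (fiber t))) = kron (sigma s) (eps (fiber t))"
    unfolding cm_mult_kron eps_Y_left[OF fiber_subset[OF t]]
      cm_mult_one_right[OF finX sigma_in_Mat[OF S s]] ..
  then show ?thesis using subalgebra_mult[OF TW_subalgebra TW_tilde[OF s] TW_eps[OF t]] by simp
qed

lemma TW_adjacency_eps:
  assumes M: "M \<in> adjacency_algebra S" and t: "t \<in> T"
  shows "kron M (eps (fiber t)) \<in> TW"
proof -
  obtain c where c: "M = (\<Sum>s\<in>S. cm_scale (c s) (sigma s))"
    using M unfolding adjacency_algebra_def by blast
  show ?thesis unfolding c kron_sum_left kron_scale_left
    by (intro subalgebra_sum[OF TW_subalgebra] subalgebra_scale[OF TW_subalgebra] TW_sigma_eps t)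
qed

lemma restricted_mult:
  assumes "F \<subseteq> Y" "M \<in> Mat (X \<times> F) \<or> N \<in> Mat (X \<times> F)"
  shows "cm_mult (X \<times> F) M N = cm_mult (X \<times> Y) M N"
  using cm_mult_superset[OF finXY _ assms(2)] assms(1) by (metis Sigma_mono order_refl)

text \<open>An algebra generated over \<open>X \<times> y\<^sub>0t\<close>, with that block as its identity, lies in \<open>TW\<close> as soon as its
  generators do; so the adjacency and Terwilliger algebras of \<open>U\<^sup>(\<^sup>t\<^sup>)\<close> embed into \<open>TW\<close>.\<close>

lemma supported_subalgebra:
  assumes t: "t \<in> T"
  shows "subalgebra (X \<times> fiber t) (TW \<inter> Mat (X \<times> fiber t))"
proof -
  let ?F = "X \<times> fiber t"
  show ?thesis
    unfolding subalgebra_def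
  proof (intro conjI ballI allI IntI)
    show "eps ?F \<in> TW" using TW_eps[OF t] by (simp only: kron_eps)
    show "eps ?F \<in> Mat ?F" by (rule eps_in_Mat) simp
    fix M assume M: "M \<in> TW \<inter> Mat ?F"
    show "cm_scale c M \<in> TW" "cm_scale c M \<in> Mat ?F" for c
      using M by (blast intro: subalgebra_scale[OF TW_subalgebra] Mat_scale)+
    fix N assume N: "N \<in> TW \<inter> Mat ?F"
    show "M + N \<in> TW" "M + N \<in> Mat ?F" "cm_mult ?F M N \<in> Mat ?F"
      using M N by (blast intro: subalgebra_add[OF TW_subalgebra] Mat_add Mat_mult)+
    have "cm_mult ?F M N = cm_mult (X \<times> Y) M N"
      using M restricted_mult[OF fiber_subset[OF t]] by blast
    then show "cm_mult ?F M N \<in> TW" using M N subalgebra_mult[OF TW_subalgebra] by simp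
  qed blast
qed

lemma Ut_eq:
  assumes t: "t \<in> T" and complete: "restrict_relations (fiber t) T = complete_relations (fiber t)"
  shows "Ut X S Y T y\<^sub>0 t = wreath X S (fiber t) (complete_relations (fiber t))"
  unfolding Ut_def Ft_def restrict_wreath[OF S T fiber_subset[OF t] fiber_ne[OF t]] complete ..

lemma Ut_scheme:
  assumes t: "t \<in> T" and complete: "restrict_relations (fiber t) T = complete_relations (fiber t)"
  shows "scheme (X \<times> fiber t) (Ut X S Y T y\<^sub>0 t)"
  unfolding Ut_eq[OF assms]
  by (rule wreath_scheme[OF S complete_scheme[OF scheme_image_finite[OF T t] fiber_ne[OF t]]])

subsection \<open>The corner at the base point\<close>

lemma base_complete: "restrict_relations (fiber (Id_on Y)) T = complete_relations (fiber (Id_on Y))"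
  unfolding fiber_Id by (rule restrict_singleton[OF T y0])

lemma complete_singleton: "complete_relations {y} = {Id_on {y}}"
proof -
  have "{y} \<times> {y} - Id_on {y} = {}" "Id_on {y} \<noteq> {}" by auto
  then show ?thesis unfolding complete_relations_def by blast
qed

definition "base_central = kron (eps X - trivial_idempotent_T X S x\<^sub>0) (eps {y\<^sub>0})"

text \<open>The complement of the trivial idempotent in the base block kills all \<open>J \<otimes> \<sigma>\<^sub>t\<close>, so the corner of \<open>TW\<close>
  is the corner of the Terwilliger algebra of \<open>U\<close> in which only the trivial idempotent is missing.\<close>

lemma base_corner:
  fixes W U B
  defines "W \<equiv> Ft X y\<^sub>0 (Id_on Y)" and "U \<equiv> Ut X S Y T y\<^sub>0 (Id_on Y)"
  defines "B \<equiv> terwilliger_algebra W U (x\<^sub>0, y\<^sub>0)"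
  shows "base_central \<in> central_idempotents (X \<times> Y) TW"
    and "cpis_below (X \<times> Y) TW base_central =
      {e_tilde X S Y T x\<^sub>0 y\<^sub>0 \<chi> | \<chi>. \<chi> \<in> Irr_nontrivial_T W U (x\<^sub>0, y\<^sub>0)}"
proof -
  note Id = scheme_Id[OF T]
  have W_eq: "W = X \<times> {y\<^sub>0}" unfolding W_def Ft_def fiber_Id ..
  have U_eq: "U = wreath X S {y\<^sub>0} (complete_relations {y\<^sub>0})"
    using Ut_eq[OF Id base_complete] unfolding U_def fiber_Id .
  have Usch: "scheme W U" using Ut_scheme[OF Id base_complete] unfolding W_eq U_def fiber_Id .
  have finW: "finite W" by (rule scheme_finite[OF Usch])
  have pt: "(x\<^sub>0, y\<^sub>0) \<in> W" using x0 by (simp add: W_eq)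
  have B: "subalgebra W B" unfolding B_def by (rule terwilliger_subalgebra[OF Usch])
  define e where "e = trivial_idempotent_T W U (x\<^sub>0, y\<^sub>0)"
  have e_eq: "e = kron (trivial_idempotent_T X S x\<^sub>0) (eps {y\<^sub>0})"
  proof -
    have "scheme {y\<^sub>0} (complete_relations {y\<^sub>0})" by (rule complete_scheme) simp_all
    from trivial_idempotent_T_wreath[OF S this x0, of y\<^sub>0] show ?thesis
      unfolding e_def W_eq U_eq complete_singleton by simp
  qed
  have e: "e \<in> central_primitive_idempotents W B"
    unfolding e_def B_def by (rule trivial_idempotent_T_primitive(1)[OF Usch pt])
  define z where "z = eps W - e"
  have z: "z \<in> central_idempotents W B"
    unfolding z_def by (rule central_idempotents_complement[OF finW B cpiD(1)[OF e]])
  let ?Q = "eps X - trivial_idempotent_T X S x\<^sub>0"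
  have z_eq: "z = base_central"
    unfolding z_def base_central_def e_eq W_eq kron_diff_left kron_eps ..
  have U_img: "U = wreath_tilde {y\<^sub>0} ` S"
    unfolding U_eq wreath_def complete_singleton by simp
  have Ugen: "sigma ` U = (\<lambda>s. kron (sigma s) (eps {y\<^sub>0})) ` S"
    "(\<lambda>s. eps (s `` {(x\<^sub>0, y\<^sub>0)})) ` U = (\<lambda>s. kron (eps (s `` {x\<^sub>0})) (eps {y\<^sub>0})) ` S"
    unfolding U_img image_image sigma_wreath_tilde kron_eps wreath_tilde_image[OF singletonI]
    by (rule refl)+
  have fW: "X \<times> fiber (Id_on Y) = W" unfolding fiber_Id W_eq ..
  have BA: "B \<subseteq> TW \<inter> Mat W"
    unfolding B_def terwilliger_algebra_def[of W]
  proof (rule generated_subalgebra_least)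
    show "subalgebra W (TW \<inter> Mat W)" using supported_subalgebra[OF Id] unfolding fW .
    show "sigma ` U \<union> (\<lambda>s. eps (s `` {(x\<^sub>0, y\<^sub>0)})) ` U \<subseteq> TW \<inter> Mat W"
    proof (rule Int_greatest)
      show "sigma ` U \<union> (\<lambda>s. eps (s `` {(x\<^sub>0, y\<^sub>0)})) ` U \<subseteq> TW"
        unfolding Ugen using TW_sigma_eps[OF _ Id] TW_eps_tilde unfolding fiber_Id by blast
    qed (rule terwilliger_generators_Mat[OF Usch])
  qed
  have sub: "{y\<^sub>0} \<subseteq> Y" using y0 by blast
  have mult: "cm_mult W b c = cm_mult (X \<times> Y) b c" if "b \<in> B" for b c
    using restricted_mult[OF sub] BA that unfolding W_eq by blast
  have eps1: "cm_mult {y\<^sub>0} (eps {y\<^sub>0}) (eps {y\<^sub>0}) = eps {y\<^sub>0}" by (simp add: cm_mult_eps_eps)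
  have bz: "cm_mult W (kron M (eps {y\<^sub>0})) z = kron (cm_mult X M ?Q) (eps {y\<^sub>0})"
    and zb: "cm_mult W z (kron M (eps {y\<^sub>0})) = kron (cm_mult X ?Q M) (eps {y\<^sub>0})" for M
    unfolding z_eq base_central_def W_eq cm_mult_kron eps1 by (rule refl)+
  have gz: "cm_mult (X \<times> Y) (kron M N) z = kron (cm_mult X M ?Q) (cm_mult Y N (eps {y\<^sub>0}))"
    and zg: "cm_mult (X \<times> Y) z (kron M N) = kron (cm_mult X ?Q M) (cm_mult Y (eps {y\<^sub>0}) N)" for M N
    unfolding z_eq base_central_def cm_mult_kron by (rule refl)+
  have JQ: "cm_mult X (Jm X X) ?Q = 0" "cm_mult X ?Q (Jm X X) = 0"
    using cm_mult_one_left[OF finX Jm_in_Mat[of X X X]] cm_mult_one_right[OF finX Jm_in_Mat[of X X X]]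
    by (simp_all add: cm_mult_diff_left cm_mult_diff_right trivial_idempotent_T_Jm[OF S x0])
  have inB: "kron (sigma s) (eps {y\<^sub>0}) \<in> B" "kron (eps (s `` {x\<^sub>0})) (eps {y\<^sub>0}) \<in> B" if "s \<in> S" for s
    using generated_subalgebra_generators[of "sigma ` U \<union> (\<lambda>s. eps (s `` {(x\<^sub>0, y\<^sub>0)})) ` U" W] that
    unfolding B_def terwilliger_algebra_def[of W] Ugen by blast+
  have step: "\<exists>b\<in>B. cm_mult (X \<times> Y) g z = cm_mult W b z \<and> cm_mult (X \<times> Y) z g = cm_mult W b z"
    if g: "g \<in> GW" for g
  proof -
    have *: ?thesis if "b \<in> B" "cm_mult (X \<times> Y) g z = cm_mult W b z" "cm_mult (X \<times> Y) z g = cm_mult W z b" for b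
      using that central_idempotentsD(2)[OF z that(1)] by auto
    from g show ?thesis
    proof (cases rule: generator_cases)
      case (tilde s)
      show ?thesis
        by (rule *[OF inB(1)[OF tilde(1)]])
          (simp_all only: tilde gz zg bz zb eps_Y_left[OF sub] eps_Y_right[OF sub])
    next
      case (bar t)
      show ?thesis
        by (rule *[OF subalgebra_zero[OF B]])
          (simp_all only: bar gz zg JQ kron_zero_left cm_mult_zero_left cm_mult_zero_right)
    next
      case (eps_tilde s)
      have "cm_mult Y (eps {y\<^sub>0}) (eps {y\<^sub>0}) = eps {y\<^sub>0}" using y0 finY by (simp add: cm_mult_eps_eps)
      then show ?thesis
        by (intro *[OF inB(2)[OF eps_tilde(1)]]) (simp_all only: eps_tilde gz zg bz zb)
    next
      case (eps_bar t)
      have "fiber t \<inter> {y\<^sub>0} = {}" using y0_notin_fiber[OF eps_bar(1,2)] by blast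
      then have "cm_mult Y (eps (fiber t)) (eps {y\<^sub>0}) = 0" "cm_mult Y (eps {y\<^sub>0}) (eps (fiber t)) = 0"
        using finY by (simp_all add: cm_mult_eps_eps Int_commute) (simp_all add: eps_def fun_eq_iff)
      then show ?thesis
        by (intro *[OF subalgebra_zero[OF B]])
          (simp_all only: eps_bar gz zg kron_zero_right cm_mult_zero_left cm_mult_zero_right)
    qed
  qed
  note TW_gen = terwilliger_algebra_def[of "X \<times> Y" "wreath X S Y T" "(x\<^sub>0, y\<^sub>0)"]
  have hA: "b \<in> generated_subalgebra (X \<times> Y) GW" if "b \<in> B" for b
    using BA that unfolding TW_gen by blast
  note corner = cpis_below_generated_corner[where h = "\<lambda>M. M", OF finXY GW_Mat finW B z hA refl refl mult _ step]
  show "base_central \<in> central_idempotents (X \<times> Y) TW"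
    unfolding TW_gen z_eq[symmetric] by (rule corner(2)) simp_all
  have "cpis_below (X \<times> Y) TW z = (\<lambda>M. M) ` cpis_below W B z"
    unfolding TW_gen by (rule corner(1)) simp_all
  also have "\<dots> = central_primitive_idempotents W B - {e}"
    unfolding z_def cpis_below_complement[OF finW B e] by simp
  also have "\<dots> = idempotent_of W B ` Irr_nontrivial_T W U (x\<^sub>0, y\<^sub>0)"
    unfolding e_def B_def idempotents_of_Irr_nontrivial_T[OF Usch pt] ..
  also have "\<dots> = {e_tilde X S Y T x\<^sub>0 y\<^sub>0 \<chi> | \<chi>. \<chi> \<in> Irr_nontrivial_T W U (x\<^sub>0, y\<^sub>0)}"
  proof -
    have eq: "e_tilde X S Y T x\<^sub>0 y\<^sub>0 \<chi> = idempotent_of W B \<chi>"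
      if "\<chi> \<in> Irr_nontrivial_T W U (x\<^sub>0, y\<^sub>0)" for \<chi>
    proof -
      have "\<chi> \<in> Irr W B" using that unfolding Irr_nontrivial_T_def Let_def B_def by blast
      then have "idempotent_of W B \<chi> \<in> central_primitive_idempotents W B"
        using idempotent_of_Irr[OF finW B] by blast
      then have "idempotent_of W B \<chi> \<in> Mat (X \<times> {y\<^sub>0})"
        using subalgebra_Mat[OF B] central_idempotentsD(1) cpiD(1) unfolding W_eq by blast
      then have "kron (first_coordinate y\<^sub>0 M) (eps {y\<^sub>0}) = M" if "M = idempotent_of W B \<chi>" for M
        using that by (auto simp: kron_def first_coordinate_def eps_def fun_eq_iff Mat_def)
      then show ?thesis unfolding e_tilde_def Let_def W_def U_def B_def by blast
    qed
    have "idempotent_of W B ` Irr_nontrivial_T W U (x\<^sub>0, y\<^sub>0) =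
        e_tilde X S Y T x\<^sub>0 y\<^sub>0 ` Irr_nontrivial_T W U (x\<^sub>0, y\<^sub>0)"
      by (rule image_cong[OF refl]) (rule eq[symmetric])
    then show ?thesis by blast
  qed
  finally show "cpis_below (X \<times> Y) TW base_central =
      {e_tilde X S Y T x\<^sub>0 y\<^sub>0 \<chi> | \<chi>. \<chi> \<in> Irr_nontrivial_T W U (x\<^sub>0, y\<^sub>0)}" unfolding z_eq .
qed

subsection \<open>The corners at the other fibres\<close>

definition "fiber_central t = kron (eps X - trivial_idempotent_A X) (eps (fiber t))"

text \<open>Multiplying by \<open>(I - J / |X|) \<otimes> I\<close> kills all \<open>J \<otimes> \<sigma>\<^sub>u\<close>, and on one fibre only the
  matrices \<open>\<sigma>\<^sub>s \<otimes> I\<close> remain.  The corner is a copy of the adjacency algebra of \<open>S\<close> under \<open>M \<mapsto> M \<otimes> \<epsilon>\<close>.\<close>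

lemma hat_corner:
  assumes t: "t \<in> T" "t \<noteq> Id_on Y"
  shows "fiber_central t \<in> central_idempotents (X \<times> Y) TW"
    and "cpis_below (X \<times> Y) TW (fiber_central t) = {e_hat X S y\<^sub>0 t \<psi> | \<psi>. \<psi> \<in> Irr_nontrivial_A X S}"
proof -
  let ?B = "adjacency_algebra S" and ?F = "fiber t" and ?e = "trivial_idempotent_A X"
  let ?Q = "eps X - ?e" and ?h = "\<lambda>M. kron M (eps (fiber t))"
  note B = adjacency_algebra_subalgebra[OF S]
  note e = trivial_idempotent_A_primitive(1)[OF S]
  note FY = fiber_subset[OF t(1)]
  have z: "?Q \<in> central_idempotents X ?B"
    by (rule central_idempotents_complement[OF finX B cpiD(1)[OF e]])
  have epsF: "cm_mult Y (eps ?F) (eps ?F) = eps ?F" using FY finY by (simp add: cm_mult_eps_eps Int_absorb2)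
  have inj: "inj_on ?h ?B"
  proof (rule inj_onI)
    fix M N :: "'a cmat" assume eq: "?h M = ?h N"
    obtain y where "y \<in> ?F" using fiber_ne[OF t(1)] by blast
    then have "?h M (x, y) (x', y) = M x x'" "?h N (x, y) (x', y) = N x x'" for x x'
      by (simp_all add: kron_def eps_def)
    then show "M = N" using eq by (intro ext) metis
  qed
  have JQ: "cm_mult X (Jm X X) ?Q = 0" "cm_mult X ?Q (Jm X X) = 0"
    using cm_mult_one_left[OF finX Jm_in_Mat[of X X X]] cm_mult_one_right[OF finX Jm_in_Mat[of X X X]]
    by (simp_all add: cm_mult_diff_left cm_mult_diff_right trivial_idempotent_A_Jm[OF finX X_ne])
  have step: "\<exists>b\<in>?B. cm_mult (X \<times> Y) g (?h ?Q) = ?h (cm_mult X b ?Q) \<and>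
                     cm_mult (X \<times> Y) (?h ?Q) g = ?h (cm_mult X b ?Q)"
    if g: "g \<in> GW" for g
  proof -
    have *: ?thesis if "b \<in> ?B" "cm_mult (X \<times> Y) g (?h ?Q) = ?h (cm_mult X b ?Q)"
        "cm_mult (X \<times> Y) (?h ?Q) g = ?h (cm_mult X ?Q b)" for b
      using that central_idempotentsD(2)[OF z that(1)] by auto
    from g show ?thesis
    proof (cases rule: generator_cases)
      case (tilde s)
      show ?thesis
        by (rule *[OF sigma_in_adjacency_algebra[OF S tilde(1)]])
          (simp_all only: tilde cm_mult_kron eps_Y_left[OF FY] eps_Y_right[OF FY])
    next
      case (bar t')
      show ?thesis
        by (rule *[OF subalgebra_zero[OF B]])
          (simp_all only: bar cm_mult_kron JQ kron_zero_left cm_mult_zero_left cm_mult_zero_right)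
    next
      case (eps_tilde s)
      have "{y\<^sub>0} \<inter> ?F = {}" using y0_notin_fiber[OF t] by blast
      then have "cm_mult Y (eps ?F) (eps {y\<^sub>0}) = 0" "cm_mult Y (eps {y\<^sub>0}) (eps ?F) = 0"
        using finY by (simp_all add: cm_mult_eps_eps Int_commute) (simp_all add: eps_def fun_eq_iff)
      then show ?thesis
        by (intro *[OF subalgebra_zero[OF B]])
          (simp_all only: eps_tilde cm_mult_kron kron_zero_right kron_zero_left cm_mult_zero_left cm_mult_zero_right)
    next
      case (eps_bar t')
      show ?thesis
      proof (cases "t' = t")
        case True
        show ?thesis
          by (rule *[OF subalgebra_one[OF B]]) (simp_all only: eps_bar True cm_mult_kron epsF)
      next
        case False
        then have "fiber t' \<inter> ?F = {}" using fiber_disjoint[OF eps_bar(1) t(1)] by blast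
        then have "cm_mult Y (eps (fiber t')) (eps ?F) = 0" "cm_mult Y (eps ?F) (eps (fiber t')) = 0"
          using finY by (simp_all add: cm_mult_eps_eps Int_commute) (simp_all add: eps_def fun_eq_iff)
        then show ?thesis
          by (intro *[OF subalgebra_zero[OF B]])
            (simp_all only: eps_bar cm_mult_kron kron_zero_right kron_zero_left cm_mult_zero_left cm_mult_zero_right)
      qed
    qed
  qed
  have h_mult: "?h (cm_mult X b c) = cm_mult (X \<times> Y) (?h b) (?h c)" for b c
    unfolding cm_mult_kron epsF ..
  note TW_gen = terwilliger_algebra_def[of "X \<times> Y" "wreath X S Y T" "(x\<^sub>0, y\<^sub>0)"]
  have hA: "?h b \<in> generated_subalgebra (X \<times> Y) GW" if "b \<in> ?B" for b
    using TW_adjacency_eps[OF that t(1)] unfolding TW_gen .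
  note corner = cpis_below_generated_corner[where h = ?h, OF finXY GW_Mat finX B z hA
      kron_add_left kron_scale_left h_mult inj step]
  show "fiber_central t \<in> central_idempotents (X \<times> Y) TW"
    unfolding TW_gen fiber_central_def by (rule corner(2))
  have "cpis_below (X \<times> Y) TW (fiber_central t) = ?h ` cpis_below X ?B ?Q"
    unfolding TW_gen fiber_central_def by (rule corner(1))
  also have "\<dots> = ?h ` idempotent_of X ?B ` Irr_nontrivial_A X S"
    unfolding cpis_below_complement[OF finX B e] idempotents_of_Irr_nontrivial_A[OF S] ..
  also have "\<dots> = {e_hat X S y\<^sub>0 t \<psi> | \<psi>. \<psi> \<in> Irr_nontrivial_A X S}"
    unfolding e_hat_def by blast
  finally show "cpis_below (X \<times> Y) TW (fiber_central t) = {e_hat X S y\<^sub>0 t \<psi> | \<psi>. \<psi> \<in> Irr_nontrivial_A X S}" .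
qed

text \<open>This is \<open>I - J / |F|\<close> on the block \<open>F = X \<times> y\<^sub>0t\<close>.\<close>

definition "restricted_central t =
  kron (eps X) (eps (fiber t)) - kron (trivial_idempotent_A X) (trivial_idempotent_A (fiber t))"

lemma eps_trivial_idempotent_A:
  assumes F: "F \<subseteq> Y"
  shows "F \<subseteq> V \<Longrightarrow> V \<subseteq> Y \<Longrightarrow> cm_mult Y (eps V) (trivial_idempotent_A F) = trivial_idempotent_A F"
    and "F \<subseteq> V \<Longrightarrow> V \<subseteq> Y \<Longrightarrow> cm_mult Y (trivial_idempotent_A F) (eps V) = trivial_idempotent_A F"
    and "F \<inter> V = {} \<Longrightarrow> cm_mult Y (eps V) (trivial_idempotent_A F) = 0"
    and "F \<inter> V = {} \<Longrightarrow> cm_mult Y (trivial_idempotent_A F) (eps V) = 0"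
  using F unfolding cm_mult_eps_left[OF finY] cm_mult_eps_right[OF finY]
  by (auto simp: fun_eq_iff trivial_idempotent_A_def cm_scale_def Jm_def)

lemma mult_centering_right:
  assumes F: "F \<subseteq> Y"
  shows "cm_mult Y M (eps F - trivial_idempotent_A F) y y' =
    of_bool (y' \<in> F) * (M y y' - (\<Sum>w\<in>F. M y w) / of_nat (card F))"
proof -
  have "cm_mult Y M (trivial_idempotent_A F) y y' =
      (\<Sum>w\<in>F. M y w * (of_bool (y' \<in> F) / of_nat (card F)))"
    unfolding cm_mult_def trivial_idempotent_A_def cm_scale_def Jm_def
    using F finY by (intro sum.mono_neutral_cong_right) auto
  also have "\<dots> = of_bool (y' \<in> F) * ((\<Sum>w\<in>F. M y w) / of_nat (card F))"
    by (simp add: sum_divide_distrib)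
  finally show ?thesis
    using F by (auto simp: cm_mult_diff_right cm_mult_eps_right[OF finY] algebra_simps)
qed

lemma mult_centering_left:
  assumes F: "F \<subseteq> Y"
  shows "cm_mult Y (eps F - trivial_idempotent_A F) M y y' =
    of_bool (y \<in> F) * (M y y' - (\<Sum>w\<in>F. M w y') / of_nat (card F))"
proof -
  have "cm_mult Y (trivial_idempotent_A F) M y y' =
      (\<Sum>w\<in>F. (of_bool (y \<in> F) / of_nat (card F)) * M w y')"
    unfolding cm_mult_def trivial_idempotent_A_def cm_scale_def Jm_def
    using F finY by (intro sum.mono_neutral_cong_right) auto
  also have "\<dots> = of_bool (y \<in> F) * ((\<Sum>w\<in>F. M w y') / of_nat (card F))"
    by (simp add: sum_divide_distrib)
  finally show ?thesis
    using F by (auto simp: cm_mult_diff_left cm_mult_eps_left[OF finY] algebra_simps)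
qed

text \<open>Multiplication by \<open>eps F - J\<^sub>F / |F|\<close> subtracts averages over \<open>F\<close>, so rows and columns of \<open>\<sigma>\<^sub>u\<close> that are
  constant along \<open>F\<close> disappear and only the block on \<open>F \<times> F\<close> survives.\<close>

lemma sigma_centering:
  assumes F: "F \<subseteq> Y" "F \<noteq> {}" and u: "u \<in> T"
    and rows: "\<And>u y. u \<in> T \<Longrightarrow> y \<in> Y - F \<Longrightarrow> F \<subseteq> u `` {y} \<or> F \<inter> u `` {y} = {}"
  shows "cm_mult Y (sigma u) (eps F - trivial_idempotent_A F) =
      cm_mult Y (sigma (u \<inter> F \<times> F)) (eps F - trivial_idempotent_A F)" (is ?R)
    and "cm_mult Y (eps F - trivial_idempotent_A F) (sigma u) =
      cm_mult Y (eps F - trivial_idempotent_A F) (sigma (u \<inter> F \<times> F))" (is ?L)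
proof -
  have cF: "of_nat (card F) \<noteq> (0 :: complex)" using F finY finite_subset by (simp add: card_eq_0_iff) blast
  have const: "c - (\<Sum>w\<in>F. c) / of_nat (card F) = (0 :: complex)" for c using cF by simp
  show ?R
  proof (intro ext)
    fix y y'
    show "cm_mult Y (sigma u) (eps F - trivial_idempotent_A F) y y' =
      cm_mult Y (sigma (u \<inter> F \<times> F)) (eps F - trivial_idempotent_A F) y y'"
    proof (cases "y' \<in> F \<and> y \<notin> F")
      case False
      have "(\<Sum>w\<in>F. sigma u y w) = (\<Sum>w\<in>F. sigma (u \<inter> F \<times> F) y w)" if "y \<in> F"
        by (rule sum.cong[OF refl]) (use that in \<open>simp add: sigma_def\<close>)
      then show ?thesis unfolding mult_centering_right[OF F(1)]
        using False by (cases "y' \<in> F") (simp_all add: sigma_def)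
    next
      case True
      have "\<exists>c. \<forall>w\<in>F. sigma u y w = c"
      proof (cases "y \<in> Y")
        case yY: True
        then have "F \<subseteq> u `` {y} \<or> F \<inter> u `` {y} = {}" using rows[OF u, of y] True by blast
        then show ?thesis
        proof
          assume "F \<subseteq> u `` {y}"
          then have "\<forall>w\<in>F. sigma u y w = 1" by (auto simp: sigma_def)
          then show ?thesis by blast
        next
          assume "F \<inter> u `` {y} = {}"
          then have "\<forall>w\<in>F. sigma u y w = 0" by (auto simp: sigma_def)
          then show ?thesis by blast
        qed
      next
        case False
        then have "\<forall>w\<in>F. sigma u y w = 0" using scheme_mem[OF T u] by (auto simp: sigma_def)
        then show ?thesis by blast
      qed
      then obtain c where c: "\<forall>w\<in>F. sigma u y w = c" by blast
      have "sigma u y y' - (\<Sum>w\<in>F. sigma u y w) / of_nat (card F) = c - (\<Sum>w\<in>F. c) / of_nat (card F)"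
        using c True by (simp cong: sum.cong)
      moreover have "(\<Sum>w\<in>F. sigma (u \<inter> F \<times> F) y w) = 0"
        by (rule sum.neutral) (use True in \<open>simp add: sigma_def\<close>)
      moreover have "sigma (u \<inter> F \<times> F) y y' = 0" using True by (simp add: sigma_def)
      ultimately show ?thesis unfolding mult_centering_right[OF F(1)] by (simp only: const) simp
    qed
  qed
  show ?L
  proof (intro ext)
    fix y y'
    show "cm_mult Y (eps F - trivial_idempotent_A F) (sigma u) y y' =
      cm_mult Y (eps F - trivial_idempotent_A F) (sigma (u \<inter> F \<times> F)) y y'"
    proof (cases "y \<in> F \<and> y' \<notin> F")
      case False
      have "(\<Sum>w\<in>F. sigma u w y') = (\<Sum>w\<in>F. sigma (u \<inter> F \<times> F) w y')" if "y' \<in> F"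
        by (rule sum.cong[OF refl]) (use that in \<open>simp add: sigma_def\<close>)
      then show ?thesis unfolding mult_centering_left[OF F(1)]
        using False by (cases "y \<in> F") (simp_all add: sigma_def)
    next
      case True
      have "\<exists>c. \<forall>w\<in>F. sigma u w y' = c"
      proof (cases "y' \<in> Y")
        case yY: True
        then have "F \<subseteq> u\<inverse> `` {y'} \<or> F \<inter> u\<inverse> `` {y'} = {}"
          using rows[OF scheme_converse[OF T u], of y'] True by blast
        then show ?thesis
        proof
          assume "F \<subseteq> u\<inverse> `` {y'}"
          then have "\<forall>w\<in>F. sigma u w y' = 1" by (auto simp: sigma_def)
          then show ?thesis by blast
        next
          assume "F \<inter> u\<inverse> `` {y'} = {}"
          then have "\<forall>w\<in>F. sigma u w y' = 0" by (auto simp: sigma_def)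
          then show ?thesis by blast
        qed
      next
        case False
        then have "\<forall>w\<in>F. sigma u w y' = 0" using scheme_mem[OF T u] by (auto simp: sigma_def)
        then show ?thesis by blast
      qed
      then obtain c where c: "\<forall>w\<in>F. sigma u w y' = c" by blast
      have "sigma u y y' - (\<Sum>w\<in>F. sigma u w y') / of_nat (card F) = c - (\<Sum>w\<in>F. c) / of_nat (card F)"
        using c True by (simp cong: sum.cong)
      moreover have "(\<Sum>w\<in>F. sigma (u \<inter> F \<times> F) w y') = 0"
        by (rule sum.neutral) (use True in \<open>simp add: sigma_def\<close>)
      moreover have "sigma (u \<inter> F \<times> F) y y' = 0" using True by (simp add: sigma_def)
      ultimately show ?thesis unfolding mult_centering_left[OF F(1)] by (simp only: const) simp
    qed
  qed
qed

text \<open>Under the two hypotheses on the fibre, the block \<open>I - J / |F|\<close> sees from each generator only its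
  restriction to \<open>F = X \<times> y\<^sub>0t\<close>, which is an element of the adjacency algebra of \<open>U\<^sup>(\<^sup>t\<^sup>)\<close>.  The hypotheses hold if
  \<open>y\<^sub>0t\<close> is a single point and if \<open>T\<close> is a one-class scheme.\<close>

lemma bar_corner:
  assumes t: "t \<in> T" "t \<noteq> Id_on Y"
    and complete: "restrict_relations (fiber t) T = complete_relations (fiber t)"
    and rows: "\<And>u y. u \<in> T \<Longrightarrow> y \<in> Y - fiber t \<Longrightarrow> fiber t \<subseteq> u `` {y} \<or> fiber t \<inter> u `` {y} = {}"
  shows "restricted_central t \<in> central_idempotents (X \<times> Y) TW"
    and "cpis_below (X \<times> Y) TW (restricted_central t) =
      {e_bar X S Y T y\<^sub>0 t \<phi> | \<phi>. \<phi> \<in> Irr_nontrivial_A (Ft X y\<^sub>0 t) (Ut X S Y T y\<^sub>0 t)}"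
proof -
  let ?F = "fiber t" and ?U = "Ut X S Y T y\<^sub>0 t"
  let ?W = "X \<times> fiber t"
  let ?B = "adjacency_algebra ?U"
  let ?E = "trivial_idempotent_A X" and ?P = "trivial_idempotent_A (fiber t)"
  note Usch = Ut_scheme[OF t(1) complete]
  note U_eq = Ut_eq[OF t(1) complete]
  note FY = fiber_subset[OF t(1)] and F_ne = fiber_ne[OF t(1)]
  note finW = scheme_finite[OF Usch]
  note B = adjacency_algebra_subalgebra[OF Usch]
  note e = trivial_idempotent_A_primitive(1)[OF Usch]
  have e_eq: "trivial_idempotent_A ?W = kron ?E ?P"
    unfolding trivial_idempotent_A_def kron_scale_left kron_scale_right kron_Jm card_cartesian_product
    by (simp add: mult.commute)
  define z where "z = eps ?W - trivial_idempotent_A ?W"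
  have z: "z \<in> central_idempotents ?W ?B"
    unfolding z_def by (rule central_idempotents_complement[OF finW B cpiD(1)[OF e]])
  have z_eq: "z = restricted_central t" unfolding z_def e_eq restricted_central_def kron_eps ..
  have z_kron: "z = kron (eps X) (eps ?F) - kron ?E ?P" unfolding z_eq restricted_central_def ..
  have tilde_in: "kron (sigma s) (eps ?F) \<in> ?B" if "s \<in> S" for s
  proof -
    have "wreath_tilde ?F s \<in> ?U" unfolding U_eq wreath_def using that by blast
    then have "sigma (wreath_tilde ?F s) \<in> ?B" by (rule sigma_in_adjacency_algebra[OF Usch])
    then show ?thesis unfolding sigma_wreath_tilde .
  qed
  have bar_in: "kron (Jm X X) (sigma (u \<inter> ?F \<times> ?F)) \<in> ?B" if u: "u \<in> T" "u \<noteq> Id_on Y" for u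
  proof (cases "u \<inter> ?F \<times> ?F = {}")
    case True
    have "sigma {} = (0 :: 'b cmat)" by (simp add: sigma_def fun_eq_iff)
    then show ?thesis unfolding True using subalgebra_zero[OF B] by simp
  next
    case False
    then have "u \<inter> ?F \<times> ?F \<in> complete_relations ?F"
      unfolding complete[symmetric] restrict_relations_def using u(1) by blast
    moreover have "u \<inter> ?F \<times> ?F \<noteq> Id_on ?F"
    proof
      assume eq: "u \<inter> ?F \<times> ?F = Id_on ?F"
      obtain y where "y \<in> ?F" using F_ne by blast
      then have "(y, y) \<in> u" using eq by blast
      then show False using off_diagonal[OF T u] by blast
    qed
    ultimately have "wreath_bar X (u \<inter> ?F \<times> ?F) \<in> ?U" unfolding U_eq wreath_def by blast
    then have "sigma (wreath_bar X (u \<inter> ?F \<times> ?F)) \<in> ?B" by (rule sigma_in_adjacency_algebra[OF Usch])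
    then show ?thesis unfolding sigma_wreath_bar .
  qed
  have BM: "b \<in> Mat ?W" if "b \<in> ?B" for b by (rule subalgebra_Mat[OF B that])
  have mult: "cm_mult ?W b c = cm_mult (X \<times> Y) b c" if "b \<in> ?B" for b c
    using restricted_mult[OF FY] BM[OF that] by blast
  have TW_J: "kron (Jm X X) (sigma (u \<inter> ?F \<times> ?F)) \<in> TW" if u: "u \<in> T" "u \<noteq> Id_on Y" for u
  proof -
    have "cm_mult (X \<times> Y) (cm_mult (X \<times> Y) (kron (eps X) (eps ?F)) (kron (Jm X X) (sigma u))) (kron (eps X) (eps ?F))
        = kron (Jm X X) (sigma (u \<inter> ?F \<times> ?F))"
    proof -
      have "cm_mult Y (cm_mult Y (eps ?F) (sigma u)) (eps ?F) = sigma (u \<inter> ?F \<times> ?F)"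
        unfolding cm_mult_eps_left[OF finY] cm_mult_eps_right[OF finY]
        using FY by (auto simp: sigma_def fun_eq_iff)
      then show ?thesis
        unfolding cm_mult_kron cm_mult_one_left[OF finX Jm_in_Mat[OF order_refl order_refl]]
          cm_mult_one_right[OF finX Jm_in_Mat[OF order_refl order_refl]] by simp
    qed
    then show ?thesis
      using subalgebra_mult[OF TW_subalgebra subalgebra_mult[OF TW_subalgebra TW_eps[OF t(1)] TW_bar[OF u]] TW_eps[OF t(1)]]
      by simp
  qed
  have sigma_U: "sigma w \<in> TW \<inter> Mat ?W" if w: "w \<in> ?U" for w
  proof -
    have "sigma w \<in> TW"
      using w unfolding U_eq
    proof (cases rule: wreath_cases)
      case (tilde s)
      show ?thesis unfolding tilde sigma_wreath_tilde by (rule TW_sigma_eps[OF tilde(1) t(1)])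
    next
      case (bar r)
      have "r \<in> restrict_relations ?F T" using bar(1) complete by simp
      then obtain u where u: "u \<in> T" "r = u \<inter> ?F \<times> ?F" unfolding restrict_relations_def by blast
      have "Id_on Y \<inter> ?F \<times> ?F = Id_on ?F" using FY by auto
      then have "u \<noteq> Id_on Y" using u bar(2) by metis
      then show ?thesis unfolding bar sigma_wreath_bar u(2) by (rule TW_J[OF u(1)])
    qed
    then show ?thesis using sigma_in_Mat[OF Usch w] by blast
  qed
  note TW_gen = terwilliger_algebra_def[of "X \<times> Y" "wreath X S Y T" "(x\<^sub>0, y\<^sub>0)"]
  have hA: "b \<in> generated_subalgebra (X \<times> Y) GW" if "b \<in> ?B" for b
    using adjacency_algebra_spanned[OF Usch that supported_subalgebra[OF t(1)] sigma_U]
    unfolding TW_gen by blast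
  have epsF: "cm_mult Y (eps ?F) (eps ?F) = eps ?F" using FY finY by (simp add: cm_mult_eps_eps Int_absorb2)
  note EJ = trivial_idempotent_A_Jm[OF finX X_ne]
  note P_simps = eps_trivial_idempotent_A[OF FY]
  have step: "\<exists>b\<in>?B. cm_mult (X \<times> Y) g z = cm_mult ?W b z \<and> cm_mult (X \<times> Y) z g = cm_mult ?W b z"
    if g: "g \<in> GW" for g
  proof -
    have *: ?thesis if b: "b \<in> ?B" and "cm_mult (X \<times> Y) g z = cm_mult (X \<times> Y) b z"
        "cm_mult (X \<times> Y) z g = cm_mult (X \<times> Y) z b" for b
    proof (rule bexI[OF _ b], rule conjI)
      show "cm_mult (X \<times> Y) g z = cm_mult ?W b z" using that(2) mult[OF b] by metis
      show "cm_mult (X \<times> Y) z g = cm_mult ?W b z"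
        using that(3) mult[OF central_idempotentsD(1)[OF z]] central_idempotentsD(2)[OF z b] by metis
    qed
    have zero: ?thesis if "cm_mult (X \<times> Y) g z = 0" "cm_mult (X \<times> Y) z g = 0"
      by (rule *[OF subalgebra_zero[OF B]]) (simp_all only: that cm_mult_zero_left cm_mult_zero_right)
    note expand = z_kron cm_mult_diff_left cm_mult_diff_right cm_mult_kron
    from g show ?thesis
    proof (cases rule: generator_cases)
      case (tilde s)
      show ?thesis
        by (rule *[OF tilde_in[OF tilde(1)]])
          (simp_all only: tilde expand eps_Y_left[OF FY] eps_Y_right[OF FY] epsF
            P_simps(1,2)[OF FY order_refl] P_simps(1,2)[OF order_refl FY])
    next
      case (bar u)
      have J: "Jm X X \<in> Mat X" by (rule Jm_in_Mat) simp_all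
      have "cm_mult (X \<times> Y) (kron (Jm X X) M) z = kron (Jm X X) (cm_mult Y M (eps ?F - ?P))"
        "cm_mult (X \<times> Y) z (kron (Jm X X) M) = kron (Jm X X) (cm_mult Y (eps ?F - ?P) M)" for M
        unfolding expand EJ cm_mult_one_left[OF finX J] cm_mult_one_right[OF finX J] kron_diff_right
        by (rule refl)+
      then show ?thesis
        by (intro *[OF bar_in[OF bar(1,2)]]) (simp_all only: bar sigma_centering[OF FY F_ne bar(1) rows])
    next
      case (eps_tilde s)
      have "?F \<inter> {y\<^sub>0} = {}" using y0_notin_fiber[OF t] by blast
      moreover from this have "cm_mult Y (eps ?F) (eps {y\<^sub>0}) = 0" "cm_mult Y (eps {y\<^sub>0}) (eps ?F) = 0"
        using finY by (simp_all add: cm_mult_eps_eps Int_commute) (simp_all add: eps_def fun_eq_iff)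
      ultimately show ?thesis
        by (intro zero) (simp_all only: eps_tilde expand P_simps(3,4) kron_zero_right diff_0_right)
    next
      case (eps_bar t')
      show ?thesis
      proof (cases "t' = t")
        case True
        show ?thesis
          by (rule *[OF subalgebra_one[OF B]]) (simp_all only: eps_bar True kron_eps)
      next
        case False
        then have "?F \<inter> fiber t' = {}" using fiber_disjoint[OF eps_bar(1) t(1)] by blast
        moreover from this have "cm_mult Y (eps (fiber t')) (eps ?F) = 0" "cm_mult Y (eps ?F) (eps (fiber t')) = 0"
          using finY by (simp_all add: cm_mult_eps_eps Int_commute) (simp_all add: eps_def fun_eq_iff)
        ultimately show ?thesis
          by (intro zero) (simp_all only: eps_bar expand P_simps(3,4) kron_zero_right diff_0_right)
      qed
    qed
  qed
  note corner = cpis_below_generated_corner[where h = "\<lambda>M. M", OF finXY GW_Mat finW B z hA refl refl mult _ step]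
  show "restricted_central t \<in> central_idempotents (X \<times> Y) TW"
    unfolding TW_gen z_eq[symmetric] by (rule corner(2)) simp_all
  have "cpis_below (X \<times> Y) TW z = (\<lambda>M. M) ` cpis_below ?W ?B z"
    unfolding TW_gen by (rule corner(1)) simp_all
  also have "\<dots> = central_primitive_idempotents ?W ?B - {trivial_idempotent_A ?W}"
    unfolding z_def cpis_below_complement[OF finW B e] by simp
  also have "\<dots> = idempotent_of ?W ?B ` Irr_nontrivial_A ?W ?U"
    unfolding idempotents_of_Irr_nontrivial_A[OF Usch] ..
  also have "\<dots> = {e_bar X S Y T y\<^sub>0 t \<phi> | \<phi>. \<phi> \<in> Irr_nontrivial_A (Ft X y\<^sub>0 t) ?U}"
    unfolding e_bar_def Ft_def by blast
  finally show "cpis_below (X \<times> Y) TW (restricted_central t) =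
      {e_bar X S Y T y\<^sub>0 t \<phi> | \<phi>. \<phi> \<in> Irr_nontrivial_A (Ft X y\<^sub>0 t) ?U}" unfolding z_eq .
qed

end

section \<open>Quasi-thin schemes\<close>

lemma valency_partD: "t \<in> valency_part Y T i \<Longrightarrow> t \<in> T \<and> valency Y t = i"
  by (simp add: valency_part_def)

lemma quasi_thin_cases:
  assumes "quasi_thin Y T" "t \<in> T"
  shows "t \<in> valency_part Y T 1 \<or> t \<in> valency_part Y T 2"
  using assms unfolding quasi_thin_def by blast

lemma valency_part_converse:
  "scheme Y T \<Longrightarrow> t \<in> valency_part Y T i \<Longrightarrow> t\<inverse> \<in> valency_part Y T i"
  by (simp add: valency_part_def scheme_converse valency_converse)

lemma valency_one_unique:
  assumes T: "scheme Y T" and t: "t \<in> valency_part Y T 1" and "(x, a) \<in> t" "(x, b) \<in> t"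
  shows "a = b"
proof -
  have "x \<in> Y" using scheme_mem[OF T _ assms(3)] valency_partD[OF t] by blast
  then have "card (t `` {x}) = 1" using valency_eq[OF T] valency_partD[OF t] by metis
  then obtain c where "t `` {x} = {c}" by (rule card_1_singletonE)
  then show ?thesis using assms(3,4) by (metis Image_singleton_iff singletonD)
qed

lemma valency_two_pair:
  assumes T: "scheme Y T" and t: "t \<in> valency_part Y T 2" and a: "(x, a) \<in> t"
  obtains b where "b \<noteq> a" "t `` {x} = {a, b}"
proof -
  have "x \<in> Y" using scheme_mem[OF T _ a] valency_partD[OF t] by blast
  then have "card (t `` {x}) = 2" using valency_eq[OF T] valency_partD[OF t] by metis
  then obtain c d where cd: "t `` {x} = {c, d}" "c \<noteq> d" by (meson card_2_iff)
  then have "a = c \<or> a = d" using a by (metis Image_singleton_iff insertE singletonD)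
  then show thesis using cd that[of c] that[of d] by auto
qed

text \<open>The number is an intersection number of \<open>t'\<close> and \<open>u\<inverse>\<close>, and \<open>(x, a)\<close>, \<open>(x, b)\<close> lie in the same relation
  \<open>t\<close>.\<close>

lemma scheme_card_fiber:
  assumes T: "scheme Y T" and t: "t \<in> T" "t' \<in> T" "u \<in> T" and ab: "(x, a) \<in> t" "(x, b) \<in> t"
  shows "card {z. (x, z) \<in> t' \<and> (a, z) \<in> u} = card {z. (x, z) \<in> t' \<and> (b, z) \<in> u}"
  using scheme_card_const[OF T t(2) scheme_converse[OF T t(3)] t(1) ab] by simp

lemma fiber_relation_transfer:
  assumes T: "scheme Y T" and t: "t \<in> T" "t' \<in> T" "u \<in> T" and ab: "(x, a) \<in> t" "(x, b) \<in> t"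
    and z: "(x, z) \<in> t'" "(a, z) \<in> u"
  obtains w where "(x, w) \<in> t'" "(b, w) \<in> u"
proof -
  have fin: "finite {z. (x, z) \<in> t' \<and> (a, z) \<in> u}" for a
    using scheme_image_finite[OF T t(2), of x] by (rule finite_subset[rotated]) blast
  have "z \<in> {z. (x, z) \<in> t' \<and> (a, z) \<in> u}" using z by blast
  then have "card {z. (x, z) \<in> t' \<and> (a, z) \<in> u} \<noteq> 0" using fin by (metis card_0_eq empty_iff)
  then have "card {z. (x, z) \<in> t' \<and> (b, z) \<in> u} \<noteq> 0" using scheme_card_fiber[OF T t ab] by simp
  then have "{z. (x, z) \<in> t' \<and> (b, z) \<in> u} \<noteq> {}" by (metis card.empty)
  then show thesis using that by blast
qed

lemma thin_fiber_block:
  assumes T: "scheme Y T" and t: "t \<in> T" "t' \<in> valency_part Y T 1" "u \<in> T"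
    and ab: "(x, a) \<in> t" "(x, b) \<in> t" and c: "(x, c) \<in> t'"
  shows "(a, c) \<in> u \<longleftrightarrow> (b, c) \<in> u"
proof -
  have t': "t' \<in> T" using valency_partD[OF t(2)] by blast
  have "(b, c) \<in> u" if ac: "(a, c) \<in> u" and xab: "(x, a) \<in> t" "(x, b) \<in> t" for a b
  proof -
    obtain w where "(x, w) \<in> t'" "(b, w) \<in> u"
      using fiber_relation_transfer[OF T t(1) t' t(3) xab c ac] .
    then show ?thesis using valency_one_unique[OF T t(2) c] by metis
  qed
  then show ?thesis using ab by blast
qed

text \<open>A \<open>2 \<times> 2\<close> zero-one matrix with equal row sums and equal column sums has equal diagonal entries and
  equal off-diagonal entries.  So each block between two-point fibres is constant or a perfect matching.\<close>

lemma pair_fiber_block: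
  assumes T: "scheme Y T" and t: "t \<in> T" "t' \<in> T" "u \<in> T"
    and ab: "t `` {x} = {a, b}" "a \<noteq> b" and cd: "t' `` {x} = {c, d}" "c \<noteq> d"
  shows "(a, c) \<in> u \<longleftrightarrow> (b, d) \<in> u"
proof -
  have mem: "(x, a) \<in> t" "(x, b) \<in> t" "(x, c) \<in> t'" "(x, d) \<in> t'" using ab cd by blast+
  have count: "card {z. (x, z) \<in> r \<and> (p, z) \<in> v} = of_bool ((p, e) \<in> v) + of_bool ((p, f) \<in> v)"
    if "r `` {x} = {e, f}" "e \<noteq> f" for r p v e f
  proof -
    have "{z. (x, z) \<in> r \<and> (p, z) \<in> v} =
        (if (p, e) \<in> v then {e} else {}) \<union> (if (p, f) \<in> v then {f} else {})"
      using that(1) by auto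
    then show ?thesis using that(2) by simp
  qed
  have "of_bool ((a, c) \<in> u) + of_bool ((a, d) \<in> u) = (of_bool ((b, c) \<in> u) + of_bool ((b, d) \<in> u) :: nat)"
    using scheme_card_fiber[OF T t mem(1,2)] unfolding count[OF cd] .
  moreover have "of_bool ((a, c) \<in> u) + of_bool ((b, c) \<in> u) = (of_bool ((a, d) \<in> u) + of_bool ((b, d) \<in> u) :: nat)"
    using scheme_card_fiber[OF T t(2,1) scheme_converse[OF T t(3)] mem(3,4)] unfolding count[OF ab] by simp
  ultimately show ?thesis by (auto simp: of_bool_def split: if_splits)
qed

text \<open>The block between the fibres \<open>xt\<close> and \<open>xt'\<close> is not constant for some relation; for fibres of two
  points it is then a perfect matching.\<close>

definition linked :: "('b \<times> 'b) set set \<Rightarrow> 'b \<Rightarrow> ('b \<times> 'b) set \<Rightarrow> ('b \<times> 'b) set \<Rightarrow> bool" where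
  "linked T x t t' \<longleftrightarrow> (\<exists>u\<in>T. \<exists>a c d. (x, a) \<in> t \<and> (x, c) \<in> t' \<and> (x, d) \<in> t' \<and> (a, c) \<in> u \<and> (a, d) \<notin> u)"

text \<open>The relations in \<open>t t\<^sup>*\<close> are those of the pairs with a common \<open>t\<close>-neighbour.  Such a neighbour of \<open>x\<close> may
  be the second point of \<open>xt\<close>, but constancy of intersection numbers provides the same off-diagonal relation
  there.\<close>

lemma orth_eq:
  assumes T: "scheme Y T" and t: "t \<in> valency_part Y T 2"
    and a: "(x, a) \<in> t" "(z, a) \<in> t" "z \<noteq> x"
  shows "orth Y T t \<in> T" and "(x, z) \<in> orth Y T t"
proof -
  have tT: "t \<in> T" using valency_partD[OF t] by blast
  have Y: "x \<in> Y" "z \<in> Y" using scheme_mem[OF T tT] a by blast+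
  obtain r where r: "r \<in> T" "(x, z) \<in> r" using scheme_exists[OF T Y] .
  have ti: "t\<inverse> \<in> valency_part Y T 2" by (rule valency_part_converse[OF T t])
  have r_Id: "r \<noteq> Id_on Y" using r a(3) by auto
  have iff: "u \<in> complex_product T t (t\<inverse>) \<longleftrightarrow> (\<exists>y w. (x, y) \<in> u \<and> (x, w) \<in> t \<and> (y, w) \<in> t)" if u: "u \<in> T" for u
  proof -
    obtain y where y: "(x, y) \<in> u" using scheme_image_nonempty[OF T u Y(1)] by blast
    have int: "intersection_number t (t\<inverse>) u = card {w. (x, w) \<in> t \<and> (y, w) \<in> t}" if "(x, y) \<in> u" for y
      using intersection_number_eq[OF T tT scheme_converse[OF T tT] u that] by simp
    have fin: "finite {w. (x, w) \<in> t \<and> (y, w) \<in> t}" for y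
      using scheme_image_finite[OF T tT, of x] by (rule finite_subset[rotated]) blast
    have "intersection_number t (t\<inverse>) u \<noteq> 0 \<longleftrightarrow> (\<exists>w. (x, w) \<in> t \<and> (y, w) \<in> t)" if "(x, y) \<in> u" for y
      unfolding int[OF that] using fin[of y] by (simp add: card_eq_0_iff)
    then show ?thesis unfolding complex_product_def using u y by blast
  qed
  have "complex_product T t (t\<inverse>) = {Id_on Y, r}"
  proof (intro equalityI subsetI)
    fix u assume u: "u \<in> complex_product T t (t\<inverse>)"
    then have uT: "u \<in> T" by (simp add: complex_product_def)
    then obtain y w where yw: "(x, y) \<in> u" "(x, w) \<in> t" "(y, w) \<in> t" using iff u by blast
    show "u \<in> {Id_on Y, r}"
    proof (cases "y = x")
      case True
      then have "u = Id_on Y" using scheme_unique[OF T uT scheme_Id[OF T] yw(1)] Y by blast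
      then show ?thesis by blast
    next
      case False
      \<comment> \<open>Transfer the second neighbour \<open>z\<close> of \<open>a\<close> to a neighbour of \<open>w\<close> in the same relation \<open>r\<close>.\<close>
      obtain y' where y': "(x, y') \<in> r" "(w, y') \<in> t\<inverse>"
        using fiber_relation_transfer[OF T tT r(1) scheme_converse[OF T tT] a(1) yw(2) r(2)] a(2) by blast
      have "y' \<noteq> x" using off_diagonal[OF T r(1) r_Id y'(1)] by blast
      obtain b where b: "b \<noteq> x" "t\<inverse> `` {w} = {x, b}"
        using valency_two_pair[OF T ti, of w x] yw(2) by blast
      then have "y = b" "y' = b" using yw y' False \<open>y' \<noteq> x\<close> by blast+
      then have "u = r" using scheme_unique[OF T uT r(1) yw(1)] y'(1) by blast
      then show ?thesis by blast
    qed
  next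
    fix u assume "u \<in> {Id_on Y, r}"
    then consider "u = Id_on Y" | "u = r" by blast
    then show "u \<in> complex_product T t (t\<inverse>)"
    proof cases
      case 1
      then show ?thesis using iff[OF scheme_Id[OF T]] Y a(1) by blast
    next
      case 2
      then show ?thesis using iff[OF r(1)] r(2) a by blast
    qed
  qed
  then have "orth Y T t = r"
    unfolding orth_def using r(1) r_Id by (intro the_equality) (auto simp: doubleton_eq_iff)
  then show "orth Y T t \<in> T" "(x, z) \<in> orth Y T t" using r by simp_all
qed

text \<open>If the pair is not linked, some \<open>u\<close> relates all of \<open>xt\<close> to all of \<open>xt'\<close>.  By valency at most 2, a second
  \<open>t\<close>-predecessor \<open>z\<close> of a point of \<open>xt\<close> then also is a \<open>t'\<close>-predecessor of the points of \<open>xt'\<close>.  So \<open>z\<close> is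
  the same for \<open>t\<close> and \<open>t'\<close> and for both points of \<open>xt\<close>, and it is the only point of \<open>xt\<^sup>\<bottom>\<close>.\<close>

lemma unlinked_orth:
  assumes T: "scheme Y T" and q: "quasi_thin Y T"
    and t: "t \<in> valency_part Y T 2" and t': "t' \<in> valency_part Y T 2"
    and x: "x \<in> Y" and unlinked: "\<not> linked T x t t'"
  shows "orth Y T t = orth Y T t'" and "valency Y (orth Y T t) = 1"
proof -
  have tT: "t \<in> T" "t' \<in> T" using valency_partD[OF t] valency_partD[OF t'] by blast+
  have ti: "t\<inverse> \<in> valency_part Y T 2" "t'\<inverse> \<in> valency_part Y T 2"
    by (rule valency_part_converse[OF T t], rule valency_part_converse[OF T t'])
  obtain a where a: "(x, a) \<in> t" using scheme_image_nonempty[OF T tT(1) x] by blast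
  obtain b where b: "b \<noteq> a" "t `` {x} = {a, b}" using valency_two_pair[OF T t a] .
  obtain c where c: "(x, c) \<in> t'" using scheme_image_nonempty[OF T tT(2) x] by blast
  obtain d where d: "d \<noteq> c" "t' `` {x} = {c, d}" using valency_two_pair[OF T t' c] .
  have mem: "(x, b) \<in> t" "(x, d) \<in> t'" using b d by blast+
  have Y: "a \<in> Y" "c \<in> Y" using scheme_mem[OF T tT(1) a] scheme_mem[OF T tT(2) c] by blast+
  obtain u where u: "u \<in> T" "(a, c) \<in> u" using scheme_exists[OF T Y] .
  have ad: "(a, d) \<in> u" using unlinked a c mem u unfolding linked_def by blast
  have d': "t' `` {x} = {d, c}" "d \<noteq> c" using d by blast+
  have bd: "(b, d) \<in> u"
    using pair_fiber_block[OF T tT u(1) b(2) b(1)[symmetric] d(2) d(1)[symmetric]] u(2) by blast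
  have bc: "(b, c) \<in> u"
    using pair_fiber_block[OF T tT u(1) b(2) b(1)[symmetric] d'] ad by blast
  have u2: "u `` {p} = {c, d}" if p: "p \<in> {a, b}" for p
  proof -
    have sub: "{c, d} \<subseteq> u `` {p}" using p u ad bd bc by blast
    have pY: "p \<in> Y" using p scheme_mem[OF T u(1)] u(2) bd by blast
    have "card {c, d} = 2" using d by simp
    moreover have "card (u `` {p}) = valency Y u" using valency_eq[OF T u(1) pY] by simp
    moreover have "valency Y u \<le> 2" using quasi_thin_cases[OF q u(1)] by (auto simp: valency_part_def)
    ultimately show ?thesis
      using card_subset_eq[OF scheme_image_finite[OF T u(1)] sub] card_mono[OF scheme_image_finite[OF T u(1)] sub]
      by simp
  qed
  \<comment> \<open>Count the \<open>t'\<close>-neighbours of \<open>x\<close> and of \<open>z\<close> to which \<open>p\<close> is related by \<open>u\<close>: from \<open>x\<close> there are two.\<close>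
  have nbr: "(z, c) \<in> t'" if p: "p \<in> {a, b}" and z: "(z, p) \<in> t" for p z
  proof -
    have xp: "(x, p) \<in> t" using p a mem by blast
    have "card {w. (x, w) \<in> t' \<and> (w, p) \<in> u\<inverse>} = card {w. (z, w) \<in> t' \<and> (w, p) \<in> u\<inverse>}"
      by (rule scheme_card_const[OF T tT(2) scheme_converse[OF T u(1)] tT(1) xp z])
    moreover have "{w. (x, w) \<in> t' \<and> (w, p) \<in> u\<inverse>} = {c, d}" using d(2) u2[OF p] by blast
    ultimately have two: "card {w. (z, w) \<in> t' \<and> (w, p) \<in> u\<inverse>} = card {c, d}" by simp
    have "{w. (z, w) \<in> t' \<and> (w, p) \<in> u\<inverse>} \<subseteq> {c, d}" using u2[OF p] by blast
    then have "{w. (z, w) \<in> t' \<and> (w, p) \<in> u\<inverse>} = {c, d}" using two by (intro card_subset_eq) simp_all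
    then show ?thesis by blast
  qed
  have "(a, x) \<in> t\<inverse>" using a by blast
  then obtain z where z: "z \<noteq> x" "t\<inverse> `` {a} = {x, z}" by (rule valency_two_pair[OF T ti(1)])
  have za: "(z, a) \<in> t" using z by blast
  have zc: "(z, c) \<in> t'" by (rule nbr[OF _ za]) blast
  have only: "z' = z" if "p \<in> {a, b}" "(z', p) \<in> t" "z' \<noteq> x" for p z'
  proof -
    have "(z', c) \<in> t'" by (rule nbr[OF that(1,2)])
    moreover have "(c, x) \<in> t'\<inverse>" using c by blast
    then obtain e where e: "e \<noteq> x" "t'\<inverse> `` {c} = {x, e}" by (rule valency_two_pair[OF T ti(2)])
    ultimately show ?thesis using zc z(1) that(3) by blast
  qed
  let ?r = "orth Y T t"
  note r = orth_eq[OF T t a za z(1)] and r' = orth_eq[OF T t' c zc z(1)]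
  show "?r = orth Y T t'" by (rule scheme_unique[OF T r(1) r'(1) r(2) r'(2)])
  have r_Id: "?r \<noteq> Id_on Y" using r(2) z(1) by auto
  have "?r `` {x} = {z}"
  proof (intro equalityI subsetI)
    fix z' assume "z' \<in> ?r `` {x}"
    then have z': "(x, z') \<in> ?r" by blast
    obtain w where w: "(x, w) \<in> t" "(z', w) \<in> t"
      using fiber_relation_transfer[OF T r(1) tT(1) tT(1) r(2) z' a za] .
    have "w \<in> {a, b}" using w(1) b(2) by blast
    moreover have "z' \<noteq> x" using off_diagonal[OF T r(1) r_Id z'] by blast
    ultimately show "z' \<in> {z}" using only w(2) by blast
  qed (use r(2) in blast)
  then show "valency Y ?r = 1" using valency_eq[OF T r(1) x] by simp
qed

text \<open>An unlinked pair has a common \<open>t\<^sup>\<bottom>\<close>, of valency 1.  If \<open>T\<^sup>\<bottom>\<close> consists of relations of valency 2, no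
  such pair exists; otherwise a third relation with a different \<open>t\<^sup>\<bottom>\<close> is linked to both.\<close>

lemma linked_connected:
  assumes T: "scheme Y T" and q: "quasi_thin Y T" and x: "x \<in> Y"
    and cond: "orth_set Y T \<noteq> {} \<and> orth_set Y T \<subseteq> valency_part Y T 2 \<or> card (orth_set Y T) \<ge> 2"
    and t: "t \<in> valency_part Y T 2" and t': "t' \<in> valency_part Y T 2"
  shows "(t, t') \<in> {(t, t'). t \<in> valency_part Y T 2 \<and> t' \<in> valency_part Y T 2 \<and> linked T x t t'}\<^sup>*"
    (is "_ \<in> ?R\<^sup>*")
proof (cases "linked T x t t'")
  case True
  then show ?thesis using t t' by blast
next
  case False
  note unl = unlinked_orth[OF T q t t' x False]
  have orth_mem: "orth Y T t \<in> orth_set Y T" using t by (simp add: orth_set_def)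
  have "\<not> orth_set Y T \<subseteq> valency_part Y T 2"
  proof
    assume "orth_set Y T \<subseteq> valency_part Y T 2"
    then have "valency Y (orth Y T t) = 2" using orth_mem valency_partD by blast
    then show False using unl(2) by simp
  qed
  then have "card (orth_set Y T) \<ge> 2" using cond by blast
  then have "orth_set Y T \<noteq> {orth Y T t}" by auto
  then obtain t'' where t'': "t'' \<in> valency_part Y T 2" "orth Y T t'' \<noteq> orth Y T t"
    using orth_mem unfolding orth_set_def by blast
  have "linked T x t t''" using unlinked_orth(1)[OF T q t t''(1) x] t''(2) by metis
  moreover have "linked T x t'' t'" using unlinked_orth(1)[OF T q t''(1) t' x] t''(2) unl(1) by metis
  ultimately have "(t, t'') \<in> ?R" "(t'', t') \<in> ?R" using t t' t''(1) by blast+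
  then show ?thesis by (meson r_into_rtrancl rtrancl_trans)
qed

text \<open>The equivalence relation on \<open>Y\<close> whose classes are the orbits of the thin radical of \<open>T\<close>.\<close>

definition thin_eq :: "'b set \<Rightarrow> ('b \<times> 'b) set set \<Rightarrow> ('b \<times> 'b) set" where
  "thin_eq Y T = \<Union>(valency_part Y T 1)"

lemma thin_eqI: "u \<in> valency_part Y T 1 \<Longrightarrow> (a, b) \<in> u \<Longrightarrow> (a, b) \<in> thin_eq Y T"
  by (auto simp: thin_eq_def)

lemma thin_eqE:
  assumes "(a, b) \<in> thin_eq Y T"
  obtains u where "u \<in> valency_part Y T 1" "(a, b) \<in> u"
  using assms by (auto simp: thin_eq_def)

lemma thin_eq_carrier:
  assumes T: "scheme Y T" and E: "(a, b) \<in> thin_eq Y T"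
  shows "a \<in> Y \<and> b \<in> Y"
proof -
  obtain u where u: "u \<in> valency_part Y T 1" "(a, b) \<in> u" using thin_eqE[OF E] .
  then show ?thesis using scheme_mem[OF T _ u(2)] valency_partD[OF u(1)] by blast
qed

lemma thin_eq_refl:
  assumes T: "scheme Y T" and "y \<in> Y"
  shows "(y, y) \<in> thin_eq Y T"
proof (rule thin_eqI)
  have "Id_on Y `` {y} = {y}" using assms(2) by auto
  then have "valency Y (Id_on Y) = 1" using valency_eq[OF T scheme_Id[OF T] assms(2)] by simp
  then show "Id_on Y \<in> valency_part Y T 1" using scheme_Id[OF T] by (simp add: valency_part_def)
qed (use assms(2) in blast)

lemma thin_eq_sym:
  assumes T: "scheme Y T" and E: "(a, b) \<in> thin_eq Y T"
  shows "(b, a) \<in> thin_eq Y T"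
proof -
  obtain u where u: "u \<in> valency_part Y T 1" "(a, b) \<in> u" using thin_eqE[OF E] .
  then have "(b, a) \<in> u\<inverse>" by blast
  then show ?thesis by (rule thin_eqI[OF valency_part_converse[OF T u(1)]])
qed

text \<open>If \<open>(a, b) \<in> u\<close> and \<open>(b, c) \<in> v\<close> with valencies 1, every \<open>c'\<close> in the same relation to \<open>a\<close> as \<open>c\<close> is
  reached through the only \<open>u\<close>-neighbour \<open>b\<close>, hence equals \<open>c\<close>.\<close>

lemma thin_eq_trans:
  assumes T: "scheme Y T" and ab: "(a, b) \<in> thin_eq Y T" and bc: "(b, c) \<in> thin_eq Y T"
  shows "(a, c) \<in> thin_eq Y T"
proof -
  obtain u where u: "u \<in> valency_part Y T 1" "(a, b) \<in> u" using thin_eqE[OF ab] .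
  obtain v where v: "v \<in> valency_part Y T 1" "(b, c) \<in> v" using thin_eqE[OF bc] .
  have uT: "u \<in> T" and vT: "v \<in> T" using valency_partD u v by blast+
  have Y: "a \<in> Y" "c \<in> Y" using thin_eq_carrier[OF T ab] thin_eq_carrier[OF T bc] by blast+
  obtain w where w: "w \<in> T" "(a, c) \<in> w" using scheme_exists[OF T Y] .
  have "w `` {a} = {c}"
  proof (intro equalityI subsetI)
    fix c' assume "c' \<in> w `` {a}"
    then have c': "(a, c') \<in> w" by blast
    obtain b' where b': "(a, b') \<in> u" "(c', b') \<in> v\<inverse>"
      using fiber_relation_transfer[OF T w(1) uT scheme_converse[OF T vT] w(2) c' u(2)] v(2) by blast
    have "b' = b" by (rule valency_one_unique[OF T u(1) b'(1) u(2)])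
    then have "(b, c') \<in> v" using b'(2) by blast
    then show "c' \<in> {c}" using valency_one_unique[OF T v(1) _ v(2)] by blast
  qed (use w(2) in blast)
  then have "valency Y w = 1" using valency_eq[OF T w(1) Y(1)] by simp
  then show ?thesis using w by (intro thin_eqI[of w]) (simp_all add: valency_part_def)
qed

lemma thin_eq_relation:
  assumes T: "scheme Y T" and "(a, b) \<in> thin_eq Y T" "t \<in> T" "(a, b) \<in> t"
  shows "t \<in> valency_part Y T 1"
proof -
  obtain u where u: "u \<in> valency_part Y T 1" "(a, b) \<in> u" using thin_eqE[OF assms(2)] .
  then have "t = u" using scheme_unique[OF T assms(3) _ assms(4) u(2)] valency_partD[OF u(1)] by blast
  then show ?thesis using u by simp
qed

locale thin_orth =
  fixes Y :: "'b set" and T :: "('b \<times> 'b) set set" and h :: "('b \<times> 'b) set"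
  assumes T: "scheme Y T" and q: "quasi_thin Y T"
    and h: "orth_set Y T = {h}" "h \<in> valency_part Y T 1"
begin

abbreviation "T2 \<equiv> valency_part Y T 2"
abbreviation "E \<equiv> thin_eq Y T"
abbreviation "coset y \<equiv> \<Union>k\<in>H_set Y T. k `` {y}"

lemma hT: "h \<in> T"
  using valency_partD[OF h(2)] by blast

lemma orth_h: "t \<in> T2 \<Longrightarrow> orth Y T t = h"
  using h(1) unfolding orth_set_def by blast

lemma fiber_pair_h:
  assumes t: "t \<in> T2" and ab: "(x, a) \<in> t" "(x, b) \<in> t" "a \<noteq> b"
  shows "(a, b) \<in> h"
proof -
  have ti: "t\<inverse> \<in> T2" by (rule valency_part_converse[OF T t])
  have "(a, b) \<in> orth Y T (t\<inverse>)" by (rule orth_eq(2)[OF T ti, of a x b]) (use ab in auto)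
  then show ?thesis using orth_h[OF ti] by simp
qed

lemma h_pair:
  assumes "y \<in> Y"
  obtains y' where "y' \<noteq> y" "y' \<in> Y" "coset y = {y, y'}" "(y, y') \<in> h"
proof -
  have "T2 \<noteq> {}" using h(1) unfolding orth_set_def by blast
  then obtain t where t: "t \<in> T2" by blast
  have tT: "t \<in> T" using valency_partD[OF t] by blast
  obtain x where x: "(y, x) \<in> t\<inverse>"
    using scheme_image_nonempty[OF T scheme_converse[OF T tT] assms] by blast
  have xy: "(x, y) \<in> t" using x by blast
  obtain y' where y': "y' \<noteq> y" "t `` {x} = {y, y'}" by (rule valency_two_pair[OF T t xy])
  have yh: "(y, y') \<in> h" by (rule fiber_pair_h[OF t xy]) (use y' in blast)+
  have "h `` {y} = {y'}" using yh valency_one_unique[OF T h(2) yh] by blast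
  moreover have "Id_on Y `` {y} = {y}" using assms by auto
  ultimately have "coset y = {y, y'}" unfolding H_set_def h(1) by auto
  moreover have "y' \<in> Y" using scheme_mem[OF T hT yh] by blast
  ultimately show thesis using that y'(1) yh by blast
qed

lemma coset_E: "y \<in> Y \<Longrightarrow> p \<in> coset y \<Longrightarrow> (y, p) \<in> E"
  using h_pair thin_eqI[OF h(2)] thin_eq_refl[OF T] by (metis insertE singletonD)

lemma coset_self: "y \<in> Y \<Longrightarrow> y \<in> coset y"
  using h_pair by (metis insertI1)

text \<open>The second point of \<open>xt\<close> is the \<open>h\<close>-neighbour of the first: both have \<open>x\<close> as a common neighbour
  through \<open>t\<inverse>\<close>, and \<open>h\<close> is the only element of \<open>T\<^sup>\<bottom>\<close>.\<close>

lemma fiber_coset: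
  assumes t: "t \<in> T2" and a: "(x, a) \<in> t"
  shows "t `` {x} = coset a"
proof -
  have aY: "a \<in> Y" using scheme_mem[OF T _ a] valency_partD[OF t] by blast
  obtain b where b: "b \<noteq> a" "t `` {x} = {a, b}" by (rule valency_two_pair[OF T t a])
  have ab: "(a, b) \<in> h" by (rule fiber_pair_h[OF t a]) (use b in blast)+
  obtain a' where a': "a' \<noteq> a" "a' \<in> Y" "coset a = {a, a'}" "(a, a') \<in> h" by (rule h_pair[OF aY])
  have "b = a'" by (rule valency_one_unique[OF T h(2) ab a'(4)])
  then show ?thesis using b a' by simp
qed

text \<open>The neighbours of a point through a relation of valency 2 form a coset, that is a whole fibre; so
  only relations of valency 1 can split a fibre.\<close>

lemma linked_iff:
  assumes t: "t \<in> T2" "t' \<in> T2" and a: "(x, a) \<in> t" and c: "(x, c) \<in> t'"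
  shows "linked T x t t' \<longleftrightarrow> (a, c) \<in> E"
proof
  have Y: "a \<in> Y" "c \<in> Y" using scheme_mem[OF T _ a] scheme_mem[OF T _ c] valency_partD[OF t(1)] valency_partD[OF t(2)] by blast+
  have fib: "(a, a') \<in> E" "(c, c') \<in> E" if "(x, a') \<in> t" "(x, c') \<in> t'" for a' c'
    using coset_E[OF Y(1), of a'] coset_E[OF Y(2), of c'] fiber_coset[OF t(1) a] fiber_coset[OF t(2) c] that by blast+
  show "(a, c) \<in> E" if link: "linked T x t t'"
  proof -
    obtain u a' c' d' where u: "u \<in> T" and l: "(x, a') \<in> t" "(x, c') \<in> t'" "(x, d') \<in> t'" "(a', c') \<in> u" "(a', d') \<notin> u"
      using link unfolding linked_def by blast
    have "u \<in> valency_part Y T 1"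
    proof (rule ccontr)
      assume "u \<notin> valency_part Y T 1"
      then have "u \<in> T2" using quasi_thin_cases[OF q u] by blast
      then have "u `` {a'} = coset c'" by (rule fiber_coset[OF _ l(4)])
      also have "\<dots> = t' `` {x}" using fiber_coset[OF t(2) l(2)] by simp
      finally show False using l(3,5) by blast
    qed
    then have "(a', c') \<in> E" using l(4) by (rule thin_eqI)
    then show ?thesis using fib[OF l(1,2)] thin_eq_trans[OF T] thin_eq_sym[OF T] by metis
  qed
  show "linked T x t t'" if E: "(a, c) \<in> E"
  proof -
    obtain u where u: "u \<in> valency_part Y T 1" "(a, c) \<in> u" using thin_eqE[OF E] .
    obtain d where d: "d \<noteq> c" "t' `` {x} = {c, d}" by (rule valency_two_pair[OF T t(2) c])
    have "(a, d) \<notin> u" using valency_one_unique[OF T u(1) u(2)] d(1) by metis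
    moreover have "(x, d) \<in> t'" using d by blast
    ultimately show ?thesis unfolding linked_def using u a c valency_partD[OF u(1)] by metis
  qed
qed

text \<open>The block \<open>\<Delta> \<times> \<Gamma>\<close> of two \<open>H\<close>-cosets is a single relation exactly if it lies in a relation of valency
  2, whose neighbourhoods are whole cosets in both directions.\<close>

lemma coset_block:
  assumes Y: "a \<in> Y" "c \<in> Y"
  shows "coset a \<times> coset c \<notin> T_H Y T \<longleftrightarrow> (a, c) \<in> E"
proof
  obtain u where u: "u \<in> T" "(a, c) \<in> u" using scheme_exists[OF T Y] .
  show "(a, c) \<in> E" if notin: "coset a \<times> coset c \<notin> T_H Y T"
  proof (rule ccontr)
    assume nE: "(a, c) \<notin> E"
    have T2I: "v \<in> T2" if "v \<in> T" "(p, r) \<in> v" "p \<in> coset a" "r \<in> coset c" for v p r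
    proof (rule ccontr)
      assume "v \<notin> T2"
      then have "(p, r) \<in> E" using quasi_thin_cases[OF q that(1)] thin_eqI that(2) by metis
      then show False
        using nE coset_E[OF Y(1) that(3)] coset_E[OF Y(2) that(4)] thin_eq_trans[OF T] thin_eq_sym[OF T] by metis
    qed
    have uT2: "u \<in> T2" using T2I[OF u] coset_self Y by blast
    have "(p, r) \<in> u" if "p \<in> coset a" "r \<in> coset c" for p r
    proof -
      have "(a, r) \<in> u" using fiber_coset[OF uT2 u(2)] that(2) by blast
      then have "(r, a) \<in> u\<inverse>" by blast
      then have "u\<inverse> `` {r} = coset a" by (rule fiber_coset[OF valency_part_converse[OF T uT2]])
      then show ?thesis using that(1) by blast
    qed
    then have block: "coset a \<times> coset c = u \<inter> coset a \<times> coset c" by blast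
    have "(a, c) \<in> coset a \<times> coset c" by (intro SigmaI coset_self Y)
    then have ne: "coset a \<times> coset c \<notin> {{}}" by (metis empty_iff singletonD)
    have cosets: "coset a \<in> H_cosets Y T" "coset c \<in> H_cosets Y T"
      unfolding H_cosets_def using Y by (blast intro: imageI)+
    have "coset a \<times> coset c \<in> T_H Y T"
      unfolding T_H_def
      by (intro DiffI CollectI exI[of _ u] exI[of _ "coset a"] exI[of _ "coset c"] conjI block u(1) cosets ne)
    then show False using notin by blast
  qed
  show "coset a \<times> coset c \<notin> T_H Y T" if E: "(a, c) \<in> E"
  proof
    assume "coset a \<times> coset c \<in> T_H Y T"
    then obtain v \<Delta> \<Gamma> where v: "v \<in> T" "coset a \<times> coset c = v \<inter> \<Delta> \<times> \<Gamma>" unfolding T_H_def by blast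
    have "(a, c) \<in> coset a \<times> coset c" by (intro SigmaI coset_self Y)
    then have ac: "(a, c) \<in> v" unfolding v(2) by (rule IntD1)
    have v1: "v \<in> valency_part Y T 1" by (rule thin_eq_relation[OF T E v(1) ac])
    obtain c' where c': "c' \<noteq> c" "c' \<in> Y" "coset c = {c, c'}" "(c, c') \<in> h" by (rule h_pair[OF Y(2)])
    have "c' \<in> coset c" unfolding c'(3) by simp
    then have "(a, c') \<in> coset a \<times> coset c" by (intro SigmaI coset_self Y(1))
    then have "(a, c') \<in> v" unfolding v(2) by (rule IntD1)
    then show False using valency_one_unique[OF T v1 ac] c'(1) by metis
  qed
qed

text \<open>The class of \<open>I\<close> that contains the coset of \<open>e\<close>.\<close>

definition "cls e = {coset c | c. c \<in> Y \<and> (e, c) \<in> E}"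

lemma Union_cls: "e \<in> Y \<Longrightarrow> \<Union>(cls e) = E `` {e}"
proof (intro equalityI subsetI)
  fix y assume e: "e \<in> Y" and "y \<in> \<Union>(cls e)"
  then obtain c where c: "c \<in> Y" "(e, c) \<in> E" "y \<in> coset c" unfolding cls_def by blast
  then have "(e, y) \<in> E" using coset_E[OF c(1,3)] thin_eq_trans[OF T] by metis
  then show "y \<in> E `` {e}" by blast
next
  fix y assume "e \<in> Y" and "y \<in> E `` {e}"
  then have "(e, y) \<in> E" "y \<in> Y" using thin_eq_carrier[OF T] by blast+
  then show "y \<in> \<Union>(cls e)" using coset_self unfolding cls_def by blast
qed

lemma I_classes_eq: "I_classes Y T = cls ` Y"
proof -
  let ?R = "{(\<Delta>, \<Gamma>). \<Delta> \<in> H_cosets Y T \<and> \<Gamma> \<in> H_cosets Y T \<and> \<Delta> \<times> \<Gamma> \<notin> T_H Y T}"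
  have "?R `` {coset e} = cls e" if e: "e \<in> Y" for e
  proof (intro equalityI subsetI)
    fix \<Gamma> assume "\<Gamma> \<in> ?R `` {coset e}"
    then have "\<Gamma> \<in> H_cosets Y T" "coset e \<times> \<Gamma> \<notin> T_H Y T" by blast+
    then obtain c where c: "c \<in> Y" "\<Gamma> = coset c" unfolding H_cosets_def by blast
    then have "(e, c) \<in> E" using coset_block[OF e c(1)] \<open>coset e \<times> \<Gamma> \<notin> T_H Y T\<close> by simp
    then show "\<Gamma> \<in> cls e" unfolding cls_def using c by blast
  next
    fix \<Gamma> assume "\<Gamma> \<in> cls e"
    then obtain c where c: "c \<in> Y" "\<Gamma> = coset c" "(e, c) \<in> E" unfolding cls_def by blast
    then have "coset e \<times> \<Gamma> \<notin> T_H Y T" using coset_block[OF e c(1)] by simp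
    moreover have "coset e \<in> H_cosets Y T" "\<Gamma> \<in> H_cosets Y T" using e c unfolding H_cosets_def by blast+
    ultimately show "\<Gamma> \<in> ?R `` {coset e}" by blast
  qed
  then have "(\<lambda>e. ?R `` {coset e}) ` Y = cls ` Y" by (rule image_cong[OF refl])
  moreover have "H_cosets Y T // ?R = (\<lambda>e. ?R `` {coset e}) ` Y"
    unfolding quotient_def H_cosets_def by blast
  ultimately show ?thesis unfolding I_classes_def by simp
qed

lemma cls_eq: "e \<in> Y \<Longrightarrow> (e, f) \<in> E \<Longrightarrow> cls e = cls f"
  unfolding cls_def using thin_eq_trans[OF T] thin_eq_sym[OF T] by blast

lemma I_classes_off_eq:
  assumes x: "x \<in> Y"
  shows "I_classes_off Y T x = {cls e | e. e \<in> Y \<and> (x, e) \<notin> E}"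
proof -
  have the: "(THE i. i \<in> I_classes Y T \<and> x \<in> \<Union>i) = cls x"
  proof (rule the_equality)
    show "cls x \<in> I_classes Y T \<and> x \<in> \<Union>(cls x)"
      unfolding I_classes_eq Union_cls[OF x] using x thin_eq_refl[OF T x] by blast
    fix i assume i: "i \<in> I_classes Y T \<and> x \<in> \<Union>i"
    then obtain e where e: "e \<in> Y" "i = cls e" unfolding I_classes_eq by blast
    then have "(e, x) \<in> E" using i Union_cls[OF e(1)] by blast
    then show "i = cls x" using cls_eq[OF e(1)] e(2) by simp
  qed
  have "cls e = cls x \<longleftrightarrow> (x, e) \<in> E" if e: "e \<in> Y" for e
  proof
    assume "cls e = cls x"
    then have "E `` {e} = E `` {x}" using Union_cls[OF e] Union_cls[OF x] by simp
    then show "(x, e) \<in> E" using thin_eq_refl[OF T e] by blast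
  next
    assume "(x, e) \<in> E"
    then show "cls e = cls x" using cls_eq[OF x] by simp
  qed
  then show ?thesis unfolding I_classes_off_def the unfolding I_classes_eq by blast
qed

lemma U_class_iff:
  assumes e: "e \<in> Y" and t: "t \<in> T2" and a: "(x, a) \<in> t"
  shows "t \<in> U_class Y T x (cls e) \<longleftrightarrow> (e, a) \<in> E"
proof -
  have aY: "a \<in> Y" using scheme_mem[OF T _ a] valency_partD[OF t] by blast
  have "coset a \<subseteq> E `` {e} \<longleftrightarrow> (e, a) \<in> E"
    using coset_self[OF aY] coset_E[OF aY] thin_eq_trans[OF T] by blast
  then show ?thesis unfolding U_class_def Union_cls[OF e] fiber_coset[OF t a, symmetric] using t by blast
qed

text \<open>The sets \<open>U\<^sub>i\<close> are the connected components of the linking relation, because \<open>Y\<^sub>i\<close> is a class of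
  \<open>thin_eq\<close> and linking is \<open>thin_eq\<close> between points of the fibres.\<close>

lemma U_class_components:
  assumes x: "x \<in> Y" and i: "i \<in> I_classes_off Y T x"
  shows "U_class Y T x i \<subseteq> T2" and "U_class Y T x i \<noteq> {}"
    and "\<lbrakk>t \<in> T2; t' \<in> T2; t \<in> U_class Y T x i\<rbrakk> \<Longrightarrow> linked T x t t' \<longleftrightarrow> t' \<in> U_class Y T x i"
    and "\<lbrakk>t \<in> T2; t' \<in> T2; t' \<in> U_class Y T x i\<rbrakk> \<Longrightarrow> linked T x t t' \<longleftrightarrow> t \<in> U_class Y T x i"
proof -
  obtain e where e: "e \<in> Y" "(x, e) \<notin> E" "i = cls e" using i unfolding I_classes_off_eq[OF x] by blast
  show "U_class Y T x i \<subseteq> T2" by (auto simp: U_class_def)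
  obtain t where t: "t \<in> T" "(x, e) \<in> t" using scheme_exists[OF T x e(1)] .
  have "t \<in> T2" using quasi_thin_cases[OF q t(1)] thin_eqI t(2) e(2) by metis
  then have "t \<in> U_class Y T x i" unfolding e(3) using U_class_iff[OF e(1) _ t(2)] thin_eq_refl[OF T e(1)] by blast
  then show "U_class Y T x i \<noteq> {}" by blast
  have pt: "\<exists>a. (x, a) \<in> t" if "t \<in> T2" for t
    using scheme_image_nonempty[OF T _ x, of t] valency_partD[OF that] by blast
  show "linked T x t t' \<longleftrightarrow> t' \<in> U_class Y T x i" if t: "t \<in> T2" "t' \<in> T2" "t \<in> U_class Y T x i" for t t'
  proof -
    obtain a c where ac: "(x, a) \<in> t" "(x, c) \<in> t'" using pt t by blast
    have "(e, a) \<in> E" using U_class_iff[OF e(1) t(1) ac(1)] t(3) e(3) by simp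
    then have "(a, c) \<in> E \<longleftrightarrow> (e, c) \<in> E" using thin_eq_trans[OF T] thin_eq_sym[OF T] by metis
    then show ?thesis using linked_iff[OF t(1,2) ac] U_class_iff[OF e(1) t(2) ac(2)] e(3) by simp
  qed
  show "linked T x t t' \<longleftrightarrow> t \<in> U_class Y T x i" if t: "t \<in> T2" "t' \<in> T2" "t' \<in> U_class Y T x i" for t t'
  proof -
    obtain a c where ac: "(x, a) \<in> t" "(x, c) \<in> t'" using pt t by blast
    have "(e, c) \<in> E" using U_class_iff[OF e(1) t(2) ac(2)] t(3) e(3) by simp
    then have "(a, c) \<in> E \<longleftrightarrow> (e, a) \<in> E" using thin_eq_trans[OF T] thin_eq_sym[OF T] by metis
    then show ?thesis using linked_iff[OF t(1,2) ac] U_class_iff[OF e(1) t(1) ac(1)] e(3) by simp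
  qed
qed

lemma U_class_cover:
  assumes x: "x \<in> Y" and t: "t \<in> T2"
  obtains i where "i \<in> I_classes_off Y T x" "t \<in> U_class Y T x i"
proof -
  have tT: "t \<in> T" using valency_partD[OF t] by blast
  obtain a where a: "(x, a) \<in> t" using scheme_image_nonempty[OF T tT x] by blast
  have aY: "a \<in> Y" using scheme_mem[OF T tT a] by blast
  have "(x, a) \<notin> E"
  proof
    assume "(x, a) \<in> E"
    then have "t \<in> valency_part Y T 1" by (rule thin_eq_relation[OF T _ tT a])
    then show False using valency_partD[OF t] valency_partD by fastforce
  qed
  then have "cls a \<in> I_classes_off Y T x" unfolding I_classes_off_eq[OF x] using aY by blast
  moreover have "t \<in> U_class Y T x (cls a)" using U_class_iff[OF aY t a] thin_eq_refl[OF T aY] by blast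
  ultimately show thesis using that by blast
qed

end

section \<open>Alternating vectors on two-point fibres\<close>

context pointed_wreath
begin

abbreviation "T2 \<equiv> valency_part Y T 2"

abbreviation "E \<equiv> trivial_idempotent_A X"

lemma E_facts: "E \<in> Mat X" "cm_mult X E E = E" "cm_mult X E (Jm X X) = Jm X X" "cm_mult X (Jm X X) E = Jm X X"
    "cm_mult X E (eps X) = E" "cm_mult X (eps X) E = E"
proof -
  show E: "E \<in> Mat X" unfolding trivial_idempotent_A_def by (intro Mat_scale Jm_in_Mat order_refl)
  show J: "cm_mult X E (Jm X X) = Jm X X" "cm_mult X (Jm X X) E = Jm X X"
    by (rule trivial_idempotent_A_Jm[OF finX X_ne])+
  show "cm_mult X E E = E"
    using J(1) unfolding trivial_idempotent_A_def[of X] cm_mult_scale_right by metis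
  show "cm_mult X E (eps X) = E" "cm_mult X (eps X) E = E"
    using cm_mult_one_left[OF finX E] cm_mult_one_right[OF finX E] by blast+
qed

lemma E_sigma: "s \<in> S \<Longrightarrow> cm_mult X E (sigma s) = cm_mult X (sigma s) E"
  by (rule central_idempotentsD(2)[OF cpiD(1)[OF trivial_idempotent_A_primitive(1)[OF S]]
        sigma_in_adjacency_algebra[OF S]])

lemma TW_E_eps: "kron E (eps Y) \<in> TW"
proof -
  obtain c where c: "Jm X X = (\<Sum>s\<in>S. cm_scale (c s) (sigma s))"
    using Jm_in_adjacency_algebra[OF S] unfolding adjacency_algebra_def by blast
  show ?thesis unfolding trivial_idempotent_A_def c kron_scale_left kron_sum_left
    by (intro subalgebra_scale[OF TW_subalgebra] subalgebra_sum[OF TW_subalgebra] TW_tilde)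
qed

lemma TW_E_sigma:
  assumes u: "u \<in> T"
  shows "kron E (sigma u) \<in> TW"
proof (cases "u = Id_on Y")
  case True
  then show ?thesis using TW_E_eps unfolding eps_eq_sigma by simp
next
  case False
  then show ?thesis unfolding trivial_idempotent_A_def kron_scale_left
    by (intro subalgebra_scale[OF TW_subalgebra] TW_bar u)
qed

lemma TW_E_left_eps:
  assumes "kron E M \<in> TW" "t \<in> T"
  shows "kron E (cm_mult Y (eps (fiber t)) M) \<in> TW" "kron E (cm_mult Y M (eps (fiber t))) \<in> TW"
proof -
  have "cm_mult (X \<times> Y) (kron (eps X) (eps (fiber t))) (kron E M) = kron E (cm_mult Y (eps (fiber t)) M)"
    "cm_mult (X \<times> Y) (kron E M) (kron (eps X) (eps (fiber t))) = kron E (cm_mult Y M (eps (fiber t)))"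
    by (simp_all only: cm_mult_kron E_facts)
  then show "kron E (cm_mult Y (eps (fiber t)) M) \<in> TW" "kron E (cm_mult Y M (eps (fiber t))) \<in> TW"
    using subalgebra_mult[OF TW_subalgebra TW_eps[OF assms(2)] assms(1)]
      subalgebra_mult[OF TW_subalgebra assms(1) TW_eps[OF assms(2)]] by simp_all
qed

text \<open>For \<open>y\<^sub>0t = {a, b}\<close> this is the orthogonal projection onto the alternating vector \<open>\<delta>\<^sub>a - \<delta>\<^sub>b\<close>.\<close>

definition alt :: "('b \<times> 'b) set \<Rightarrow> 'b cmat" where
  "alt t = cm_scale (1 / 2) (eps (fiber t) - eps_overline (fiber t))"

lemma e_eta_eq: "e_eta X y\<^sub>0 U = kron E (\<Sum>t\<in>U. alt t)"
  unfolding e_eta_def kron_sum_right alt_def trivial_idempotent_A_def kron_scale_left kron_scale_right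
  by simp

lemma T2D: "t \<in> T2 \<Longrightarrow> t \<in> T"
  using valency_partD by blast

lemma T2_not_Id: "t \<in> T2 \<Longrightarrow> t \<noteq> Id_on Y"
  using valency_eq[OF T scheme_Id[OF T] y0] fiber_Id valency_partD by fastforce

lemma alt_rank_one:
  assumes "fiber t = {a, b}" "a \<noteq> b"
  shows "alt t y w = 1 / 2 * ((of_bool (y = a) - of_bool (y = b)) * (of_bool (w = a) - of_bool (w = b)))"
  unfolding alt_def assms(1) eps_overline_doubleton[OF assms(2)]
  using assms(2)
  by (cases "y = a"; cases "y = b"; cases "w = a"; cases "w = b")
    (simp_all add: cm_scale_def eps_def Jm_def)

lemma T2_pair:
  assumes "t \<in> T2" "y \<in> fiber t"
  obtains b where "b \<noteq> y" "fiber t = {y, b}"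
  using valency_two_pair[OF T assms(1), of y\<^sub>0 y] assms(2) by blast

lemma T2_pair':
  assumes "t \<in> T2"
  obtains a b where "a \<noteq> b" "fiber t = {a, b}" "a \<in> Y" "b \<in> Y"
proof -
  obtain a where a: "a \<in> fiber t" using fiber_ne[OF T2D[OF assms]] by blast
  then obtain b where b: "b \<noteq> a" "fiber t = {a, b}" using T2_pair[OF assms] by blast
  then show thesis using that fiber_subset[OF T2D[OF assms]] by blast
qed

lemma alt_outside:
  assumes t: "t \<in> T2" and "y \<notin> fiber t \<or> w \<notin> fiber t"
  shows "alt t y w = 0"
proof -
  obtain a b where ab: "a \<noteq> b" "fiber t = {a, b}" using T2_pair'[OF t] by blast
  show ?thesis using assms(2) ab by (auto simp: alt_rank_one[OF ab(2,1)])
qed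

lemma alt_Mat: "t \<in> T2 \<Longrightarrow> alt t \<in> Mat Y"
  using alt_outside fiber_subset[OF T2D] by (intro Mat_I) blast

lemma alt_mult_left:
  assumes t: "t \<in> T2" and y: "fiber t = {y, b}" "b \<noteq> y"
  shows "cm_mult Y (alt t) M y w = 1 / 2 * (M y w - M b w)"
proof -
  have Y: "{y, b} \<subseteq> Y" using fiber_subset[OF T2D[OF t]] y by simp
  have "cm_mult Y (alt t) M y w = (\<Sum>z\<in>{y, b}. alt t y z * M z w)"
    unfolding cm_mult_def
    by (rule sum.mono_neutral_right[OF finY Y]) (use alt_outside[OF t] y in auto)
  then show ?thesis using y by (simp add: alt_rank_one[OF y(1) y(2)[symmetric]] algebra_simps)
qed

lemma alt_mult_right:
  assumes t: "t \<in> T2" and y: "fiber t = {w, d}" "d \<noteq> w"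
  shows "cm_mult Y M (alt t) y w = 1 / 2 * (M y w - M y d)"
proof -
  have Y: "{w, d} \<subseteq> Y" using fiber_subset[OF T2D[OF t]] y by simp
  have "cm_mult Y M (alt t) y w = (\<Sum>z\<in>{w, d}. M y z * alt t z w)"
    unfolding cm_mult_def
    by (rule sum.mono_neutral_right[OF finY Y]) (use alt_outside[OF t] y in auto)
  then show ?thesis using y by (simp add: alt_rank_one[OF y(1) y(2)[symmetric]] algebra_simps)
qed

lemma altsum_mult:
  assumes U: "U \<subseteq> T2" and t: "t \<in> T" and y: "y \<in> fiber t"
  shows "cm_mult Y (\<Sum>t\<in>U. alt t) M y w = (if t \<in> U then cm_mult Y (alt t) M y w else 0)"
    and "cm_mult Y M (\<Sum>t\<in>U. alt t) w y = (if t \<in> U then cm_mult Y M (alt t) w y else 0)"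
proof -
  have finU: "finite U"
    using U scheme_finite_relations[OF T] T2D by (meson finite_subset subset_eq)
  have other: "y \<notin> fiber t'" if "t' \<in> U" "t' \<noteq> t" for t'
    using fiber_disjoint[OF T2D t that(2)] y U that(1) by blast
  have "cm_mult Y (alt t') M y w = 0" "cm_mult Y M (alt t') w y = 0" if "t' \<in> U" "t' \<noteq> t" for t'
    unfolding cm_mult_def using alt_outside[of t'] other[OF that] U that(1)
    by (auto intro!: sum.neutral)
  then have "cm_mult Y (alt t') M y w = (if t' = t then cm_mult Y (alt t) M y w else 0)"
    "cm_mult Y M (alt t') w y = (if t' = t then cm_mult Y M (alt t) w y else 0)" if "t' \<in> U" for t'
    using that by simp_all
  then have "(\<Sum>t'\<in>U. cm_mult Y (alt t') M y w) = (\<Sum>t'\<in>U. if t' = t then cm_mult Y (alt t) M y w else 0)"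
    "(\<Sum>t'\<in>U. cm_mult Y M (alt t') w y) = (\<Sum>t'\<in>U. if t' = t then cm_mult Y M (alt t) w y else 0)"
    by (simp_all cong: sum.cong)
  then show "cm_mult Y (\<Sum>t\<in>U. alt t) M y w = (if t \<in> U then cm_mult Y (alt t) M y w else 0)"
    "cm_mult Y M (\<Sum>t\<in>U. alt t) w y = (if t \<in> U then cm_mult Y M (alt t) w y else 0)"
    unfolding cm_mult_sum_left cm_mult_sum_right sum_fun_apply2 using finU by simp_all
qed

lemma altsum_Mat: "U \<subseteq> T2 \<Longrightarrow> (\<Sum>t\<in>U. alt t) \<in> Mat Y"
  using subalgebra_sum[OF subalgebra_full] alt_Mat by (metis subset_iff)

lemma point_fiber:
  assumes "y \<in> Y"
  obtains t where "t \<in> T" "y \<in> fiber t"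
  using scheme_exists[OF T y0 assms] by blast

text \<open>Between linked fibres \<open>\<sigma>\<^sub>u\<close> intertwines the alternating vectors; a constant block, or a block with a
  fibre of one point, kills them.  Since \<open>U\<close> is closed under linking, no block leads out of \<open>U\<close>.\<close>

lemma altsum_sigma:
  assumes q: "quasi_thin Y T" and U: "U \<subseteq> T2" and u: "u \<in> T"
    and closed: "\<And>t t'. t \<in> T2 \<Longrightarrow> t' \<in> T2 \<Longrightarrow> linked T y\<^sub>0 t t' \<Longrightarrow> t \<in> U \<longleftrightarrow> t' \<in> U"
  shows "cm_mult Y (\<Sum>t\<in>U. alt t) (sigma u) = cm_mult Y (sigma u) (\<Sum>t\<in>U. alt t)"
proof (intro ext)
  fix y w
  let ?f = "\<Sum>t\<in>U. alt t"
  show "cm_mult Y ?f (sigma u) y w = cm_mult Y (sigma u) ?f y w"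
  proof (cases "y \<in> Y \<and> w \<in> Y")
    case False
    then show ?thesis
      using Mat_mult[OF altsum_Mat[OF U] sigma_in_Mat[OF T u]]
        Mat_mult[OF sigma_in_Mat[OF T u] altsum_Mat[OF U]] Mat_outside by metis
  next
    case True
    obtain t where t: "t \<in> T" "y \<in> fiber t" using point_fiber True by blast
    obtain t' where t': "t' \<in> T" "w \<in> fiber t'" using point_fiber True by blast
    have yt: "(y\<^sub>0, y) \<in> t" and wt: "(y\<^sub>0, w) \<in> t'" using t t' by blast+
    have left: "cm_mult Y ?f (sigma u) y w = (if t \<in> U then cm_mult Y (alt t) (sigma u) y w else 0)"
      by (rule altsum_mult(1)[OF U t])
    have right: "cm_mult Y (sigma u) ?f y w = (if t' \<in> U then cm_mult Y (sigma u) (alt t') y w else 0)"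
      by (rule altsum_mult(2)[OF U t'])
    consider "t \<notin> T2" "t' \<notin> T2" | "t \<in> T2" "t' \<notin> T2" | "t \<notin> T2" "t' \<in> T2" | "t \<in> T2" "t' \<in> T2" by blast
    then show ?thesis
    proof cases
      case 1
      then show ?thesis unfolding left right using U by auto
    next
      case 2
      have "t' \<in> valency_part Y T 1" using quasi_thin_cases[OF q t'(1)] 2 by blast
      obtain b where b: "b \<noteq> y" "fiber t = {y, b}" using T2_pair[OF 2(1) t(2)] .
      have "(y\<^sub>0, b) \<in> t" using b by blast
      then have "(y, w) \<in> u \<longleftrightarrow> (b, w) \<in> u"
        by (rule thin_fiber_block[OF T t(1) \<open>t' \<in> valency_part Y T 1\<close> u yt _ wt])
      then have "cm_mult Y (alt t) (sigma u) y w = 0"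
        unfolding alt_mult_left[OF 2(1) b(2,1)] by (simp add: sigma_def)
      then show ?thesis unfolding left right using U 2(2) by auto
    next
      case 3
      have "t \<in> valency_part Y T 1" using quasi_thin_cases[OF q t(1)] 3 by blast
      obtain d where d: "d \<noteq> w" "fiber t' = {w, d}" using T2_pair[OF 3(2) t'(2)] .
      have "(y\<^sub>0, d) \<in> t'" using d by blast
      then have "(w, y) \<in> u\<inverse> \<longleftrightarrow> (d, y) \<in> u\<inverse>"
        by (rule thin_fiber_block[OF T t'(1) \<open>t \<in> valency_part Y T 1\<close> scheme_converse[OF T u] wt _ yt])
      then have "cm_mult Y (sigma u) (alt t') y w = 0"
        unfolding alt_mult_right[OF 3(2) d(2,1)] by (simp add: sigma_def)
      then show ?thesis unfolding left right using U 3(1) by auto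
    next
      case 4
      obtain b where b: "b \<noteq> y" "fiber t = {y, b}" using T2_pair[OF 4(1) t(2)] .
      obtain d where d: "d \<noteq> w" "fiber t' = {w, d}" using T2_pair[OF 4(2) t'(2)] .
      have d': "fiber t' = {d, w}" using d by blast
      have diag: "(y, w) \<in> u \<longleftrightarrow> (b, d) \<in> u"
        by (rule pair_fiber_block[OF T t(1) t'(1) u b(2) b(1)[symmetric] d(2) d(1)[symmetric]])
      have off: "(y, d) \<in> u \<longleftrightarrow> (b, w) \<in> u"
        by (rule pair_fiber_block[OF T t(1) t'(1) u b(2) b(1)[symmetric] d' d(1)])
      have eq: "cm_mult Y (alt t) (sigma u) y w = cm_mult Y (sigma u) (alt t') y w"
        unfolding alt_mult_left[OF 4(1) b(2,1)] alt_mult_right[OF 4(2) d(2,1)]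
        using off by (simp add: sigma_def)
      show ?thesis
      proof (cases "linked T y\<^sub>0 t t'")
        case True
        then show ?thesis unfolding left right using closed[OF 4 True] eq by simp
      next
        case False
        have dt: "(y\<^sub>0, d) \<in> t'" using d by blast
        have "(y, w) \<in> u \<longleftrightarrow> (y, d) \<in> u" using False u yt wt dt unfolding linked_def by blast
        then have "cm_mult Y (sigma u) (alt t') y w = 0"
          unfolding alt_mult_right[OF 4(2) d(2,1)] by (simp add: sigma_def)
        then show ?thesis unfolding left right using eq by simp
      qed
    qed
  qed
qed

lemma alt_eps:
  assumes t: "t \<in> T2"
  shows "fiber t \<subseteq> V \<Longrightarrow> V \<subseteq> Y \<Longrightarrow> cm_mult Y (eps V) (alt t) = alt t"
    and "fiber t \<subseteq> V \<Longrightarrow> V \<subseteq> Y \<Longrightarrow> cm_mult Y (alt t) (eps V) = alt t"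
    and "fiber t \<inter> V = {} \<Longrightarrow> cm_mult Y (eps V) (alt t) = 0"
    and "fiber t \<inter> V = {} \<Longrightarrow> cm_mult Y (alt t) (eps V) = 0"
proof -
  have out: "alt t y w = 0" if "y \<notin> fiber t \<or> w \<notin> fiber t" for y w using alt_outside[OF t that] .
  show "cm_mult Y (eps V) (alt t) = alt t" "cm_mult Y (alt t) (eps V) = alt t" if "fiber t \<subseteq> V" "V \<subseteq> Y"
  proof -
    show "cm_mult Y (eps V) (alt t) = alt t"
    proof (intro ext)
      fix y w
      show "cm_mult Y (eps V) (alt t) y w = alt t y w"
        unfolding cm_mult_eps_left[OF finY] using out[of y w] that by (cases "y \<in> fiber t") auto
    qed
    show "cm_mult Y (alt t) (eps V) = alt t"
    proof (intro ext)
      fix y w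
      show "cm_mult Y (alt t) (eps V) y w = alt t y w"
        unfolding cm_mult_eps_right[OF finY] using out[of y w] that by (cases "w \<in> fiber t") auto
    qed
  qed
  show "cm_mult Y (eps V) (alt t) = 0" "cm_mult Y (alt t) (eps V) = 0" if "fiber t \<inter> V = {}"
  proof -
    show "cm_mult Y (eps V) (alt t) = 0"
    proof (intro ext)
      fix y w
      show "cm_mult Y (eps V) (alt t) y w = 0 y w"
        unfolding cm_mult_eps_left[OF finY] using out[of y w] that by (cases "y \<in> fiber t") auto
    qed
    show "cm_mult Y (alt t) (eps V) = 0"
    proof (intro ext)
      fix y w
      show "cm_mult Y (alt t) (eps V) y w = 0 y w"
        unfolding cm_mult_eps_right[OF finY] using out[of y w] that by (cases "w \<in> fiber t") auto
    qed
  qed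
qed

lemma alt_idem:
  assumes t: "t \<in> T2"
  shows "cm_mult Y (alt t) (alt t) = alt t"
proof (intro ext)
  fix y w
  show "cm_mult Y (alt t) (alt t) y w = alt t y w"
  proof (cases "y \<in> fiber t")
    case True
    then obtain b where b: "b \<noteq> y" "fiber t = {y, b}" using T2_pair[OF t] by blast
    show ?thesis unfolding alt_mult_left[OF t b(2,1)] alt_rank_one[OF b(2) b(1)[symmetric]]
      using b(1) by auto
  next
    case False
    then have "alt t y z = 0" for z using alt_outside[OF t] by blast
    then show ?thesis by (simp add: cm_mult_def)
  qed
qed

lemma alt_orth:
  assumes t: "t \<in> T2" "t' \<in> T2" "t \<noteq> t'"
  shows "cm_mult Y (alt t) (alt t') = 0"
proof -
  have disj: "fiber t' \<inter> fiber t = {}" using fiber_disjoint[OF T2D T2D] t by blast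
  have "cm_mult Y (alt t) (alt t') = cm_mult Y (cm_mult Y (alt t) (eps (fiber t))) (alt t')"
    by (simp only: alt_eps(2)[OF t(1) order_refl fiber_subset[OF T2D[OF t(1)]]])
  also have "\<dots> = cm_mult Y (alt t) (cm_mult Y (eps (fiber t)) (alt t'))" by (simp only: cm_mult_assoc)
  also have "\<dots> = 0" by (simp only: alt_eps(3)[OF t(2) disj] cm_mult_zero_right)
  finally show ?thesis .
qed

lemma altsum_alt:
  assumes U: "U \<subseteq> T2" and t: "t \<in> U"
  shows "cm_mult Y (\<Sum>t\<in>U. alt t) (alt t) = alt t"
proof -
  have finU: "finite U"
    using U scheme_finite_relations[OF T] T2D by (meson finite_subset subset_eq)
  have "cm_mult Y (\<Sum>t\<in>U. alt t) (alt t) = (\<Sum>t'\<in>U. if t' = t then alt t else 0)"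
    unfolding cm_mult_sum_left
    by (rule sum.cong[OF refl]) (use alt_idem alt_orth U t in \<open>simp add: subset_iff\<close>)
  also have "\<dots> = alt t" using finU t by (simp only: sum.delta if_True)
  finally show ?thesis .
qed

lemma altsum_idem:
  assumes U: "U \<subseteq> T2"
  shows "cm_mult Y (\<Sum>t\<in>U. alt t) (\<Sum>t\<in>U. alt t) = (\<Sum>t\<in>U. alt t)"
proof -
  have "cm_mult Y M (\<Sum>t\<in>U. alt t) = (\<Sum>t\<in>U. cm_mult Y M (alt t))" for M by (rule cm_mult_sum_right)
  then have "cm_mult Y (\<Sum>t\<in>U. alt t) (\<Sum>t\<in>U. alt t) = (\<Sum>t\<in>U. cm_mult Y (\<Sum>t\<in>U. alt t) (alt t))" .
  also have "\<dots> = (\<Sum>t\<in>U. alt t)" by (rule sum.cong[OF refl altsum_alt[OF U]])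
  finally show ?thesis .
qed

text \<open>On two points, the identity is the sum of the projections onto the constant and the alternating
  vectors.\<close>

lemma eps_split:
  assumes t: "t \<in> T2"
  shows "eps (fiber t) = trivial_idempotent_A (fiber t) + alt t"
proof -
  obtain a b where ab: "a \<noteq> b" "fiber t = {a, b}" using T2_pair'[OF t] by blast
  show ?thesis
  proof (intro ext)
    fix y w
    show "eps (fiber t) y w = (trivial_idempotent_A (fiber t) + alt t) y w"
      unfolding plus_fun_apply alt_rank_one[OF ab(2,1)] trivial_idempotent_A_def ab(2)
      using ab(1) by (cases "y = a"; cases "y = b"; cases "w = a"; cases "w = b")
        (simp_all add: eps_def cm_scale_def Jm_def)
  qed
qed

lemma TW_E_alt:
  assumes t: "t \<in> T2"
  shows "kron E (alt t) \<in> TW"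
proof -
  note tT = T2D[OF t]
  have "wreath_bar X t \<in> wreath X S Y T" using tT T2_not_Id[OF t] by (simp add: wreath_def)
  then have "Jm (X \<times> fiber t) (X \<times> fiber t) \<in> TW"
    using Jm_in_terwilliger[OF wreath_scheme[OF S T], of "wreath_bar X t" "wreath_bar X t" "(x\<^sub>0, y\<^sub>0)"]
    unfolding wreath_bar_image[OF x0] by blast
  then have "kron E (trivial_idempotent_A (fiber t)) \<in> TW"
    unfolding trivial_idempotent_A_def kron_scale_left kron_scale_right kron_Jm
    by (intro subalgebra_scale[OF TW_subalgebra])
  moreover have "kron E (eps (fiber t)) \<in> TW"
    using TW_E_left_eps(1)[OF TW_E_eps tT] unfolding eps_Y_right[OF fiber_subset[OF tT]] .
  moreover have "kron E (alt t) = kron E (eps (fiber t)) - kron E (trivial_idempotent_A (fiber t))"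
    unfolding eps_split[OF t] kron_add_right by simp
  ultimately show ?thesis using subalgebra_diff[OF TW_subalgebra] by metis
qed

lemma eta_central:
  assumes q: "quasi_thin Y T" and U: "U \<subseteq> T2"
    and closed: "\<And>t t'. t \<in> T2 \<Longrightarrow> t' \<in> T2 \<Longrightarrow> linked T y\<^sub>0 t t' \<Longrightarrow> t \<in> U \<longleftrightarrow> t' \<in> U"
  shows "e_eta X y\<^sub>0 U \<in> central_idempotents (X \<times> Y) TW"
proof (rule central_idempotentsI)
  let ?f = "\<Sum>t\<in>U. alt t"
  have f: "?f \<in> Mat Y" by (rule altsum_Mat[OF U])
  show in_TW: "e_eta X y\<^sub>0 U \<in> TW"
    unfolding e_eta_eq kron_sum_right
    by (rule subalgebra_sum[OF TW_subalgebra TW_E_alt]) (use U in blast)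
  show "cm_mult (X \<times> Y) (e_eta X y\<^sub>0 U) (e_eta X y\<^sub>0 U) = e_eta X y\<^sub>0 U"
    unfolding e_eta_eq cm_mult_kron E_facts altsum_idem[OF U] ..
  have f_eps: "cm_mult Y ?f (eps (fiber t)) = cm_mult Y (eps (fiber t)) ?f" if t: "t \<in> T" for t
  proof -
    have "cm_mult Y (alt t') (eps (fiber t)) = cm_mult Y (eps (fiber t)) (alt t')" if "t' \<in> U" for t'
    proof -
      have t': "t' \<in> T2" using that U by blast
      show ?thesis
      proof (cases "t' = t")
        case True
        then show ?thesis using alt_eps(1,2)[OF t', of "fiber t"] fiber_subset[OF t] by simp
      next
        case False
        then have "fiber t' \<inter> fiber t = {}" by (rule fiber_disjoint[OF T2D[OF t'] t])
        then show ?thesis using alt_eps(3,4)[OF t'] by simp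
      qed
    qed
    then show ?thesis unfolding cm_mult_sum_left cm_mult_sum_right by (rule sum.cong[OF refl])
  qed
  fix N assume N: "N \<in> TW"
  show "cm_mult (X \<times> Y) (e_eta X y\<^sub>0 U) N = cm_mult (X \<times> Y) N (e_eta X y\<^sub>0 U)"
  proof (rule generated_subalgebra_commutes[OF finXY GW_Mat])
    show "N \<in> generated_subalgebra (X \<times> Y) GW" using N unfolding terwilliger_algebra_def .
    show "e_eta X y\<^sub>0 U \<in> Mat (X \<times> Y)" by (rule subalgebra_Mat[OF TW_subalgebra in_TW])
    fix g assume "g \<in> GW"
    then show "cm_mult (X \<times> Y) (e_eta X y\<^sub>0 U) g = cm_mult (X \<times> Y) g (e_eta X y\<^sub>0 U)"
    proof (cases rule: generator_cases)
      case (tilde s)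
      show ?thesis unfolding tilde e_eta_eq cm_mult_kron E_sigma[OF tilde(1)]
          cm_mult_one_left[OF finY f] cm_mult_one_right[OF finY f] ..
    next
      case (bar u)
      have "cm_mult Y ?f (sigma u) = cm_mult Y (sigma u) ?f"
        by (rule altsum_sigma[OF q U bar(1)]) (rule closed)
      then show ?thesis unfolding bar e_eta_eq cm_mult_kron E_facts by (rule arg_cong)
    next
      case (eps_tilde s)
      have z: "cm_mult Y ?f (eps {y\<^sub>0}) = 0"
      proof -
        have "cm_mult Y (alt t) (eps {y\<^sub>0}) = 0" if "t \<in> U" for t
        proof -
          have t: "t \<in> T2" using that U by blast
          have "fiber t \<inter> {y\<^sub>0} = {}" using y0_notin_fiber[OF T2D[OF t] T2_not_Id[OF t]] by blast
          then show ?thesis by (rule alt_eps(4)[OF t])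
        qed
        then show ?thesis unfolding cm_mult_sum_left by (rule sum.neutral[OF ballI])
      qed
      moreover have "cm_mult Y (eps {y\<^sub>0}) ?f = 0"
        using f_eps[OF scheme_Id[OF T]] z unfolding fiber_Id by simp
      ultimately show ?thesis unfolding eps_tilde e_eta_eq cm_mult_kron by (simp only: kron_zero_right)
    next
      case (eps_bar t)
      show ?thesis unfolding eps_bar e_eta_eq cm_mult_kron E_facts f_eps[OF eps_bar(1)] ..
    qed
  qed
qed

lemma rank_one_sandwich:
  assumes "\<And>x y. P x y = c * (v x * w y)"
  shows "cm_mult Y (cm_mult Y K P) L x y = c * ((\<Sum>z\<in>Y. K x z * v z) * (\<Sum>z\<in>Y. w z * L z y))"
  by (simp add: cm_mult_def assms sum_distrib_left sum_distrib_right mult.assoc mult.left_commute)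

text \<open>A perfect matching between two fibres carries the alternating vector of one to that of the other, up
  to sign.\<close>

lemma alt_linked:
  assumes t: "t \<in> T2" "t' \<in> T2" and linked: "linked T y\<^sub>0 t t'"
  obtains u where "u \<in> T" "alt t' = cm_mult Y (cm_mult Y (cm_mult Y (eps (fiber t')) (sigma (u\<inverse>))) (alt t))
      (cm_mult Y (sigma u) (eps (fiber t')))"
proof -
  obtain u a c d where u: "u \<in> T" and m: "(y\<^sub>0, a) \<in> t" "(y\<^sub>0, c) \<in> t'" "(y\<^sub>0, d) \<in> t'" "(a, c) \<in> u" "(a, d) \<notin> u"
    using linked unfolding linked_def by blast
  have tT: "t \<in> T" "t' \<in> T" using T2D t by blast+
  obtain b where b: "b \<noteq> a" "fiber t = {a, b}" by (rule valency_two_pair[OF T t(1) m(1)])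
  have cd: "c \<noteq> d" using m by blast
  obtain d' where d': "d' \<noteq> c" "fiber t' = {c, d'}" by (rule valency_two_pair[OF T t(2) m(2)])
  have "d \<in> {c, d'}" unfolding d'(2)[symmetric] using m(3) by (rule ImageI) simp
  then have "d' = d" using cd by simp
  then have ft': "fiber t' = {c, d}" "fiber t' = {d, c}" using d'(2) by (simp_all add: insert_commute)
  have bd: "(b, d) \<in> u" using pair_fiber_block[OF T tT u b(2) b(1)[symmetric] ft'(1) cd] m(4) by blast
  have bc: "(b, c) \<notin> u" using pair_fiber_block[OF T tT u b(2) b(1)[symmetric] ft'(2) cd[symmetric]] m(5) by blast
  have abY: "a \<in> Y" "b \<in> Y" using fiber_subset[OF tT(1)] unfolding b(2) by blast+
  let ?v = "\<lambda>z. of_bool (z = a) - of_bool (z = b) :: complex"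
  have pick: "(\<Sum>z\<in>Y. g z * ?v z) = g a - g b" for g :: "'b \<Rightarrow> complex"
  proof -
    have "(\<Sum>z\<in>Y. g z * ?v z) = (\<Sum>z\<in>{a, b}. g z * ?v z)"
      by (rule sum.mono_neutral_right[OF finY]) (use abY in auto)
    then show ?thesis using b(1) by (simp add: algebra_simps)
  qed
  have "alt t' = cm_mult Y (cm_mult Y (cm_mult Y (eps (fiber t')) (sigma (u\<inverse>))) (alt t))
      (cm_mult Y (sigma u) (eps (fiber t')))"
  proof (intro ext)
    fix y w
    let ?K = "cm_mult Y (eps (fiber t')) (sigma (u\<inverse>))" and ?L = "cm_mult Y (sigma u) (eps (fiber t'))"
    have "cm_mult Y (cm_mult Y ?K (alt t)) ?L y w = 1 / 2 * ((\<Sum>z\<in>Y. ?K y z * ?v z) * (\<Sum>z\<in>Y. ?v z * ?L z w))"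
      by (rule rank_one_sandwich[OF alt_rank_one[OF b(2) b(1)[symmetric]]])
    also have "(\<Sum>z\<in>Y. ?v z * ?L z w) = (\<Sum>z\<in>Y. ?L z w * ?v z)" by (simp add: mult.commute)
    also have "1 / 2 * ((\<Sum>z\<in>Y. ?K y z * ?v z) * (\<Sum>z\<in>Y. ?L z w * ?v z)) =
        1 / 2 * ((?K y a - ?K y b) * (?L a w - ?L b w))" unfolding pick ..
    also have "\<dots> = alt t' y w"
      unfolding cm_mult_eps_left[OF finY] cm_mult_eps_right[OF finY] alt_rank_one[OF ft'(1) cd]
      using fiber_subset[OF tT(2)] m(4,5) bd bc cd unfolding ft'(1) by (auto simp: sigma_def)
    finally show "alt t' y w = cm_mult Y (cm_mult Y ?K (alt t)) ?L y w" ..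
  qed
  then show thesis using u that by blast
qed

text \<open>Each summand \<open>J / |X| \<otimes> alt t\<close> has rank one, and along linked pairs each summand generates the next
  as an ideal.  Hence a central idempotent that kills one summand kills all of them.\<close>

lemma eta_primitive:
  assumes q: "quasi_thin Y T" and U: "U \<subseteq> T2" "U \<noteq> {}"
    and closed: "\<And>t t'. t \<in> T2 \<Longrightarrow> t' \<in> T2 \<Longrightarrow> linked T y\<^sub>0 t t' \<Longrightarrow> t \<in> U \<longleftrightarrow> t' \<in> U"
    and connected: "\<And>t t'. t \<in> U \<Longrightarrow> t' \<in> U \<Longrightarrow>
      (t, t') \<in> {(t, t'). t \<in> T2 \<and> t' \<in> T2 \<and> linked T y\<^sub>0 t t'}\<^sup>*"
  shows "e_eta X y\<^sub>0 U \<in> central_primitive_idempotents (X \<times> Y) TW"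
proof -
  obtain t0 where t0U: "t0 \<in> U" using U by blast
  then have t0: "t0 \<in> T2" using U by blast
  let ?p = "kron E (alt t0)"
  obtain a b where ab: "a \<noteq> b" "fiber t0 = {a, b}" by (rule T2_pair'[OF t0])
  have nz: "?p \<noteq> 0"
  proof
    assume "?p = 0"
    then have "?p (x\<^sub>0, a) (x\<^sub>0, a) = 0" by simp
    then show False
      using ab(1) x0 finX X_ne
      by (simp add: kron_def alt_rank_one[OF ab(2,1)] trivial_idempotent_A_def cm_scale_def Jm_def)
  qed
  have rank: "?p p r = (1 / of_nat (card X) * of_bool (fst p \<in> X) * (1 / 2) * (of_bool (snd p = a) - of_bool (snd p = b)))
      * (of_bool (fst r \<in> X) * (of_bool (snd r = a) - of_bool (snd r = b)))" for p r
    by (cases p; cases r)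
      (simp add: kron_def alt_rank_one[OF ab(2,1)] trivial_idempotent_A_def cm_scale_def Jm_def)
  have central: "e_eta X y\<^sub>0 U \<in> central_idempotents (X \<times> Y) TW"
    by (rule eta_central[OF q U(1)]) (rule closed)
  show ?thesis
  proof (rule cpi_of_scalar_corner[OF TW_subalgebra central TW_E_alt[OF t0] nz])
    show "cm_mult (X \<times> Y) ?p ?p = ?p" unfolding cm_mult_kron E_facts alt_idem[OF t0] ..
    show "cm_mult (X \<times> Y) (e_eta X y\<^sub>0 U) ?p = ?p"
      unfolding e_eta_eq cm_mult_kron E_facts altsum_alt[OF U(1) t0U] ..
    show "\<exists>c. cm_mult (X \<times> Y) (cm_mult (X \<times> Y) ?p M) ?p = cm_scale c ?p" for M
      by (rule rank_one_corner[OF rank])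
    fix f assume f: "f \<in> central_idempotents (X \<times> Y) TW" and fp: "cm_mult (X \<times> Y) f ?p = 0"
    have "cm_mult (X \<times> Y) f (kron E (alt t)) = 0"
      if "(t0, t) \<in> {(t, t'). t \<in> T2 \<and> t' \<in> T2 \<and> linked T y\<^sub>0 t t'}\<^sup>*" for t
      using that
    proof (induction rule: rtrancl_induct)
      case base
      show ?case by (rule fp)
    next
      case (step t t')
      then have t: "t \<in> T2" "t' \<in> T2" and l: "linked T y\<^sub>0 t t'" by blast+
      obtain u where u: "u \<in> T" "alt t' = cm_mult Y (cm_mult Y (cm_mult Y (eps (fiber t')) (sigma (u\<inverse>))) (alt t))
          (cm_mult Y (sigma u) (eps (fiber t')))" by (rule alt_linked[OF t l])
      let ?K = "kron E (cm_mult Y (eps (fiber t')) (sigma (u\<inverse>)))" and ?L = "kron E (cm_mult Y (sigma u) (eps (fiber t')))"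
      have K: "?K \<in> TW"
        by (rule TW_E_left_eps(1)[OF TW_E_sigma[OF scheme_converse[OF T u(1)]] T2D[OF t(2)]])
      have "kron E (alt t') = cm_mult (X \<times> Y) (cm_mult (X \<times> Y) ?K (kron E (alt t))) ?L"
        unfolding cm_mult_kron E_facts u(2)[symmetric] ..
      then have "cm_mult (X \<times> Y) f (kron E (alt t')) =
          cm_mult (X \<times> Y) (cm_mult (X \<times> Y) (cm_mult (X \<times> Y) f ?K) (kron E (alt t))) ?L"
        by (simp only: cm_mult_assoc)
      also have "cm_mult (X \<times> Y) f ?K = cm_mult (X \<times> Y) ?K f" by (rule central_idempotentsD(2)[OF f K])
      also have "cm_mult (X \<times> Y) (cm_mult (X \<times> Y) (cm_mult (X \<times> Y) ?K f) (kron E (alt t))) ?L =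
          cm_mult (X \<times> Y) (cm_mult (X \<times> Y) ?K (cm_mult (X \<times> Y) f (kron E (alt t)))) ?L"
        by (simp only: cm_mult_assoc)
      also have "\<dots> = 0" by (simp only: step.IH cm_mult_zero_left cm_mult_zero_right)
      finally show ?case .
    qed
    then have "cm_mult (X \<times> Y) f (kron E (alt t)) = 0" if "t \<in> U" for t
      using connected[OF t0U that] by blast
    then show "cm_mult (X \<times> Y) f (e_eta X y\<^sub>0 U) = 0"
      unfolding e_eta_eq kron_sum_right cm_mult_sum_right by (rule sum.neutral[OF ballI])
  qed
qed

section \<open>The primitive central idempotents\<close>

abbreviation "e1 \<equiv> trivial_idempotent_T (X \<times> Y) (wreath X S Y T) (x\<^sub>0, y\<^sub>0)"

lemma e1_primitive: "e1 \<in> central_primitive_idempotents (X \<times> Y) TW"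
  by (rule trivial_idempotent_T_primitive(1)[OF wreath_scheme[OF S T]]) (use x0 y0 in simp)

lemma eT_Mat: "trivial_idempotent_T X S x\<^sub>0 \<in> Mat X"
  by (rule subalgebra_Mat[OF terwilliger_subalgebra[OF S] trivial_idempotent_T_in[OF S]])

text \<open>The part of the trivial idempotent in one fibre: what the other listed idempotents have to
  complement there.\<close>

lemma e1_fiber:
  assumes t: "t \<in> T"
  shows "cm_mult (X \<times> Y) e1 (kron (eps X) (eps (fiber t))) =
    (if t = Id_on Y then kron (trivial_idempotent_T X S x\<^sub>0) (eps {y\<^sub>0})
     else kron E (trivial_idempotent_A (fiber t)))"
proof -
  have e1: "e1 = kron (trivial_idempotent_T X S x\<^sub>0) (eps {y\<^sub>0}) +
      (\<Sum>t\<in>T - {Id_on Y}. kron E (trivial_idempotent_A (fiber t)))"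
    unfolding trivial_idempotent_T_wreath[OF S T x0 y0] trivial_idempotent_A_def[of "_ `` _"]
    by (intro arg_cong2[where f = "(+)"] sum.cong refl) (simp add: valency_eq[OF T _ y0])
  have sum: "(\<Sum>t'\<in>T - {Id_on Y}. cm_mult (X \<times> Y) (kron E (trivial_idempotent_A (fiber t'))) (kron (eps X) (eps (fiber t))))
      = (\<Sum>t'\<in>T - {Id_on Y}. if t' = t then kron E (trivial_idempotent_A (fiber t)) else 0)"
  proof (rule sum.cong[OF refl])
    fix t' assume "t' \<in> T - {Id_on Y}"
    then have t': "t' \<in> T" by blast
    note P = eps_trivial_idempotent_A[OF fiber_subset[OF t']]
    show "cm_mult (X \<times> Y) (kron E (trivial_idempotent_A (fiber t'))) (kron (eps X) (eps (fiber t))) =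
        (if t' = t then kron E (trivial_idempotent_A (fiber t)) else 0)"
    proof (cases "t' = t")
      case True
      then show ?thesis unfolding cm_mult_kron E_facts using P(2)[of "fiber t"] fiber_subset[OF t] by simp
    next
      case False
      then have "fiber t' \<inter> fiber t = {}" by (rule fiber_disjoint[OF t' t])
      then show ?thesis unfolding cm_mult_kron E_facts using P(4)[of "fiber t"] False by simp
    qed
  qed
  have fin: "finite (T - {Id_on Y})" using scheme_finite_relations[OF T] by simp
  have "cm_mult (X \<times> Y) (kron (trivial_idempotent_T X S x\<^sub>0) (eps {y\<^sub>0})) (kron (eps X) (eps (fiber t))) =
      kron (trivial_idempotent_T X S x\<^sub>0) (eps ({y\<^sub>0} \<inter> fiber t \<inter> Y))"
    unfolding cm_mult_kron cm_mult_one_right[OF finX eT_Mat] cm_mult_eps_eps[OF finY] ..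
  moreover have "{y\<^sub>0} \<inter> fiber t \<inter> Y = (if t = Id_on Y then {y\<^sub>0} else {})"
    using y0 y0_notin_fiber[OF t] by auto
  moreover have "eps {} = (0 :: 'b cmat)" by (simp add: eps_def fun_eq_iff)
  ultimately have base: "cm_mult (X \<times> Y) (kron (trivial_idempotent_T X S x\<^sub>0) (eps {y\<^sub>0})) (kron (eps X) (eps (fiber t))) =
      (if t = Id_on Y then kron (trivial_idempotent_T X S x\<^sub>0) (eps {y\<^sub>0}) else 0)"
    by simp
  have delta: "(\<Sum>t'\<in>T - {Id_on Y}. if t' = t then kron E (trivial_idempotent_A (fiber t)) else 0) =
      (if t = Id_on Y then 0 else kron E (trivial_idempotent_A (fiber t)))"
    unfolding sum.delta[OF fin] using t by simp
  have total: "cm_mult (X \<times> Y) e1 (kron (eps X) (eps (fiber t))) =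
      (if t = Id_on Y then kron (trivial_idempotent_T X S x\<^sub>0) (eps {y\<^sub>0}) else 0) +
      (if t = Id_on Y then 0 else kron E (trivial_idempotent_A (fiber t)))"
    unfolding e1 cm_mult_add_left cm_mult_sum_left base sum delta by (rule refl)
  show ?thesis
  proof (cases "t = Id_on Y")
    case True
    show ?thesis unfolding total if_P[OF True] by (rule add_0_right)
  next
    case False
    show ?thesis unfolding total if_not_P[OF False] by (rule add_0_left)
  qed
qed

lemma one_sum: "eps (X \<times> Y) = (\<Sum>t\<in>T. kron (eps X) (eps (fiber t)))"
proof -
  have "(\<Sum>t\<in>T. kron (eps X) (eps (fiber t))) = kron (eps X) (eps Y)"
    unfolding kron_sum_right[symmetric] eps_sum_cells[OF T y0] by (rule refl)
  then show ?thesis unfolding kron_eps[of X Y, symmetric] by (rule sym)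
qed

text \<open>In the fibre over \<open>y\<^sub>0t\<close> the identity is the sum of the trivial part and the listed idempotents:
  \<open>restricted_central\<close> alone, or \<open>fiber_central\<close> together with the alternating part of \<open>e_eta\<close>.  So \<open>e\<close> is
  annihilated by the identity of every fibre.\<close>

lemma annihilated_zero:
  assumes e: "e \<in> Mat (X \<times> Y)" and e1: "cm_mult (X \<times> Y) e e1 = 0" and base: "cm_mult (X \<times> Y) e base_central = 0"
    and others: "\<And>t. t \<in> T \<Longrightarrow> t \<noteq> Id_on Y \<Longrightarrow> cm_mult (X \<times> Y) e (restricted_central t) = 0 \<or>
      t \<in> T2 \<and> cm_mult (X \<times> Y) e (fiber_central t) = 0 \<and>
        (\<exists>U\<subseteq>T2. t \<in> U \<and> cm_mult (X \<times> Y) e (e_eta X y\<^sub>0 U) = 0)"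
  shows "e = 0"
proof -
  have e1t: "cm_mult (X \<times> Y) e (cm_mult (X \<times> Y) e1 M) = 0" for M
    using e1 by (metis cm_mult_assoc cm_mult_zero_left)
  have "cm_mult (X \<times> Y) e (kron (eps X) (eps (fiber t))) = 0" if t: "t \<in> T" for t
  proof (cases "t = Id_on Y")
    case True
    have "kron (eps X) (eps (fiber t)) = base_central + cm_mult (X \<times> Y) e1 (kron (eps X) (eps (fiber t)))"
      unfolding e1_fiber[OF t] using True fiber_Id by (simp add: base_central_def kron_diff_left)
    then have "cm_mult (X \<times> Y) e (kron (eps X) (eps (fiber t))) =
        cm_mult (X \<times> Y) e base_central + cm_mult (X \<times> Y) e (cm_mult (X \<times> Y) e1 (kron (eps X) (eps (fiber t))))"
      by (metis cm_mult_add_right)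
    then show ?thesis unfolding base e1t by simp
  next
    case False
    have e1P: "cm_mult (X \<times> Y) e (kron E (trivial_idempotent_A (fiber t))) = 0"
      using e1t[of "kron (eps X) (eps (fiber t))"] unfolding e1_fiber[OF t] using False by simp
    show ?thesis using others[OF t False]
    proof
      assume r: "cm_mult (X \<times> Y) e (restricted_central t) = 0"
      have "kron (eps X) (eps (fiber t)) = restricted_central t + kron E (trivial_idempotent_A (fiber t))"
        unfolding restricted_central_def by simp
      then have "cm_mult (X \<times> Y) e (kron (eps X) (eps (fiber t))) = 0 + 0"
        by (simp only: cm_mult_add_right r e1P)
      then show ?thesis by simp
    next
      assume "t \<in> T2 \<and> cm_mult (X \<times> Y) e (fiber_central t) = 0 \<and>
        (\<exists>U\<subseteq>T2. t \<in> U \<and> cm_mult (X \<times> Y) e (e_eta X y\<^sub>0 U) = 0)"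
      then obtain U where t2: "t \<in> T2" and c: "cm_mult (X \<times> Y) e (fiber_central t) = 0"
        and U: "U \<subseteq> T2" "t \<in> U" "cm_mult (X \<times> Y) e (e_eta X y\<^sub>0 U) = 0" by blast
      have "cm_mult (X \<times> Y) (e_eta X y\<^sub>0 U) (kron E (alt t)) = kron E (alt t)"
        unfolding e_eta_eq cm_mult_kron E_facts altsum_alt[OF U(1,2)] ..
      then have alt0: "cm_mult (X \<times> Y) e (kron E (alt t)) = 0"
        using U(3) by (metis cm_mult_assoc cm_mult_zero_left)
      have "kron (eps X) (eps (fiber t)) = fiber_central t + (kron E (trivial_idempotent_A (fiber t)) + kron E (alt t))"
        unfolding fiber_central_def kron_diff_left kron_add_right[symmetric] eps_split[OF t2, symmetric] by simp
      then have "cm_mult (X \<times> Y) e (kron (eps X) (eps (fiber t))) = 0 + (0 + 0)"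
        by (simp only: cm_mult_add_right c e1P alt0)
      then show ?thesis by simp
    qed
  qed
  then have "cm_mult (X \<times> Y) e (eps (X \<times> Y)) = 0"
    unfolding one_sum cm_mult_sum_right by (rule sum.neutral[OF ballI])
  then show ?thesis using cm_mult_one_right[OF finXY e] by simp
qed

lemma thin_fiber:
  assumes t: "t \<in> valency_part Y T 1"
  shows "restrict_relations (fiber t) T = complete_relations (fiber t)"
    and "u \<in> T \<Longrightarrow> y \<in> Y - fiber t \<Longrightarrow> fiber t \<subseteq> u `` {y} \<or> fiber t \<inter> u `` {y} = {}"
proof -
  have tT: "t \<in> T" using valency_partD[OF t] by blast
  have "card (fiber t) = 1" using valency_eq[OF T tT y0] valency_partD[OF t] by simp
  then obtain y where y: "fiber t = {y}" by (rule card_1_singletonE)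
  have "y \<in> Y" using fiber_subset[OF tT] y by blast
  then show "restrict_relations (fiber t) T = complete_relations (fiber t)"
    unfolding y by (rule restrict_singleton[OF T])
  show "fiber t \<subseteq> u `` {y} \<or> fiber t \<inter> u `` {y} = {}" for u y unfolding y by blast
qed

lemma one_class_fiber:
  assumes one: "one_class_scheme T" and t: "t \<in> T" "t \<noteq> Id_on Y"
  shows "restrict_relations (fiber t) T = complete_relations (fiber t)"
    and "u \<in> T \<Longrightarrow> y \<in> Y - fiber t \<Longrightarrow> fiber t \<subseteq> u `` {y} \<or> fiber t \<inter> u `` {y} = {}"
proof -
  show "restrict_relations (fiber t) T = complete_relations (fiber t)"
    by (rule restrict_one_class[OF T one fiber_subset[OF t(1)] fiber_ne[OF t(1)]])
  have "t = Y \<times> Y - Id_on Y" using t one_class_relations[OF T one] by blast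
  then have ft: "fiber t = Y - {y\<^sub>0}" using y0 by auto
  show "fiber t \<subseteq> u `` {y} \<or> fiber t \<inter> u `` {y} = {}" if u: "u \<in> T" and y: "y \<in> Y - fiber t" for u y
  proof -
    have yy: "y = y\<^sub>0" using y ft by blast
    show ?thesis
    proof (cases "u = t")
      case True
      then show ?thesis using yy by blast
    next
      case False
      then show ?thesis using fiber_disjoint[OF t(1) u] yy by blast
    qed
  qed
qed

theorem cpis_thin_or_one_class:
  assumes "thin Y T \<or> one_class_scheme T"
  shows "central_primitive_idempotents (X \<times> Y) TW =
    {e1} \<union>
    {e_tilde X S Y T x\<^sub>0 y\<^sub>0 \<chi> | \<chi>.
       \<chi> \<in> Irr_nontrivial_T (Ft X y\<^sub>0 (Id_on Y)) (Ut X S Y T y\<^sub>0 (Id_on Y)) (x\<^sub>0, y\<^sub>0)} \<union>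
    (\<Union>t \<in> T - {Id_on Y}.
       {e_bar X S Y T y\<^sub>0 t \<phi> | \<phi>. \<phi> \<in> Irr_nontrivial_A (Ft X y\<^sub>0 t) (Ut X S Y T y\<^sub>0 t)})"
proof -
  let ?T' = "T - {Id_on Y}"
  let ?Z = "{e1, base_central} \<union> restricted_central ` ?T'"
  have bar: "restricted_central t \<in> central_idempotents (X \<times> Y) TW \<and>
      cpis_below (X \<times> Y) TW (restricted_central t) =
      {e_bar X S Y T y\<^sub>0 t \<phi> | \<phi>. \<phi> \<in> Irr_nontrivial_A (Ft X y\<^sub>0 t) (Ut X S Y T y\<^sub>0 t)}"
    if "t \<in> ?T'" for t
  proof -
    have t: "t \<in> T" "t \<noteq> Id_on Y" using that by blast+
    from assms show ?thesis
    proof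
      assume "thin Y T"
      then have t1: "t \<in> valency_part Y T 1" using t(1) by (simp add: thin_def valency_part_def)
      show ?thesis
        by (intro conjI bar_corner[OF t thin_fiber(1)[OF t1]] thin_fiber(2)[OF t1])
    next
      assume one: "one_class_scheme T"
      show ?thesis
        by (intro conjI bar_corner[OF t one_class_fiber(1)[OF one t]] one_class_fiber(2)[OF one t])
    qed
  qed
  have "central_primitive_idempotents (X \<times> Y) TW = (\<Union>z\<in>?Z. cpis_below (X \<times> Y) TW z)"
  proof (rule cpis_cover[OF finXY TW_subalgebra])
    show "z \<in> central_idempotents (X \<times> Y) TW" if "z \<in> ?Z" for z
      using that cpiD(1)[OF e1_primitive] base_corner(1) bar by blast
    fix e assume e: "e \<in> Mat (X \<times> Y)" and ann: "\<And>z. z \<in> ?Z \<Longrightarrow> cm_mult (X \<times> Y) e z = 0"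
    show "e = 0"
    proof (rule annihilated_zero[OF e])
      show "cm_mult (X \<times> Y) e e1 = 0" "cm_mult (X \<times> Y) e base_central = 0" by (rule ann, blast)+
      fix t assume "t \<in> T" "t \<noteq> Id_on Y"
      then have "cm_mult (X \<times> Y) e (restricted_central t) = 0" by (intro ann) blast
      then show "cm_mult (X \<times> Y) e (restricted_central t) = 0 \<or>
        t \<in> T2 \<and> cm_mult (X \<times> Y) e (fiber_central t) = 0 \<and>
        (\<exists>U\<subseteq>T2. t \<in> U \<and> cm_mult (X \<times> Y) e (e_eta X y\<^sub>0 U) = 0)" by (rule disjI1)
    qed
  qed
  also have "\<dots> = cpis_below (X \<times> Y) TW e1 \<union> cpis_below (X \<times> Y) TW base_central \<union>
      (\<Union>t\<in>?T'. cpis_below (X \<times> Y) TW (restricted_central t))" by blast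
  also have "(\<Union>t\<in>?T'. cpis_below (X \<times> Y) TW (restricted_central t)) =
      (\<Union>t\<in>?T'. {e_bar X S Y T y\<^sub>0 t \<phi> | \<phi>. \<phi> \<in> Irr_nontrivial_A (Ft X y\<^sub>0 t) (Ut X S Y T y\<^sub>0 t)})"
    by (rule SUP_cong[OF refl]) (rule conjunct2[OF bar])
  finally show ?thesis
    unfolding cpis_below_cpi[OF TW_subalgebra e1_primitive] base_corner(2) .
qed

text \<open>The two quasi-thin cases differ only in the family \<open>\<U>\<close> of connected components of the linking
  relation.\<close>

theorem cpis_quasi_thin:
  assumes q: "quasi_thin Y T" and UU: "\<Union>\<U> = T2"
    and prim: "\<And>U. U \<in> \<U> \<Longrightarrow> e_eta X y\<^sub>0 U \<in> central_primitive_idempotents (X \<times> Y) TW"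
  shows "central_primitive_idempotents (X \<times> Y) TW =
    {e1} \<union>
    {e_tilde X S Y T x\<^sub>0 y\<^sub>0 \<chi> | \<chi>.
       \<chi> \<in> Irr_nontrivial_T (Ft X y\<^sub>0 (Id_on Y)) (Ut X S Y T y\<^sub>0 (Id_on Y)) (x\<^sub>0, y\<^sub>0)} \<union>
    (\<Union>t \<in> valency_part Y T 1 - {Id_on Y}.
       {e_bar X S Y T y\<^sub>0 t \<phi> | \<phi>. \<phi> \<in> Irr_nontrivial_A (Ft X y\<^sub>0 t) (Ut X S Y T y\<^sub>0 t)}) \<union>
    (\<Union>t \<in> T2. {e_hat X S y\<^sub>0 t \<psi> | \<psi>. \<psi> \<in> Irr_nontrivial_A X S}) \<union>
    e_eta X y\<^sub>0 ` \<U>"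
proof -
  let ?T1 = "valency_part Y T 1 - {Id_on Y}"
  let ?Z = "{e1, base_central} \<union> restricted_central ` ?T1 \<union> fiber_central ` T2 \<union> e_eta X y\<^sub>0 ` \<U>"
  have T1: "t \<in> T" "t \<noteq> Id_on Y" "t \<in> valency_part Y T 1" if "t \<in> ?T1" for t
    using that valency_partD by blast+
  have bar: "restricted_central t \<in> central_idempotents (X \<times> Y) TW"
    "cpis_below (X \<times> Y) TW (restricted_central t) =
      {e_bar X S Y T y\<^sub>0 t \<phi> | \<phi>. \<phi> \<in> Irr_nontrivial_A (Ft X y\<^sub>0 t) (Ut X S Y T y\<^sub>0 t)}"
    if tT1: "t \<in> ?T1" for t
  proof -
    note t = T1[OF tT1]
    show "restricted_central t \<in> central_idempotents (X \<times> Y) TW"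
      by (rule bar_corner(1)[OF t(1,2) thin_fiber(1)[OF t(3)]]) (rule thin_fiber(2)[OF t(3)])
    show "cpis_below (X \<times> Y) TW (restricted_central t) =
        {e_bar X S Y T y\<^sub>0 t \<phi> | \<phi>. \<phi> \<in> Irr_nontrivial_A (Ft X y\<^sub>0 t) (Ut X S Y T y\<^sub>0 t)}"
      by (rule bar_corner(2)[OF t(1,2) thin_fiber(1)[OF t(3)]]) (rule thin_fiber(2)[OF t(3)])
  qed
  note hat = hat_corner[OF T2D T2_not_Id]
  have "central_primitive_idempotents (X \<times> Y) TW = (\<Union>z\<in>?Z. cpis_below (X \<times> Y) TW z)"
  proof (rule cpis_cover[OF finXY TW_subalgebra])
    show "z \<in> central_idempotents (X \<times> Y) TW" if "z \<in> ?Z" for z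
    proof -
      from that consider "z = e1" | "z = base_central" | t where "t \<in> ?T1" "z = restricted_central t"
        | t where "t \<in> T2" "z = fiber_central t" | U where "U \<in> \<U>" "z = e_eta X y\<^sub>0 U" by blast
      then show ?thesis
      proof cases
        case 1 then show ?thesis using cpiD(1)[OF e1_primitive] by simp
      next
        case 2 then show ?thesis using base_corner(1) by simp
      next
        case (3 t) then show ?thesis using bar(1)[OF 3(1)] by simp
      next
        case (4 t) then show ?thesis using hat(1)[OF 4(1) 4(1)] by simp
      next
        case (5 U) then show ?thesis using cpiD(1)[OF prim[OF 5(1)]] by simp
      qed
    qed
    fix e assume e: "e \<in> Mat (X \<times> Y)" and ann: "\<And>z. z \<in> ?Z \<Longrightarrow> cm_mult (X \<times> Y) e z = 0"
    show "e = 0"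
    proof (rule annihilated_zero[OF e])
      show "cm_mult (X \<times> Y) e e1 = 0" "cm_mult (X \<times> Y) e base_central = 0" by (rule ann, blast)+
      fix t assume t: "t \<in> T" "t \<noteq> Id_on Y"
      from quasi_thin_cases[OF q t(1)]
      show "cm_mult (X \<times> Y) e (restricted_central t) = 0 \<or>
        t \<in> T2 \<and> cm_mult (X \<times> Y) e (fiber_central t) = 0 \<and>
        (\<exists>U\<subseteq>T2. t \<in> U \<and> cm_mult (X \<times> Y) e (e_eta X y\<^sub>0 U) = 0)"
      proof
        assume "t \<in> valency_part Y T 1"
        then have "cm_mult (X \<times> Y) e (restricted_central t) = 0" using t(2) by (intro ann) blast
        then show ?thesis by (rule disjI1)
      next
        assume t2: "t \<in> T2"
        then obtain U where U: "U \<in> \<U>" "t \<in> U" using UU by blast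
        have "cm_mult (X \<times> Y) e (fiber_central t) = 0" using t2 by (intro ann) blast
        moreover have "cm_mult (X \<times> Y) e (e_eta X y\<^sub>0 U) = 0" using U(1) by (intro ann) blast
        moreover have "U \<subseteq> T2" using U(1) UU by blast
        ultimately show ?thesis using t2 U(2) by blast
      qed
    qed
  qed
  also have "\<dots> = cpis_below (X \<times> Y) TW e1 \<union> cpis_below (X \<times> Y) TW base_central \<union>
      (\<Union>t\<in>?T1. cpis_below (X \<times> Y) TW (restricted_central t)) \<union>
      (\<Union>t\<in>T2. cpis_below (X \<times> Y) TW (fiber_central t)) \<union>
      (\<Union>U\<in>\<U>. cpis_below (X \<times> Y) TW (e_eta X y\<^sub>0 U))"
    by (simp only: UN_Un UN_insert UN_empty Un_empty_right image_image Un_assoc)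
  also have "(\<Union>t\<in>?T1. cpis_below (X \<times> Y) TW (restricted_central t)) =
      (\<Union>t\<in>?T1. {e_bar X S Y T y\<^sub>0 t \<phi> | \<phi>. \<phi> \<in> Irr_nontrivial_A (Ft X y\<^sub>0 t) (Ut X S Y T y\<^sub>0 t)})"
    by (rule SUP_cong[OF refl]) (rule bar(2))
  also have "(\<Union>t\<in>T2. cpis_below (X \<times> Y) TW (fiber_central t)) =
      (\<Union>t\<in>T2. {e_hat X S y\<^sub>0 t \<psi> | \<psi>. \<psi> \<in> Irr_nontrivial_A X S})"
    by (rule SUP_cong[OF refl]) (rule hat(2))
  also have "(\<Union>U\<in>\<U>. cpis_below (X \<times> Y) TW (e_eta X y\<^sub>0 U)) = (\<Union>U\<in>\<U>. {e_eta X y\<^sub>0 U})"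
    by (rule SUP_cong[OF refl]) (rule cpis_below_cpi[OF TW_subalgebra prim])
  also have "(\<Union>U\<in>\<U>. {e_eta X y\<^sub>0 U}) = e_eta X y\<^sub>0 ` \<U>" by blast
  finally show ?thesis
    unfolding cpis_below_cpi[OF TW_subalgebra e1_primitive] base_corner(2) .
qed

lemma eta_primitive_connected:
  assumes q: "quasi_thin Y T"
    and cond: "orth_set Y T \<noteq> {} \<and> orth_set Y T \<subseteq> T2 \<or> card (orth_set Y T) \<ge> 2"
  shows "e_eta X y\<^sub>0 T2 \<in> central_primitive_idempotents (X \<times> Y) TW"
proof (rule eta_primitive[OF q order_refl])
  have "orth_set Y T \<noteq> {}" using cond by auto
  then show "T2 \<noteq> {}" unfolding orth_set_def by blast
  show "t \<in> T2 \<longleftrightarrow> t' \<in> T2" if "t \<in> T2" "t' \<in> T2" for t t' using that by blast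
  show "(t, t') \<in> {(t, t'). t \<in> T2 \<and> t' \<in> T2 \<and> linked T y\<^sub>0 t t'}\<^sup>*" if "t \<in> T2" "t' \<in> T2" for t t'
    by (rule linked_connected[OF T q y0 cond that])
qed

lemma eta_primitive_component:
  assumes q: "quasi_thin Y T" and orth: "card (orth_set Y T) = 1" "orth_set Y T \<subseteq> valency_part Y T 1"
    and i: "i \<in> I_classes_off Y T y\<^sub>0"
  shows "e_eta X y\<^sub>0 (U_class Y T y\<^sub>0 i) \<in> central_primitive_idempotents (X \<times> Y) TW"
proof -
  obtain h where h: "orth_set Y T = {h}" using orth(1) by (rule card_1_singletonE)
  interpret orth: thin_orth Y T h by unfold_locales (use T q h orth(2) in auto)
  note U = orth.U_class_components[OF y0 i]
  show ?thesis
  proof (rule eta_primitive[OF q U(1,2)])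
    show "t \<in> U_class Y T y\<^sub>0 i \<longleftrightarrow> t' \<in> U_class Y T y\<^sub>0 i" if "t \<in> valency_part Y T 2" "t' \<in> valency_part Y T 2" "linked T y\<^sub>0 t t'" for t t'
      using U(3)[OF that(1,2)] U(4)[OF that(1,2)] that(3) by blast
    fix t t' assume t: "t \<in> U_class Y T y\<^sub>0 i" "t' \<in> U_class Y T y\<^sub>0 i"
    then have t2: "t \<in> valency_part Y T 2" "t' \<in> valency_part Y T 2" using U(1) by blast+
    then have "linked T y\<^sub>0 t t'" using U(3)[OF t2 t(1)] t(2) by blast
    then show "(t, t') \<in> {(t, t'). t \<in> valency_part Y T 2 \<and> t' \<in> valency_part Y T 2 \<and> linked T y\<^sub>0 t t'}\<^sup>*"
      using t2 by blast
  qed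
qed

lemma U_classes_cover:
  assumes q: "quasi_thin Y T" and orth: "card (orth_set Y T) = 1" "orth_set Y T \<subseteq> valency_part Y T 1"
  shows "\<Union>(U_class Y T y\<^sub>0 ` I_classes_off Y T y\<^sub>0) = T2"
proof -
  obtain h where h: "orth_set Y T = {h}" using orth(1) by (rule card_1_singletonE)
  interpret orth: thin_orth Y T h by unfold_locales (use T q h orth(2) in auto)
  show ?thesis 
  proof (intro equalityI subsetI)
    fix t assume "t \<in> \<Union>(U_class Y T y\<^sub>0 ` I_classes_off Y T y\<^sub>0)"
    then show "t \<in> T2" using orth.U_class_components(1)[OF y0] by blast
  next
    fix t assume "t \<in> T2"
    then obtain i where "i \<in> I_classes_off Y T y\<^sub>0" "t \<in> U_class Y T y\<^sub>0 i" by (rule orth.U_class_cover[OF y0])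
    then show "t \<in> \<Union>(U_class Y T y\<^sub>0 ` I_classes_off Y T y\<^sub>0)" by blast
  qed
qed

end

theorem theorem4p1:
  fixes X :: "'a set" and S :: "('a \<times> 'a) set set"
    and Y :: "'b set" and T :: "('b \<times> 'b) set set"
    and x\<^sub>0 :: 'a and y\<^sub>0 :: 'b
  assumes "scheme X S" and "scheme Y T"
    and "quasi_thin Y T \<or> one_class_scheme T"
    and "x\<^sub>0 \<in> X" and "y\<^sub>0 \<in> Y"
  shows
    "(thin Y T \<or> one_class_scheme T \<longrightarrow>
       central_primitive_idempotents (X \<times> Y)
           (terwilliger_algebra (X \<times> Y) (wreath X S Y T) (x\<^sub>0, y\<^sub>0)) =
         {trivial_idempotent_T (X \<times> Y) (wreath X S Y T) (x\<^sub>0, y\<^sub>0)} \<union>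
         {e_tilde X S Y T x\<^sub>0 y\<^sub>0 \<chi> | \<chi>.
            \<chi> \<in> Irr_nontrivial_T (Ft X y\<^sub>0 (Id_on Y)) (Ut X S Y T y\<^sub>0 (Id_on Y)) (x\<^sub>0, y\<^sub>0)} \<union>
         (\<Union>t \<in> T - {Id_on Y}.
            {e_bar X S Y T y\<^sub>0 t \<phi> | \<phi>. \<phi> \<in> Irr_nontrivial_A (Ft X y\<^sub>0 t) (Ut X S Y T y\<^sub>0 t)})) \<and>
     (quasi_thin Y T \<and>
        (orth_set Y T \<noteq> {} \<and> orth_set Y T \<subseteq> valency_part Y T 2 \<or> card (orth_set Y T) \<ge> 2) \<longrightarrow>
       central_primitive_idempotents (X \<times> Y)
           (terwilliger_algebra (X \<times> Y) (wreath X S Y T) (x\<^sub>0, y\<^sub>0)) =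
         {trivial_idempotent_T (X \<times> Y) (wreath X S Y T) (x\<^sub>0, y\<^sub>0)} \<union>
         {e_tilde X S Y T x\<^sub>0 y\<^sub>0 \<chi> | \<chi>.
            \<chi> \<in> Irr_nontrivial_T (Ft X y\<^sub>0 (Id_on Y)) (Ut X S Y T y\<^sub>0 (Id_on Y)) (x\<^sub>0, y\<^sub>0)} \<union>
         (\<Union>t \<in> valency_part Y T 1 - {Id_on Y}.
            {e_bar X S Y T y\<^sub>0 t \<phi> | \<phi>. \<phi> \<in> Irr_nontrivial_A (Ft X y\<^sub>0 t) (Ut X S Y T y\<^sub>0 t)}) \<union>
         (\<Union>t \<in> valency_part Y T 2. {e_hat X S y\<^sub>0 t \<psi> | \<psi>. \<psi> \<in> Irr_nontrivial_A X S}) \<union>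
         {e_eta X y\<^sub>0 (valency_part Y T 2)}) \<and>
     (quasi_thin Y T \<and> card (orth_set Y T) = 1 \<and> orth_set Y T \<subseteq> valency_part Y T 1 \<longrightarrow>
       central_primitive_idempotents (X \<times> Y)
           (terwilliger_algebra (X \<times> Y) (wreath X S Y T) (x\<^sub>0, y\<^sub>0)) =
         {trivial_idempotent_T (X \<times> Y) (wreath X S Y T) (x\<^sub>0, y\<^sub>0)} \<union>
         {e_tilde X S Y T x\<^sub>0 y\<^sub>0 \<chi> | \<chi>.
            \<chi> \<in> Irr_nontrivial_T (Ft X y\<^sub>0 (Id_on Y)) (Ut X S Y T y\<^sub>0 (Id_on Y)) (x\<^sub>0, y\<^sub>0)} \<union>
         (\<Union>t \<in> valency_part Y T 1 - {Id_on Y}.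
            {e_bar X S Y T y\<^sub>0 t \<phi> | \<phi>. \<phi> \<in> Irr_nontrivial_A (Ft X y\<^sub>0 t) (Ut X S Y T y\<^sub>0 t)}) \<union>
         (\<Union>t \<in> valency_part Y T 2. {e_hat X S y\<^sub>0 t \<psi> | \<psi>. \<psi> \<in> Irr_nontrivial_A X S}) \<union>
         {e_eta X y\<^sub>0 (U_class Y T y\<^sub>0 i) | i. i \<in> I_classes_off Y T y\<^sub>0})"
proof -
  interpret pointed_wreath X S Y T x\<^sub>0 y\<^sub>0 by unfold_locales (fact assms)+
  show ?thesis
  proof (intro conjI impI)
    assume "thin Y T \<or> one_class_scheme T"
    then show "central_primitive_idempotents (X \<times> Y) TW =
         {e1} \<union>
         {e_tilde X S Y T x\<^sub>0 y\<^sub>0 \<chi> | \<chi>.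
            \<chi> \<in> Irr_nontrivial_T (Ft X y\<^sub>0 (Id_on Y)) (Ut X S Y T y\<^sub>0 (Id_on Y)) (x\<^sub>0, y\<^sub>0)} \<union>
         (\<Union>t \<in> T - {Id_on Y}.
            {e_bar X S Y T y\<^sub>0 t \<phi> | \<phi>. \<phi> \<in> Irr_nontrivial_A (Ft X y\<^sub>0 t) (Ut X S Y T y\<^sub>0 t)})"
      by (rule cpis_thin_or_one_class)
  next
    assume a: "quasi_thin Y T \<and>
        (orth_set Y T \<noteq> {} \<and> orth_set Y T \<subseteq> valency_part Y T 2 \<or> card (orth_set Y T) \<ge> 2)"
    then have prim: "e_eta X y\<^sub>0 T2 \<in> central_primitive_idempotents (X \<times> Y) TW"
      by (intro eta_primitive_connected) blast+
    have "\<Union>{T2} = T2" by simp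
    from cpis_quasi_thin[OF conjunct1[OF a] this] prim
    show "central_primitive_idempotents (X \<times> Y) TW =
         {e1} \<union>
         {e_tilde X S Y T x\<^sub>0 y\<^sub>0 \<chi> | \<chi>.
            \<chi> \<in> Irr_nontrivial_T (Ft X y\<^sub>0 (Id_on Y)) (Ut X S Y T y\<^sub>0 (Id_on Y)) (x\<^sub>0, y\<^sub>0)} \<union>
         (\<Union>t \<in> valency_part Y T 1 - {Id_on Y}.
            {e_bar X S Y T y\<^sub>0 t \<phi> | \<phi>. \<phi> \<in> Irr_nontrivial_A (Ft X y\<^sub>0 t) (Ut X S Y T y\<^sub>0 t)}) \<union>
         (\<Union>t \<in> valency_part Y T 2. {e_hat X S y\<^sub>0 t \<psi> | \<psi>. \<psi> \<in> Irr_nontrivial_A X S}) \<union>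
         {e_eta X y\<^sub>0 (valency_part Y T 2)}"
      by (simp only: singleton_iff image_insert image_empty)
  next
    assume a: "quasi_thin Y T \<and> card (orth_set Y T) = 1 \<and> orth_set Y T \<subseteq> valency_part Y T 1"
    then have q: "quasi_thin Y T" and orth: "card (orth_set Y T) = 1" "orth_set Y T \<subseteq> valency_part Y T 1"
      by blast+
    have "e_eta X y\<^sub>0 U \<in> central_primitive_idempotents (X \<times> Y) TW"
      if "U \<in> U_class Y T y\<^sub>0 ` I_classes_off Y T y\<^sub>0" for U
      using that eta_primitive_component[OF q orth] by blast
    note main = cpis_quasi_thin[OF q U_classes_cover[OF q orth] this]
    have "e_eta X y\<^sub>0 ` U_class Y T y\<^sub>0 ` I_classes_off Y T y\<^sub>0 =
        {e_eta X y\<^sub>0 (U_class Y T y\<^sub>0 i) | i. i \<in> I_classes_off Y T y\<^sub>0}" by blast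
    with main show "central_primitive_idempotents (X \<times> Y) TW =
         {e1} \<union>
         {e_tilde X S Y T x\<^sub>0 y\<^sub>0 \<chi> | \<chi>.
            \<chi> \<in> Irr_nontrivial_T (Ft X y\<^sub>0 (Id_on Y)) (Ut X S Y T y\<^sub>0 (Id_on Y)) (x\<^sub>0, y\<^sub>0)} \<union>
         (\<Union>t \<in> valency_part Y T 1 - {Id_on Y}.
            {e_bar X S Y T y\<^sub>0 t \<phi> | \<phi>. \<phi> \<in> Irr_nontrivial_A (Ft X y\<^sub>0 t) (Ut X S Y T y\<^sub>0 t)}) \<union>
         (\<Union>t \<in> valency_part Y T 2. {e_hat X S y\<^sub>0 t \<psi> | \<psi>. \<psi> \<in> Irr_nontrivial_A X S}) \<union>
         {e_eta X y\<^sub>0 (U_class Y T y\<^sub>0 i) | i. i \<in> I_classes_off Y T y\<^sub>0}"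
      by (simp only:)
  qed
qed

end
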